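(* Let $n\ge2$, $s\in\mathbb{R}$ and $p,q\in\,]0,\infty]$ satisfy $s\ge\frac1p+(n-1)\big(\frac1p-1\big)_+$, and suppose that $q\le1$ holds in the case of equality. Then there is an inclusion $$B^s_{p,q}(\mathbb{R}^n)\subset C(\mathbb{R},\mathcal{D}'(\mathbb{R}^{n-1})),$$ and on $B^s_{p,q}(\mathbb{R}^n)$ the working definition of $\gamma_0$ amounts to a restriction of the natural trace on $C(\mathbb{R},\mathcal{D}'(\mathbb{R}^{n-1}))$; that is, for every $u\in B^s_{p,q}(\mathbb{R}^n)$ the series $$\gamma_0u=\sum_{j=0}^\infty\mathcal{F}^{-1}(\Phi_j\mathcal{F}u)\big|_{x_n=0}$$ converges in $\mathcal{D}'(\mathbb{R}^{n-1})$ and $\gamma_0u=u(0)$, where $u(0)$ is the value at $t=0$ of $u$ regarded as an element of $C(\mathbb{R},\mathcal{D}'(\mathbb{R}^{n-1}))$.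
   Context: Notation: $a_+=\max(a,0)$, $1/\infty=0$, $x=(x',x_n)$ with $x'\in\mathbb{R}^{n-1}$. Besov spaces. Let $\Psi\colon\mathbb{R}\to\mathbb{R}$ be a $C^\infty$ function with $\Psi(t)=1$ for $t<11/10$ and $\Psi(t)=0$ for $t>13/10$. On $\mathbb{R}^n$ put $\Psi_j(\xi)=\Psi(2^{-j}|\xi|)$ for $j\ge0$, $\Phi_0=\Psi_0$ and $\Phi_j=\Psi_j-\Psi_{j-1}$ for $j\ge1$, so that $1=\sum_{j\ge0}\Phi_j$. For $s\in\mathbb{R}$ and $p,q\in\,]0,\infty]$, $B^s_{p,q}(\mathbb{R}^n)$ is the set of $u\in\mathcal{S}'(\mathbb{R}^n)$ with $$\|u\|_{B^s_{p,q}}=\Big(\sum_{k=0}^\infty 2^{skq}\|\mathcal{F}^{-1}(\Phi_k\hat u)\|_{L_p}^q\Big)^{1/q}<\infty$$ (supremum over $k$ if $q=\infty$). Working definition of the trace: for $u\in\mathcal{S}'(\mathbb{R}^n)$, $\gamma_0u=\sum_{j=0}^\infty\mathcal{F}^{-1}(\Phi_j\mathcal{F}u)|_{x_n=0}$ whenever the series converges in $\mathcal{D}'(\mathbb{R}^{n-1})$; each summand is the restriction of an entire analytic function. Natural (distributional) trace: $C(\mathbb{R},\mathcal{D}'(\mathbb{R}^{n-1}))$ is the space of continuous maps $f\colon\mathbb{R}\to\mathcal{D}'(\mathbb{R}^{n-1})$, where $\mathcal{D}'(\mathbb{R}^{n-1})$ has the weak-$*$ topology; it is regarded as a subspace of $\mathcal{D}'(\mathbb{R}^n)$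 by identifying $f$ with the distribution $\varphi\mapsto\int_{\mathbb{R}}\langle f(t),\varphi(\cdot,t)\rangle\,dt$, $\varphi\in C_0^\infty(\mathbb{R}^n)$. The natural trace of $f$ is $f(0)$. *)

theory Defs
  imports "HOL-Probability.Probability"
begin

section \<open>Smooth functions, test functions and distributions\<close>

text \<open>\<open>pderivs [v\<^sub>1, \<dots>, v\<^sub>m] f\<close> is \<open>\<partial>\<^bsub>v\<^sub>1\<^esub> \<dots> \<partial>\<^bsub>v\<^sub>m\<^esub> f\<close>. For smooth \<open>f\<close>, lists of basis
  vectors play the role of multi-indices, the length of the list being the order.\<close>

primrec pderivs :: "'a::euclidean_space list \<Rightarrow> ('a \<Rightarrow> 'b::real_normed_vector) \<Rightarrow> 'a \<Rightarrow> 'b" where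
  "pderivs [] f = f"
| "pderivs (v # vs) f = (\<lambda>x. frechet_derivative (pderivs vs f) (at x) v)"

definition multi_indices :: "nat \<Rightarrow> 'a::euclidean_space list set" where
  "multi_indices N = {vs. set vs \<subseteq> Basis \<and> length vs \<le> N}"

text \<open>Differentiability of all iterated partial derivatives also makes all of them continuous,
  so this is the class \<open>C\<^sup>\<infinity>\<close>.\<close>

definition smooth :: "('a::euclidean_space \<Rightarrow> 'b::real_normed_vector) \<Rightarrow> bool" where
  "smooth f \<longleftrightarrow> (\<forall>vs. set vs \<subseteq> Basis \<longrightarrow> (\<forall>x. pderivs vs f differentiable (at x)))"

definition test_functions_on :: "'a::euclidean_space set \<Rightarrow> ('a \<Rightarrow> complex) set" where
  "test_functions_on K = {\<phi>. smooth \<phi> \<and> (\<forall>x. x \<notin> K \<longrightarrow> \<phi> x = 0)}"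

definition test_functions :: "('a::euclidean_space \<Rightarrow> complex) set" where
  "test_functions = (\<Union>K\<in>{K. compact K}. test_functions_on K)"

definition linear_functional_on ::
    "('a \<Rightarrow> complex) set \<Rightarrow> (('a \<Rightarrow> complex) \<Rightarrow> complex) \<Rightarrow> bool" where
  "linear_functional_on V u \<longleftrightarrow>
     (\<forall>\<phi>\<in>V. \<forall>\<psi>\<in>V. u (\<lambda>x. \<phi> x + \<psi> x) = u \<phi> + u \<psi>) \<and>
     (\<forall>c. \<forall>\<phi>\<in>V. u (\<lambda>x. c * \<phi> x) = c * u \<phi>)"

text \<open>A distribution is a functional on \<^const>\<open>test_functions\<close>; outside of this set it takes the
  value \<^const>\<open>undefined\<close> (as in \<^const>\<open>extensional\<close>), so that equality of distributions is equality
  in HOL.\<close>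

definition distributions :: "(('a::euclidean_space \<Rightarrow> complex) \<Rightarrow> complex) set" where
  "distributions = {u \<in> extensional test_functions.
     linear_functional_on test_functions u \<and>
     (\<forall>K. compact K \<longrightarrow> (\<exists>C N. \<forall>\<phi>\<in>test_functions_on K.
        norm (u \<phi>) \<le> C * (\<Sum>vs\<in>multi_indices N. SUP x. norm (pderivs vs \<phi> x))))}"

text \<open>The weak-* topology, i.e. that of pointwise convergence on test functions.\<close>

definition distr_topology :: "(('a::euclidean_space \<Rightarrow> complex) \<Rightarrow> complex) topology" where
  "distr_topology =
     subtopology (product_topology (\<lambda>_. euclidean) test_functions) distributions"

section \<open>Tempered distributions and the Fourier transformation\<close>

definition schwartz :: "('a::euclidean_space \<Rightarrow> complex) set" where
  "schwartz = {\<phi>. smooth \<phi> \<and> (\<forall>m vs. set vs \<subseteq> Basis \<longrightarrow>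
     bdd_above (range (\<lambda>x. (1 + norm x) ^ m * norm (pderivs vs \<phi> x))))}"

definition tempered :: "(('a::euclidean_space \<Rightarrow> complex) \<Rightarrow> complex) set" where
  "tempered = {u \<in> extensional schwartz.
     linear_functional_on schwartz u \<and>
     (\<exists>C N. \<forall>\<phi>\<in>schwartz. norm (u \<phi>) \<le>
        C * (\<Sum>vs\<in>multi_indices N. SUP x. (1 + norm x) ^ N * norm (pderivs vs \<phi> x)))}"

text \<open>\<open>\<S>' \<subset> \<D>'\<close>.\<close>

definition distr_of_tempered ::
    "(('a::euclidean_space \<Rightarrow> complex) \<Rightarrow> complex) \<Rightarrow> ('a \<Rightarrow> complex) \<Rightarrow> complex" where
  "distr_of_tempered u = restrict u test_functions"

definition fourier :: "('a::euclidean_space \<Rightarrow> complex) \<Rightarrow> 'a \<Rightarrow> complex" where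
  "fourier \<phi> \<xi> = (LINT x|lborel. exp (- \<i> * of_real (x \<bullet> \<xi>)) * \<phi> x)"

definition inv_fourier :: "('a::euclidean_space \<Rightarrow> complex) \<Rightarrow> 'a \<Rightarrow> complex" where
  "inv_fourier \<phi> x =
     of_real (1 / (2 * pi) ^ DIM('a)) * (LINT \<xi>|lborel. exp (\<i> * of_real (x \<bullet> \<xi>)) * \<phi> \<xi>)"

definition tfourier ::
    "(('a::euclidean_space \<Rightarrow> complex) \<Rightarrow> complex) \<Rightarrow> ('a \<Rightarrow> complex) \<Rightarrow> complex" where
  "tfourier u = (\<lambda>\<phi>\<in>schwartz. u (fourier \<phi>))"

definition inv_tfourier ::
    "(('a::euclidean_space \<Rightarrow> complex) \<Rightarrow> complex) \<Rightarrow> ('a \<Rightarrow> complex) \<Rightarrow> complex" where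
  "inv_tfourier u = (\<lambda>\<phi>\<in>schwartz. u (inv_fourier \<phi>))"

definition tmult :: "('a::euclidean_space \<Rightarrow> real) \<Rightarrow>
    (('a \<Rightarrow> complex) \<Rightarrow> complex) \<Rightarrow> ('a \<Rightarrow> complex) \<Rightarrow> complex" where
  "tmult a u = (\<lambda>\<phi>\<in>schwartz. u (\<lambda>\<xi>. of_real (a \<xi>) * \<phi> \<xi>))"

section \<open>Littlewood-Paley decomposition\<close>

definition cutoff :: "(real \<Rightarrow> real) \<Rightarrow> bool" where
  "cutoff \<Psi> \<longleftrightarrow> smooth \<Psi> \<and> (\<forall>t < 11/10. \<Psi> t = 1) \<and> (\<forall>t > 13/10. \<Psi> t = 0)"

definition Psi :: "(real \<Rightarrow> real) \<Rightarrow> nat \<Rightarrow> 'a::euclidean_space \<Rightarrow> real" where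
  "Psi \<Psi> j \<xi> = \<Psi> (2 powr (- real j) * norm \<xi>)"

definition Phi :: "(real \<Rightarrow> real) \<Rightarrow> nat \<Rightarrow> 'a::euclidean_space \<Rightarrow> real" where
  "Phi \<Psi> j \<xi> = (if j = 0 then Psi \<Psi> 0 \<xi> else Psi \<Psi> j \<xi> - Psi \<Psi> (j - 1) \<xi>)"

definition lp_block :: "(real \<Rightarrow> real) \<Rightarrow> nat \<Rightarrow>
    (('a::euclidean_space \<Rightarrow> complex) \<Rightarrow> complex) \<Rightarrow> ('a \<Rightarrow> complex) \<Rightarrow> complex" where
  "lp_block \<Psi> j u = inv_tfourier (tmult (Phi \<Psi> j) (tfourier u))"

text \<open>The distribution given by a (locally integrable) function, and conversely the continuous
  function giving a regular distribution. By Paley--Wiener--Schwartz, \<open>lp_block \<Psi> j u\<close> is given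
  by the restriction of an entire function to \<open>\<real>\<^sup>n\<close>, which is the only continuous function giving
  it.\<close>

definition distr_of_fun ::
    "('a::euclidean_space \<Rightarrow> complex) \<Rightarrow> ('a \<Rightarrow> complex) \<Rightarrow> complex" where
  "distr_of_fun g = (\<lambda>\<phi>\<in>test_functions. LINT x|lborel. g x * \<phi> x)"

definition fun_of_distr ::
    "(('a::euclidean_space \<Rightarrow> complex) \<Rightarrow> complex) \<Rightarrow> 'a \<Rightarrow> complex" where
  "fun_of_distr v = (THE g. continuous_on UNIV g \<and> distr_of_fun g = v)"

definition lp_fun :: "(real \<Rightarrow> real) \<Rightarrow> nat \<Rightarrow>
    (('a::euclidean_space \<Rightarrow> complex) \<Rightarrow> complex) \<Rightarrow> 'a \<Rightarrow> complex" where
  "lp_fun \<Psi> j u = fun_of_distr (distr_of_tempered (lp_block \<Psi> j u))"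

section \<open>Besov spaces\<close>

text \<open>\<open>a\<^sup>r\<close> for \<open>a \<in> [0,\<infinity>]\<close> and \<open>r > 0\<close>.\<close>

definition epow :: "ennreal \<Rightarrow> real \<Rightarrow> ennreal" where
  "epow a r = (if a = \<infinity> then \<infinity> else ennreal (enn2real a powr r))"

definition Lp_norm :: "ereal \<Rightarrow> ('a::euclidean_space \<Rightarrow> complex) \<Rightarrow> ennreal" where
  "Lp_norm p g =
     (if p = \<infinity> then esssup lborel (\<lambda>x. ennreal (norm (g x)))
      else epow (\<integral>\<^sup>+ x. ennreal (norm (g x) powr real_of_ereal p) \<partial>lborel) (1 / real_of_ereal p))"

definition besov_norm :: "(real \<Rightarrow> real) \<Rightarrow> real \<Rightarrow> ereal \<Rightarrow> ereal \<Rightarrow>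
    (('a::euclidean_space \<Rightarrow> complex) \<Rightarrow> complex) \<Rightarrow> ennreal" where
  "besov_norm \<Psi> s p q u =
     (if q = \<infinity> then SUP k. ennreal (2 powr (s * real k)) * Lp_norm p (lp_fun \<Psi> k u)
      else epow (\<Sum>k. ennreal (2 powr (s * real k * real_of_ereal q)) *
                      epow (Lp_norm p (lp_fun \<Psi> k u)) (real_of_ereal q))
                (1 / real_of_ereal q))"

definition besov :: "(real \<Rightarrow> real) \<Rightarrow> real \<Rightarrow> ereal \<Rightarrow> ereal \<Rightarrow>
    (('a::euclidean_space \<Rightarrow> complex) \<Rightarrow> complex) set" where
  "besov \<Psi> s p q = {u \<in> tempered. besov_norm \<Psi> s p q u < \<infinity>}"

section \<open>Traces\<close>

text \<open>\<open>\<real>\<^sup>n\<close> is modelled as \<open>'a \<times> real\<close> with \<open>'a\<close> a Euclidean space of dimension \<open>n - 1\<close>; a point is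
  \<open>x = (x', x\<^sub>n)\<close>. \<open>has_working_trace \<Psi> u w\<close> says that the series defining \<open>\<gamma>\<^sub>0 u\<close> converges in
  \<open>\<D>'(\<real>\<^sup>n\<^sup>-\<^sup>1)\<close> with sum \<open>w\<close>.\<close>

definition has_working_trace :: "(real \<Rightarrow> real) \<Rightarrow>
    (('a::euclidean_space \<times> real \<Rightarrow> complex) \<Rightarrow> complex) \<Rightarrow>
    (('a \<Rightarrow> complex) \<Rightarrow> complex) \<Rightarrow> bool" where
  "has_working_trace \<Psi> u w \<longleftrightarrow>
     limitin distr_topology
       (\<lambda>N. \<lambda>\<phi>\<in>test_functions. \<Sum>j<N. distr_of_fun (\<lambda>x'. lp_fun \<Psi> j u (x', 0)) \<phi>)
       w sequentially"

definition continuous_curves :: "(real \<Rightarrow> ('a::euclidean_space \<Rightarrow> complex) \<Rightarrow> complex) set" where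
  "continuous_curves = {f. continuous_map euclideanreal distr_topology f}"

text \<open>The identification of \<open>f \<in> C(\<real>, \<D>'(\<real>\<^sup>n\<^sup>-\<^sup>1))\<close> with an element of \<open>\<D>'(\<real>\<^sup>n)\<close>.\<close>

definition distr_of_curve :: "(real \<Rightarrow> ('a::euclidean_space \<Rightarrow> complex) \<Rightarrow> complex) \<Rightarrow>
    ('a \<times> real \<Rightarrow> complex) \<Rightarrow> complex" where
  "distr_of_curve f = (\<lambda>\<phi>\<in>test_functions. LINT t|lborel. f t (\<lambda>x'. \<phi> (x', t)))"

end

theory Submission
  imports Defs
begin

text \<open>
  Let \<open>u\<close> be in the Besov space and \<open>u\<^sub>j\<close> its \<open>j\<close>-th Littlewood--Paley block, a continuous function of
  polynomial growth. The blocks reproduce under convolution, \<open>u\<^sub>j = \<kappa>\<^sub>j * u\<^sub>j\<close>, with kernels that are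
  dilates by \<open>2\<^sup>j\<close> of one Schwartz function. Hence \<open>\<bar>u\<^sub>j\<bar>\<^sup>p\<close> is dominated by its own averages at scale
  \<open>2\<^sup>-\<^sup>j\<close> (for \<open>p < 1\<close> through Peetre's maximal function), and integration over a hyperplane gives, with
  \<open>\<sigma> = 1/p + (n - 1)(1/p - 1)\<^sub>+\<close> and any compact set \<open>K\<close>, the bound
  \<open>\<integral>\<^sub>K \<bar>u\<^sub>j(x', t)\<bar> dx' \<le> C 2\<^bsup>\<sigma>j\<^esup> \<parallel>u\<^sub>j\<parallel>\<^sub>p\<close> uniformly in \<open>t\<close>. The assumptions on \<open>s\<close> and \<open>q\<close> make the right-hand
  side summable over \<open>j\<close>, so \<open>\<Sum>\<^sub>j u\<^sub>j(\<cdot>, t)\<close> converges in the space of distributions to a curve that is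
  continuous in \<open>t\<close>, and by Fubini's theorem that curve represents \<open>\<Sum>\<^sub>j u\<^sub>j = u\<close>. A continuous curve is
  determined by the distribution it defines, as testing with tensor products shows.
\<close>


section \<open>Smooth functions\<close>

text \<open>The exponent \<sigma> has two sources. An average at scale 2^(-j), integrated over a
  hyperplane instead of the whole space, costs a factor 2^j, hence 2^(j/p) after the p-th root.
  Passing from L_p on the slice to L_1 on K is free for p \<ge> 1, since K has finite measure; for p
  < 1 it takes a supremum bound of Nikolskii type, which adds (n - 1)(1/p - 1). L_1 on compact sets
  is enough because test functions are bounded. The obstacle is that u is only a functional, while
  the estimates concern functions. The bridge is the interchange of u with an integral of translates
  of one Schwartz function; it yields both the blocks as functions and their reproducing formula.
  All constants must be uniform in j. For the kernels this follows by dilation. For Peetre's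
  argument it holds because the polynomial order of growth of a block comes from the order of u
  alone, so that one decay exponent can be fixed for all blocks.\<close>

abbreviation pd :: "'a::euclidean_space \<Rightarrow> ('a \<Rightarrow> 'b::real_normed_vector) \<Rightarrow> 'a \<Rightarrow> 'b" where
  "pd b f \<equiv> \<lambda>x. frechet_derivative f (at x) b"

lemma pderivs_append: "pderivs (us @ vs) f = pderivs us (pderivs vs f)"
  by (induction us) auto

lemma smooth_differentiable: "smooth f \<Longrightarrow> f differentiable (at x)"
  unfolding smooth_def by (drule spec[of _ "[]"]) auto

lemma smooth_has_derivative: "smooth f \<Longrightarrow> (f has_derivative frechet_derivative f (at x)) (at x)"
  using smooth_differentiable frechet_derivative_works by blast

lemma smooth_pderivs:
  assumes "smooth f" "set us \<subseteq> Basis"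
  shows "smooth (pderivs us f)"
  unfolding smooth_def
proof (intro allI impI)
  fix vs :: "'a list" and x assume "set vs \<subseteq> Basis"
  then show "pderivs vs (pderivs us f) differentiable at x"
    using assms unfolding pderivs_append[symmetric] smooth_def by auto
qed

lemma smooth_pd: "smooth f \<Longrightarrow> b \<in> Basis \<Longrightarrow> smooth (pd b f)"
  using smooth_pderivs[of f "[b]"] by simp

lemma smooth_continuous_on: "smooth f \<Longrightarrow> continuous_on A f"
  by (simp add: smooth_differentiable continuous_at_imp_continuous_on differentiable_imp_continuous_within)

lemma smooth_measurable: "smooth f \<Longrightarrow> f \<in> borel_measurable borel"
  by (simp add: smooth_continuous_on borel_measurable_continuous_onI)

text \<open>Nearly all smoothness proofs exhibit a class of functions that is stable under partial
  derivatives.\<close>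

lemma pderivs_in_class:
  assumes "\<And>f b. f \<in> S \<Longrightarrow> b \<in> Basis \<Longrightarrow> pd b f \<in> S"
    and "f \<in> S" "set vs \<subseteq> Basis"
  shows "pderivs vs f \<in> S"
  using assms(3) by (induction vs) (auto simp: assms(1,2))

lemma smooth_classI:
  assumes "\<And>f x. f \<in> S \<Longrightarrow> f differentiable (at x)"
    and "\<And>f b. f \<in> S \<Longrightarrow> b \<in> Basis \<Longrightarrow> pd b f \<in> S"
    and "f \<in> S"
  shows "smooth f"
  unfolding smooth_def using pderivs_in_class[of S, OF assms(2,3)] assms(1) by blast

text \<open>Derivatives of members are again members, so the weighted bounds need to be checked for
  the members only and then hold for all iterated derivatives.\<close>

lemma schwartz_classI:
  assumes "\<And>f x. f \<in> S \<Longrightarrow> f differentiable (at x)"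
    and "\<And>f b. f \<in> S \<Longrightarrow> b \<in> Basis \<Longrightarrow> pd b f \<in> S"
    and "\<And>f m. f \<in> S \<Longrightarrow> \<exists>C. \<forall>x. (1 + norm x) ^ m * norm (f x) \<le> C"
    and "f \<in> S"
  shows "f \<in> schwartz"
proof -
  have "smooth f" using smooth_classI[of S, OF assms(1,2,4)] .
  moreover have "bdd_above (range (\<lambda>x. (1 + norm x) ^ m * norm (pderivs vs f x)))"
    if "set vs \<subseteq> Basis" for m vs
    using assms(3)[OF pderivs_in_class[of S, OF assms(2,4) that], of m]
    by (auto simp: bdd_above_def)
  ultimately show ?thesis by (auto simp: schwartz_def)
qed

lemma schwartz_smooth: "\<phi> \<in> schwartz \<Longrightarrow> smooth \<phi>"
  by (simp add: schwartz_def)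

lemma schwartz_pderivs: "\<phi> \<in> schwartz \<Longrightarrow> set vs \<subseteq> Basis \<Longrightarrow> pderivs vs \<phi> \<in> schwartz"
  unfolding schwartz_def by (auto simp: smooth_pderivs pderivs_append[symmetric])

lemma schwartz_pd: "\<phi> \<in> schwartz \<Longrightarrow> b \<in> Basis \<Longrightarrow> pd b \<phi> \<in> schwartz"
  using schwartz_pderivs[of \<phi> "[b]"] by simp

lemma schwartz_bounded:
  assumes "\<phi> \<in> schwartz"
  obtains C where "C > 0" "\<And>x. (1 + norm x) ^ m * norm (\<phi> x) \<le> C"
proof -
  have "bdd_above (range (\<lambda>x. (1 + norm x) ^ m * norm (pderivs [] \<phi> x)))"
    using assms unfolding schwartz_def by (elim CollectE conjE allE[of _ m] allE[of _ "[]"]) simp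
  then obtain C where "\<And>x. (1 + norm x) ^ m * norm (\<phi> x) \<le> C"
    by (auto simp: bdd_above_def)
  then have "\<And>x. (1 + norm x) ^ m * norm (\<phi> x) \<le> max C 1"
    by (meson max.coboundedI1)
  then show ?thesis using that[of "max C 1"] by simp
qed

lemma pd_eqI: "(f has_derivative f') (at x) \<Longrightarrow> frechet_derivative f (at x) b = f' b"
  using frechet_derivative_at by metis

lemma frechet_derivative_Basis:
  fixes f :: "'a::euclidean_space \<Rightarrow> 'b::real_normed_vector"
  assumes "f differentiable (at x)"
  shows "frechet_derivative f (at x) v = (\<Sum>b\<in>Basis. (v \<bullet> b) *\<^sub>R pd b f x)"
proof -
  interpret bounded_linear "frechet_derivative f (at x)"
    using assms frechet_derivative_works has_derivative_bounded_linear by blast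
  have "frechet_derivative f (at x) v = frechet_derivative f (at x) (\<Sum>b\<in>Basis. (v \<bullet> b) *\<^sub>R b)"
    by (simp add: euclidean_representation)
  then show ?thesis by (simp add: sum scaleR)
qed

lemma norm_frechet_derivative_le:
  fixes f :: "'a::euclidean_space \<Rightarrow> 'b::real_normed_vector"
  assumes "f differentiable (at x)"
  shows "norm (frechet_derivative f (at x) v) \<le> (\<Sum>b\<in>Basis. norm (pd b f x)) * norm v"
  unfolding frechet_derivative_Basis[OF assms, of v] sum_distrib_right
  by (rule sum_norm_le) (simp add: mult.commute mult_right_mono Basis_le_norm)

lemma pd_add:
  assumes "f differentiable (at x)" "g differentiable (at x)"
  shows "frechet_derivative (\<lambda>x. f x + g x) (at x) b
    = frechet_derivative f (at x) b + frechet_derivative g (at x) b"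
  using assms unfolding frechet_derivative_works
  by (intro pd_eqI) (auto intro!: has_derivative_add)

lemma pd_mult:
  fixes f g :: "'a::euclidean_space \<Rightarrow> 'b::real_normed_algebra"
  assumes "f differentiable (at x)" "g differentiable (at x)"
  shows "frechet_derivative (\<lambda>x. f x * g x) (at x) b
    = f x * frechet_derivative g (at x) b + frechet_derivative f (at x) b * g x"
  using assms unfolding frechet_derivative_works
  by (intro pd_eqI) (auto intro!: has_derivative_mult)

lemma smooth_const [simp]: "smooth (\<lambda>x. c)"
  by (rule smooth_classI[of "range (\<lambda>c x. c)"]) (auto simp: pd_eqI[OF has_derivative_const])

text \<open>It suffices that the partial derivatives are sums of members of the class.\<close>

inductive_set span_class :: "('a \<Rightarrow> 'b::real_normed_vector) set \<Rightarrow> ('a \<Rightarrow> 'b) set" for S where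
  base: "f \<in> S \<Longrightarrow> f \<in> span_class S"
| add: "f \<in> span_class S \<Longrightarrow> g \<in> span_class S \<Longrightarrow> (\<lambda>x. f x + g x) \<in> span_class S"

lemma span_class_differentiable:
  fixes S :: "('a::euclidean_space \<Rightarrow> 'b::real_normed_vector) set"
  assumes "\<And>f x. f \<in> S \<Longrightarrow> f differentiable (at x)" "f \<in> span_class S"
  shows "f differentiable (at x)"
  using assms(2) by induction (auto simp: assms(1) intro: differentiable_add)

lemma span_class_pd:
  fixes S :: "('a::euclidean_space \<Rightarrow> 'b::real_normed_vector) set"
  assumes "\<And>f x. f \<in> S \<Longrightarrow> f differentiable (at x)"
    and "\<And>f b. f \<in> S \<Longrightarrow> b \<in> Basis \<Longrightarrow> pd b f \<in> span_class S"
    and "f \<in> span_class S" "b \<in> Basis"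
  shows "pd b f \<in> span_class S"
  using assms(3)
proof induction
  case (add f g)
  have "pd b (\<lambda>x. f x + g x) = (\<lambda>x. pd b f x + pd b g x)"
    using span_class_differentiable[OF assms(1)] add by (intro ext pd_add) auto
  then show ?case using span_class.add[OF add.IH] by simp
qed (use assms in auto)

lemma smooth_span_classI:
  fixes S :: "('a::euclidean_space \<Rightarrow> 'b::real_normed_vector) set"
  assumes "\<And>f x. f \<in> S \<Longrightarrow> f differentiable (at x)"
    and "\<And>f b. f \<in> S \<Longrightarrow> b \<in> Basis \<Longrightarrow> pd b f \<in> span_class S"
    and "f \<in> span_class S"
  shows "smooth f"
  by (rule smooth_classI[of "span_class S", OF span_class_differentiable[OF assms(1)]
        span_class_pd[OF assms(1,2)] assms(3)])

lemma schwartz_span_classI: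
  fixes S :: "('a::euclidean_space \<Rightarrow> complex) set"
  assumes "\<And>f x. f \<in> S \<Longrightarrow> f differentiable (at x)"
    and "\<And>f b. f \<in> S \<Longrightarrow> b \<in> Basis \<Longrightarrow> pd b f \<in> span_class S"
    and "\<And>f m. f \<in> S \<Longrightarrow> \<exists>C. \<forall>x. (1 + norm x) ^ m * norm (f x) \<le> C"
    and "f \<in> span_class S"
  shows "f \<in> schwartz"
proof (rule schwartz_classI[of "span_class S", OF span_class_differentiable[OF assms(1)]
        span_class_pd[OF assms(1,2)] _ assms(4)])
  fix f m assume "f \<in> span_class S"
  then show "\<exists>C. \<forall>x. (1 + norm x) ^ m * norm (f x) \<le> C"
  proof induction
    case (add f g)
    then obtain C D where CD: "\<And>x. (1 + norm x) ^ m * norm (f x) \<le> C"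
      "\<And>x. (1 + norm x) ^ m * norm (g x) \<le> D" by auto
    have "(1 + norm x) ^ m * norm (f x + g x) \<le> C + D" for x
    proof -
      have "(1 + norm x) ^ m * norm (f x + g x) \<le> (1 + norm x) ^ m * (norm (f x) + norm (g x))"
        by (intro mult_left_mono norm_triangle_ineq) auto
      also have "\<dots> \<le> C + D" using add_mono[OF CD] by (simp add: algebra_simps)
      finally show ?thesis .
    qed
    then show ?case by blast
  qed (use assms(3) in auto)
qed auto

lemma smooth_add:
  assumes "smooth f" "smooth g"
  shows "smooth (\<lambda>x. f x + g x)"
proof (rule smooth_span_classI[of "Collect smooth"])
  show "(\<lambda>x. f x + g x) \<in> span_class (Collect smooth)"
    using assms by (intro span_class.intros) auto
next
  fix h :: "'a \<Rightarrow> 'b" and b :: 'a assume "h \<in> Collect smooth" "b \<in> Basis"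
  then show "pd b h \<in> span_class (Collect smooth)"
    using smooth_pd[of h b] by (intro span_class.base) simp
qed (simp add: smooth_differentiable)

lemma smooth_mult:
  fixes f g :: "'a::euclidean_space \<Rightarrow> 'b::real_normed_algebra"
  assumes "smooth f" "smooth g"
  shows "smooth (\<lambda>x. f x * g x)"
proof -
  let ?S = "{\<lambda>x. f x * g x | f g :: 'a \<Rightarrow> 'b. smooth f \<and> smooth g}"
  show ?thesis
  proof (rule smooth_span_classI[of ?S])
    fix h :: "'a \<Rightarrow> 'b" and b :: 'a
    assume "h \<in> ?S" and b: "b \<in> Basis"
    then obtain f g where h: "h = (\<lambda>x. f x * g x)" "smooth f" "smooth g" by auto
    have "pd b h = (\<lambda>x. f x * pd b g x + pd b f x * g x)"
      unfolding h by (intro ext pd_mult) (use h smooth_differentiable in auto)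
    moreover have "(\<lambda>x. f x * g x) \<in> span_class ?S" if "smooth f" "smooth g" for f g
      using that by (intro span_class.base) blast
    from this[OF h(2) smooth_pd[OF h(3) b]] this[OF smooth_pd[OF h(2) b] h(3)]
    have "(\<lambda>x. f x * pd b g x) \<in> span_class ?S" "(\<lambda>x. pd b f x * g x) \<in> span_class ?S" .
    ultimately show "pd b h \<in> span_class ?S" by (simp add: span_class.add)
  next
    show "(\<lambda>x. f x * g x) \<in> span_class ?S" using assms by (intro span_class.base) blast
  qed (auto intro!: differentiable_mult simp: smooth_differentiable)
qed

lemma smooth_bounded_linear_comp:
  fixes f :: "'a::euclidean_space \<Rightarrow> 'b::real_normed_vector"
  assumes "smooth f" "bounded_linear h"
  shows "smooth (\<lambda>x. h (f x))"
proof (rule smooth_classI[of "{\<lambda>x. h (f x) | f :: 'a \<Rightarrow> 'b. smooth f}"])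
  fix g and b :: 'a assume "g \<in> {\<lambda>x. h (f x) | f :: 'a \<Rightarrow> 'b. smooth f}" and b: "b \<in> Basis"
  then obtain f where g: "g = (\<lambda>x. h (f x))" "smooth f" by auto
  have "pd b g = (\<lambda>x. h (pd b f x))"
    unfolding g
    by (intro ext pd_eqI bounded_linear.has_derivative[OF assms(2)] smooth_has_derivative g)
  then show "pd b g \<in> {\<lambda>x. h (f x) | f. smooth f}" using smooth_pd[OF g(2) b] by (intro CollectI exI[of _ "pd b f"] conjI)
next
  fix g x assume "g \<in> {\<lambda>x. h (f x) | f :: 'a \<Rightarrow> 'b. smooth f}"
  then show "g differentiable (at x)"
    unfolding differentiable_def
    using bounded_linear.has_derivative[OF assms(2) smooth_has_derivative] by blast
qed (use assms in auto)

lemma smooth_scaleR: "smooth f \<Longrightarrow> smooth (\<lambda>x. c *\<^sub>R f x)"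
  by (rule smooth_bounded_linear_comp) (auto intro: bounded_linear_scaleR_right)

lemma smooth_cmult:
  fixes f :: "'a::euclidean_space \<Rightarrow> 'b::real_normed_algebra"
  shows "smooth f \<Longrightarrow> smooth (\<lambda>x. c * f x)"
  by (rule smooth_bounded_linear_comp) (auto intro: bounded_linear_mult_right)

lemma smooth_diff: "smooth f \<Longrightarrow> smooth g \<Longrightarrow> smooth (\<lambda>x. f x - g x)"
  using smooth_add[OF _ smooth_scaleR[of g "-1"], of f] by simp

lemma smooth_of_real:
  fixes f :: "'a::euclidean_space \<Rightarrow> real"
  shows "smooth f \<Longrightarrow> smooth (\<lambda>x. complex_of_real (f x))"
  by (rule smooth_bounded_linear_comp) (auto intro: bounded_linear_of_real)

lemma span_class_sum:
  assumes "finite I" "I \<noteq> {}" "\<And>i. i \<in> I \<Longrightarrow> f i \<in> span_class S"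
  shows "(\<lambda>x. \<Sum>i\<in>I. f i x) \<in> span_class S"
  using assms
proof (induction rule: finite_ne_induct)
  case (insert i I)
  then have "(\<lambda>x. f i x + (\<Sum>i\<in>I. f i x)) \<in> span_class S" by (intro span_class.add) auto
  then show ?case using insert by simp
qed auto

lemma smooth_affine_comp:
  fixes L :: "'a::euclidean_space \<Rightarrow> 'c::euclidean_space" and f :: "'c \<Rightarrow> 'b::real_normed_vector"
  assumes "smooth f" "bounded_linear L"
  shows "smooth (\<lambda>x. f (L x + a))"
proof -
  let ?S = "{\<lambda>x. f (L x + a) | f :: 'c \<Rightarrow> 'b. smooth f}"
  have der: "((\<lambda>x. f (L x + a)) has_derivative (\<lambda>v. frechet_derivative f (at (L x + a)) (L v))) (at x)"
    if "smooth f" for f :: "'c \<Rightarrow> 'b" and x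
    using bounded_linear_imp_has_derivative[OF assms(2)]
    by (intro has_derivative_compose[of "\<lambda>x. L x + a", OF _ smooth_has_derivative[OF that]])
       (auto intro!: derivative_eq_intros)
  show ?thesis
  proof (rule smooth_span_classI[of ?S])
    \<comment> \<open>The chain rule differentiates f in the direction \<open>L b\<close>, which
      need not be a basis vector; expanding it in the basis returns to partial derivatives.\<close>
    fix g and b :: 'a assume "g \<in> ?S" and b: "b \<in> Basis"
    then obtain f where g: "g = (\<lambda>x. f (L x + a))" "smooth f" by auto
    have "pd b g = (\<lambda>x. \<Sum>c\<in>Basis. (L b \<bullet> c) *\<^sub>R pd c f (L x + a))"
      unfolding g using g(2)
      by (auto simp: pd_eqI[OF der] frechet_derivative_Basis[OF smooth_differentiable] fun_eq_iff)
    also have "\<dots> \<in> span_class ?S"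
    proof (intro span_class_sum span_class.base)
      fix c :: 'c assume c: "c \<in> Basis"
      show "(\<lambda>x. (L b \<bullet> c) *\<^sub>R pd c f (L x + a)) \<in> ?S"
        using smooth_scaleR[OF smooth_pd[OF g(2) c]] by (intro CollectI exI conjI) (rule refl)
    qed auto
    finally show "pd b g \<in> span_class ?S" .
  next
    show "(\<lambda>x. f (L x + a)) \<in> span_class ?S"
      using assms(1) by (auto intro!: span_class.base)
  qed (use der in \<open>auto simp: differentiable_def\<close>)
qed

lemma pderivs_translate:
  "pderivs vs (\<lambda>x. f (x + a)) = (\<lambda>x. pderivs vs f (x + a))"
proof (induction vs)
  case (Cons v vs)
  have "frechet_derivative (\<lambda>x. g (x + a)) (at x) = frechet_derivative g (at (x + a))"
    for g :: "'a \<Rightarrow> 'b" and x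
  proof -
    \<comment> \<open>The two predicates agree for every candidate, so the choice made by
      \<open>frechet_derivative\<close> agrees as well, even where g is not differentiable. No
      smoothness has to be assumed.\<close>
    have "((\<lambda>x. g (x + a)) has_derivative g') (at x) = (g has_derivative g') (at (x + a))" for g'
      by (simp add: has_derivative_at ac_simps)
    then show ?thesis by (simp add: frechet_derivative_def)
  qed
  then show ?case by (simp add: Cons.IH)
qed simp

section \<open>Schwartz functions\<close>

lemma pderivs_add:
  assumes "smooth f" "smooth g" "set vs \<subseteq> Basis"
  shows "pderivs vs (\<lambda>x. f x + g x) = (\<lambda>x. pderivs vs f x + pderivs vs g x)"
  using assms(3)
proof (induction vs)
  case (Cons v vs)
  then show ?case
    using smooth_pderivs[OF assms(1), of vs] smooth_pderivs[OF assms(2), of vs]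
    by (simp add: pd_add smooth_differentiable)
qed simp

lemma pderivs_cmult:
  fixes f :: "'a::euclidean_space \<Rightarrow> 'b::real_normed_algebra"
  assumes "smooth f" "set vs \<subseteq> Basis"
  shows "pderivs vs (\<lambda>x. c * f x) = (\<lambda>x. c * pderivs vs f x)"
  using assms(2)
proof (induction vs)
  case (Cons v vs)
  have "frechet_derivative (\<lambda>x. c * g x) (at x) v = c * frechet_derivative g (at x) v"
    if "smooth g" for x and g :: "'a \<Rightarrow> 'b"
    by (intro pd_eqI has_derivative_mult_right smooth_has_derivative that)
  then show ?case
    using Cons smooth_pderivs[OF assms(1), of vs] by simp
qed simp

lemma pderivs_diff:
  fixes f g :: "'a::euclidean_space \<Rightarrow> complex"
  assumes "smooth f" "smooth g" "set vs \<subseteq> Basis"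
  shows "pderivs vs (\<lambda>x. f x - g x) = (\<lambda>x. pderivs vs f x - pderivs vs g x)"
  using pderivs_add[OF assms(1) smooth_cmult[OF assms(2)] assms(3), of "-1"]
    pderivs_cmult[OF assms(2,3), of "-1"] by simp

lemma schwartz_span:
  assumes "f \<in> span_class schwartz"
  shows "f \<in> schwartz"
proof (rule schwartz_span_classI[of schwartz, OF _ _ _ assms])
  fix f :: "'a \<Rightarrow> complex" and m assume "f \<in> schwartz"
  then show "\<exists>C. \<forall>x. (1 + norm x) ^ m * norm (f x) \<le> C" using schwartz_bounded by blast
next
  fix f :: "'a \<Rightarrow> complex" and b :: 'a assume "f \<in> schwartz" "b \<in> Basis"
  then show "pd b f \<in> span_class schwartz" by (intro span_class.base schwartz_pd)
qed (simp add: smooth_differentiable schwartz_smooth)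

lemma schwartz_add: "f \<in> schwartz \<Longrightarrow> g \<in> schwartz \<Longrightarrow> (\<lambda>x. f x + g x) \<in> schwartz"
  by (intro schwartz_span span_class.add) (auto intro: span_class.base)

lemma schwartz_mult:
  assumes "f \<in> schwartz" "g \<in> schwartz"
  shows "(\<lambda>x. f x * g x) \<in> schwartz"
proof -
  let ?S = "{\<lambda>x. f x * g x | f g :: 'a \<Rightarrow> complex. f \<in> schwartz \<and> g \<in> schwartz}"
  have mem: "(\<lambda>x. f x * g x) \<in> span_class ?S" if "f \<in> schwartz" "g \<in> schwartz" for f g
    using that by (intro span_class.base) blast
  show ?thesis
  proof (rule schwartz_span_classI[of ?S, OF _ _ _ mem[OF assms]])
    fix h :: "'a \<Rightarrow> complex" and b :: 'a
    assume "h \<in> ?S" and b: "b \<in> Basis"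
    then obtain f g where h: "h = (\<lambda>x. f x * g x)" "f \<in> schwartz" "g \<in> schwartz" by auto
    have "pd b h = (\<lambda>x. f x * pd b g x + pd b f x * g x)"
      unfolding h by (intro ext pd_mult) (use h smooth_differentiable schwartz_smooth in auto)
    then show "pd b h \<in> span_class ?S"
      using span_class.add[OF mem[OF h(2) schwartz_pd[OF h(3) b]] mem[OF schwartz_pd[OF h(2) b] h(3)]]
      by simp
  next
    fix h :: "'a \<Rightarrow> complex" and m :: nat
    assume "h \<in> ?S"
    then obtain f g where h: "h = (\<lambda>x. f x * g x)" "f \<in> schwartz" "g \<in> schwartz" by auto
    obtain C where C: "C > 0" "\<And>x. (1 + norm x) ^ m * norm (f x) \<le> C"
      using schwartz_bounded[OF h(2), of m] by blast
    obtain D where D: "D > 0" "\<And>x. (1 + norm x) ^ 0 * norm (g x) \<le> D"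
      using schwartz_bounded[OF h(3), of 0] by blast
    have "(1 + norm x) ^ m * norm (h x) \<le> C * D" for x
      using mult_mono[OF C(2) D(2), of x x] C(1) by (simp add: h norm_mult mult.assoc)
    then show "\<exists>C. \<forall>x. (1 + norm x) ^ m * norm (h x) \<le> C" by blast
  qed (auto intro!: differentiable_mult simp: smooth_differentiable schwartz_smooth)
qed

lemma schwartz_cmult:
  assumes "f \<in> schwartz"
  shows "(\<lambda>x. c * f x) \<in> schwartz"
proof -
  let ?S = "{\<lambda>x. c * f x | f :: 'a \<Rightarrow> complex. f \<in> schwartz}"
  have mem: "(\<lambda>x. c * f x) \<in> ?S" if "f \<in> schwartz" for f
    using that by blast
  show ?thesis
  proof (rule schwartz_classI[of ?S])
    fix h :: "'a \<Rightarrow> complex" and b :: 'a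
    assume "h \<in> ?S" and b: "b \<in> Basis"
    then obtain f where h: "h = (\<lambda>x. c * f x)" "f \<in> schwartz" by auto
    have "pd b h = (\<lambda>x. c * pd b f x)"
      unfolding h
      by (intro ext pd_eqI has_derivative_mult_right smooth_has_derivative schwartz_smooth h)
    then show "pd b h \<in> ?S" by (rule ssubst) (rule mem[OF schwartz_pd[OF h(2) b]])
  next
    fix h :: "'a \<Rightarrow> complex" and m :: nat
    assume "h \<in> ?S"
    then obtain f where h: "h = (\<lambda>x. c * f x)" "f \<in> schwartz" by auto
    obtain C where C: "C > 0" "\<And>x. (1 + norm x) ^ m * norm (f x) \<le> C"
      using schwartz_bounded[OF h(2), of m] by blast
    have "(1 + norm x) ^ m * norm (h x) \<le> norm c * C" for x
      using mult_left_mono[OF C(2), of "norm c" x] by (simp add: h norm_mult ac_simps)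
    then show "\<exists>C. \<forall>x. (1 + norm x) ^ m * norm (h x) \<le> C" by blast
  qed (use assms in \<open>auto intro!: differentiable_mult simp: smooth_differentiable schwartz_smooth\<close>)
qed

lemma schwartz_diff: "f \<in> schwartz \<Longrightarrow> g \<in> schwartz \<Longrightarrow> (\<lambda>x. f x - g x) \<in> schwartz"
  using schwartz_add[OF _ schwartz_cmult[of g "-1"], of f] by simp

lemma schwartz_zero: "(\<lambda>x. 0) \<in> schwartz"
  by (rule schwartz_classI[of "{\<lambda>x. 0}"]) (auto simp: pd_eqI[OF has_derivative_const])

lemma schwartz_sum:
  assumes "\<And>i. i \<in> I \<Longrightarrow> f i \<in> schwartz"
  shows "(\<lambda>x. \<Sum>i\<in>I. f i x) \<in> schwartz"
  using assms by (induction I rule: infinite_finite_induct) (auto intro: schwartz_add simp: schwartz_zero)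

text \<open>Peetre's inequality. It moves polynomial weights from one point to a translate, at a
  price that depends on the translation only.\<close>

lemma one_plus_norm_shift: "1 + norm y \<le> (1 + norm (y + a)) * (1 + norm a)"
proof -
  have "norm y \<le> norm (y + a) + norm a" using norm_triangle_ineq4[of "y + a" a] by simp
  then have "1 + norm y \<le> 1 + norm (y + a) + norm a" by simp
  also have "\<dots> \<le> (1 + norm (y + a)) * (1 + norm a)" by (simp add: distrib_right distrib_left)
  finally show ?thesis .
qed

lemma schwartz_translate:
  fixes f :: "'a::euclidean_space \<Rightarrow> complex"
  assumes "f \<in> schwartz"
  shows "(\<lambda>x. f (x + a)) \<in> schwartz"
  unfolding schwartz_def
proof (intro CollectI conjI allI impI)
  show "smooth (\<lambda>x. f (x + a))"
    using smooth_affine_comp[OF schwartz_smooth[OF assms] bounded_linear_ident] .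
next
  fix m and vs :: "'a list" assume vs: "set vs \<subseteq> Basis"
  obtain C where C: "C > 0" "\<And>x. (1 + norm x) ^ m * norm (pderivs vs f x) \<le> C"
    using schwartz_bounded[OF schwartz_pderivs[OF assms vs], of m] by blast
  have "(1 + norm x) ^ m * norm (pderivs vs f (x + a)) \<le> (1 + norm a) ^ m * C" for x
  proof -
    have "(1 + norm x) ^ m \<le> ((1 + norm (x + a)) * (1 + norm a)) ^ m"
      by (intro power_mono one_plus_norm_shift) auto
    from mult_right_mono[OF this norm_ge_zero, of "pderivs vs f (x + a)"]
    have "(1 + norm x) ^ m * norm (pderivs vs f (x + a))
      \<le> (1 + norm a) ^ m * ((1 + norm (x + a)) ^ m * norm (pderivs vs f (x + a)))"
      by (simp only: power_mult_distrib ac_simps)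
    also have "\<dots> \<le> (1 + norm a) ^ m * C" by (intro mult_left_mono C) auto
    finally show ?thesis .
  qed
  then show "bdd_above (range (\<lambda>x. (1 + norm x) ^ m * norm (pderivs vs (\<lambda>x. f (x + a)) x)))"
    unfolding pderivs_translate by (auto simp: bdd_above_def)
qed

lemma schwartz_reflect:
  fixes f :: "'a::euclidean_space \<Rightarrow> complex"
  assumes "f \<in> schwartz"
  shows "(\<lambda>x. f (- x)) \<in> schwartz"
proof -
  let ?S = "{\<lambda>x. f (- x) | f :: 'a \<Rightarrow> complex. f \<in> schwartz}"
  have mem: "(\<lambda>x. f (- x)) \<in> ?S" if "f \<in> schwartz" for f
    using that by blast
  have der: "((\<lambda>x. f (- x)) has_derivative (\<lambda>v. frechet_derivative f (at (- x)) (- v))) (at x)"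
    if "f \<in> schwartz" for f :: "'a \<Rightarrow> complex" and x
    by (intro has_derivative_compose[of "\<lambda>x. - x", OF _ smooth_has_derivative[OF schwartz_smooth[OF that]]])
       (auto intro!: derivative_eq_intros)
  show ?thesis
  proof (rule schwartz_classI[of ?S])
    fix h :: "'a \<Rightarrow> complex" and b :: 'a
    assume "h \<in> ?S" and b: "b \<in> Basis"
    then obtain f where h: "h = (\<lambda>x. f (- x))" "f \<in> schwartz" by auto
    have "pd b h = (\<lambda>x. (-1) * pd b f (- x))"
    proof
      fix x
      have "linear (frechet_derivative f (at (- x)))"
        by (rule linear_frechet_derivative[OF smooth_differentiable[OF schwartz_smooth[OF h(2)]]])
      then show "pd b h x = (-1) * pd b f (- x)"
        unfolding h by (simp add: pd_eqI[OF der[OF h(2)]] linear_neg)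
    qed
    then show "pd b h \<in> ?S" by (rule ssubst) (rule mem[OF schwartz_cmult[OF schwartz_pd[OF h(2) b], of "-1"]])
  next
    fix h :: "'a \<Rightarrow> complex" and m :: nat
    assume "h \<in> ?S"
    then obtain f where h: "h = (\<lambda>x. f (- x))" "f \<in> schwartz" by auto
    obtain C where C: "C > 0" "\<And>x. (1 + norm x) ^ m * norm (f x) \<le> C"
      using schwartz_bounded[OF h(2), of m] by blast
    have "(1 + norm x) ^ m * norm (h x) \<le> C" for x
      using C(2)[of "- x"] by (simp add: h)
    then show "\<exists>C. \<forall>x. (1 + norm x) ^ m * norm (h x) \<le> C" by blast
  qed (use assms der in \<open>auto simp: differentiable_def\<close>)
qed

text \<open>Differentiating the coordinate leaves a multiple of f without the coordinate factor, so
  the stable class has to contain the Schwartz functions themselves. Needed because derivatives of a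
  Fourier transform bring down coordinates.\<close>

lemma schwartz_mult_inner:
  fixes f :: "'a::euclidean_space \<Rightarrow> complex"
  assumes "f \<in> schwartz" "b \<in> Basis"
  shows "(\<lambda>x. of_real (x \<bullet> b) * f x) \<in> schwartz"
proof -
  let ?S = "{\<lambda>x. of_real (x \<bullet> b) * f x | f :: 'a \<Rightarrow> complex. f \<in> schwartz} \<union> schwartz"
  have mem: "(\<lambda>x. of_real (x \<bullet> b) * f x) \<in> span_class ?S" if "f \<in> schwartz" for f
    using that by (intro span_class.base) blast
  have der: "((\<lambda>x. of_real (x \<bullet> b) * f x) has_derivative
      (\<lambda>v. of_real (x \<bullet> b) * frechet_derivative f (at x) v + of_real (v \<bullet> b) * f x)) (at x)"
    if "f \<in> schwartz" for f :: "'a \<Rightarrow> complex" and x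
    by (intro has_derivative_mult smooth_has_derivative[OF schwartz_smooth[OF that]])
       (auto intro!: derivative_eq_intros)
  show ?thesis
  proof (rule schwartz_span_classI[of ?S])
    fix h :: "'a \<Rightarrow> complex" and c :: 'a
    assume "h \<in> ?S" and c: "c \<in> Basis"
    then consider f where "h = (\<lambda>x. of_real (x \<bullet> b) * f x)" "f \<in> schwartz" | "h \<in> schwartz" by auto
    then show "pd c h \<in> span_class ?S"
    proof cases
      case 1
      have "pd c h = (\<lambda>x. of_real (x \<bullet> b) * pd c f x + of_real (c \<bullet> b) * f x)"
        unfolding 1 by (simp add: pd_eqI[OF der[OF 1(2)]])
      moreover have "(\<lambda>x. of_real (x \<bullet> b) * pd c f x) \<in> span_class ?S"
        by (rule mem[OF schwartz_pd[OF 1(2) c]])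
      moreover have "(\<lambda>x. of_real (c \<bullet> b) * f x) \<in> span_class ?S"
        by (intro span_class.base UnI2 schwartz_cmult 1)
      ultimately show ?thesis by (simp add: span_class.add)
    next
      case 2
      then show ?thesis using schwartz_pd[OF _ c] by (intro span_class.base UnI2)
    qed
  next
    fix h :: "'a \<Rightarrow> complex" and m :: nat
    assume "h \<in> ?S"
    then consider f where "h = (\<lambda>x. of_real (x \<bullet> b) * f x)" "f \<in> schwartz" | "h \<in> schwartz" by auto
    then show "\<exists>C. \<forall>x. (1 + norm x) ^ m * norm (h x) \<le> C"
    proof cases
      case 1
      obtain C where C: "C > 0" "\<And>x. (1 + norm x) ^ Suc m * norm (f x) \<le> C"
        using schwartz_bounded[OF 1(2)] by blast
      have "(1 + norm x) ^ m * norm (h x) \<le> C" for x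
      proof -
        have "\<bar>x \<bullet> b\<bar> \<le> 1 + norm x" using Basis_le_norm[OF assms(2), of x] by simp
        then have "(1 + norm x) ^ m * norm (h x) \<le> (1 + norm x) ^ m * ((1 + norm x) * norm (f x))"
          unfolding 1 norm_mult norm_of_real by (intro mult_left_mono mult_right_mono) auto
        also have "\<dots> \<le> C" using C(2)[of x] by (simp add: ac_simps)
        finally show ?thesis .
      qed
      then show ?thesis by blast
    next
      case 2
      then show ?thesis using schwartz_bounded by blast
    qed
  next
    show "(\<lambda>x. of_real (x \<bullet> b) * f x) \<in> span_class ?S" by (rule mem[OF assms(1)])
  next
    fix h :: "'a \<Rightarrow> complex" and x assume "h \<in> ?S"
    then show "h differentiable (at x)"
      using der smooth_differentiable[OF schwartz_smooth] unfolding differentiable_def by blast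
  qed
qed

lemma frechet_derivative_zero_if_zero_near:
  assumes "open U" "x \<in> U" "\<And>y. y \<in> U \<Longrightarrow> f y = 0"
  shows "frechet_derivative f (at x) v = 0"
proof -
  have "((\<lambda>y. 0) has_derivative (\<lambda>v. 0)) (at x)" by simp
  then have "(f has_derivative (\<lambda>v. 0)) (at x)"
    by (rule has_derivative_transform_within_open[OF _ assms(1,2)]) (simp add: assms(3))
  then show ?thesis by (rule pd_eqI)
qed

lemma test_functions_on_pd:
  assumes "compact K" "f \<in> test_functions_on K" "b \<in> Basis"
  shows "pd b f \<in> test_functions_on K"
proof -
  have "frechet_derivative f (at x) b = 0" if "x \<notin> K" for x
    by (rule frechet_derivative_zero_if_zero_near[of "- K"])
       (use assms that in \<open>auto simp: test_functions_on_def compact_imp_closed open_Compl\<close>)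
  then show ?thesis using assms by (auto simp: test_functions_on_def smooth_pd)
qed

lemma bounded_if_compact_support:
  fixes f :: "'a::euclidean_space \<Rightarrow> complex"
  assumes "continuous_on UNIV f" "compact K" "\<And>x. x \<notin> K \<Longrightarrow> f x = 0"
  shows "\<exists>C. \<forall>x. norm (f x) \<le> C"
proof -
  have "bounded (f ` K)"
    using assms by (intro compact_imp_bounded compact_continuous_image) (auto intro: continuous_on_subset)
  then obtain C where "\<And>x. x \<in> K \<Longrightarrow> norm (f x) \<le> C" by (auto simp: bounded_iff)
  then have "norm (f x) \<le> max C 0" for x
    using assms(3)[of x] by (cases "x \<in> K") (auto intro: max.coboundedI1)
  then show ?thesis by blast
qed

lemma test_function_schwartz:
  fixes f :: "'a::euclidean_space \<Rightarrow> complex"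
  assumes "f \<in> test_functions"
  shows "f \<in> schwartz"
proof -
  obtain K where K: "compact K" "f \<in> test_functions_on K" using assms by (auto simp: test_functions_def)
  show ?thesis
  proof (rule schwartz_classI[of "test_functions_on K", OF _ _ _ K(2)])
    fix g :: "'a \<Rightarrow> complex" and m :: nat assume g: "g \<in> test_functions_on K"
    have "continuous_on UNIV (\<lambda>x. of_real ((1 + norm x) ^ m) * g x)"
      using g by (intro continuous_intros) (auto simp: test_functions_on_def smooth_continuous_on)
    then have "\<exists>C. \<forall>x. norm (of_real ((1 + norm x) ^ m) * g x) \<le> C"
      using g by (intro bounded_if_compact_support[OF _ K(1)]) (auto simp: test_functions_on_def)
    then show "\<exists>C. \<forall>x. (1 + norm x) ^ m * norm (g x) \<le> C" by (simp only: norm_mult norm_of_real) simp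
  qed (use test_functions_on_pd[OF K(1)] in \<open>auto simp: test_functions_on_def smooth_differentiable\<close>)
qed

section \<open>Smoothness and supports of the dyadic cutoffs\<close>

lemma smooth_inner_left: "smooth (\<lambda>x::'a::euclidean_space. x \<bullet> b)"
proof (rule smooth_classI[of "insert (\<lambda>x. x \<bullet> b) (range (\<lambda>c x. c))"])
  have der: "((\<lambda>x. x \<bullet> b) has_derivative (\<lambda>v. v \<bullet> b)) (at x)" for x
    by (auto intro!: derivative_eq_intros)
  fix f :: "'a \<Rightarrow> real" and v :: 'a assume "f \<in> insert (\<lambda>x. x \<bullet> b) (range (\<lambda>c x. c))"
  then show "pd v f \<in> insert (\<lambda>x. x \<bullet> b) (range (\<lambda>c x. c))"
    by (auto simp: pd_eqI[OF der] pd_eqI[OF has_derivative_const])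
qed auto

text \<open>The norm fails to be smooth at the origin only, and there the profile vanishes. The
  products \<Theta>(|x|) |x|^(-k) g(x) form a stable class: of the gradient x/|x| of the norm, 1/|x|
  raises k and the coordinate of x goes into g.\<close>

lemma smooth_radial:
  fixes \<Theta> :: "real \<Rightarrow> real"
  assumes "smooth \<Theta>" "\<epsilon> > 0" "\<And>t. t < \<epsilon> \<Longrightarrow> \<Theta> t = 0"
  shows "smooth (\<lambda>x::'a::euclidean_space. \<Theta> (norm x))"
proof -
  let ?P = "\<lambda>\<Theta>. smooth \<Theta> \<and> (\<forall>t < \<epsilon>. \<Theta> t = (0::real))"
  let ?h = "\<lambda>\<Theta> k g x. \<Theta> (norm x) * inverse (norm x) ^ k * g x"
  let ?S = "{?h \<Theta> k g | \<Theta> k (g :: 'a \<Rightarrow> real). ?P \<Theta> \<and> smooth g}"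
  have mem: "?h \<Theta> k g \<in> span_class ?S" if "?P \<Theta>" "smooth g" for \<Theta> k and g :: "'a \<Rightarrow> real"
    using that by (intro span_class.base) blast
  have P': "?P (\<lambda>t. frechet_derivative \<Theta> (at t) 1)" if "?P \<Theta>" for \<Theta>
    using smooth_pd[of \<Theta> 1] frechet_derivative_zero_if_zero_near[of "{..<\<epsilon>}" _ \<Theta>] that by auto
  have der: "(?h \<Theta> k g has_derivative (\<lambda>v.
       ?h (\<lambda>t. frechet_derivative \<Theta> (at t) 1) (k + 1) (\<lambda>x. (x \<bullet> v) * g x) x +
       (?h (\<lambda>t. - real k * \<Theta> t) (k + 2) (\<lambda>x. (x \<bullet> v) * g x) x +
        ?h \<Theta> k (\<lambda>x. frechet_derivative g (at x) v) x))) (at x)"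
    if "?P \<Theta>" "smooth g" for \<Theta> k g and x :: 'a
  \<comment> \<open>Near the origin everything is identically zero; elsewhere x is nonzero and the
    product and chain rules apply.\<close>
  proof (cases "norm x < \<epsilon>")
    case True
    have "((\<lambda>x. 0) has_derivative (\<lambda>v. 0)) (at x)" by simp
    then have "(?h \<Theta> k g has_derivative (\<lambda>v. 0)) (at x)"
      by (rule has_derivative_transform_within_open[of _ _ _ _ "ball 0 \<epsilon>"]) (use True that in auto)
    then show ?thesis using True that P'[OF that(1)] by simp
  next
    case False
    then have x: "x \<noteq> 0" using assms(2) by auto
    have d\<Theta>: "(\<Theta> has_derivative (\<lambda>h. frechet_derivative \<Theta> (at (norm x)) 1 * h)) (at (norm x))"
    proof -
      have "(\<Theta> has_derivative frechet_derivative \<Theta> (at (norm x))) (at (norm x))"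
        using that smooth_has_derivative by blast
      moreover have "frechet_derivative \<Theta> (at (norm x)) = (\<lambda>h. frechet_derivative \<Theta> (at (norm x)) 1 * h)"
      proof
        fix h :: real
        have "linear (frechet_derivative \<Theta> (at (norm x)))"
          using that by (intro linear_frechet_derivative smooth_differentiable) auto
        from linear_scale[OF this, of h 1]
        show "frechet_derivative \<Theta> (at (norm x)) h = frechet_derivative \<Theta> (at (norm x)) 1 * h"
          by simp
      qed
      ultimately show ?thesis by simp
    qed
    have dn: "(norm has_derivative (\<lambda>v. x \<bullet> v / norm x)) (at x)"
      using has_derivative_norm[OF x] x by (simp add: sgn_div_norm inner_commute divide_inverse mult.commute)
    have pk: "((\<lambda>t. inverse t ^ k) has_real_derivative - real k * inverse (norm x) ^ (k + 1)) (at (norm x))" for k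
    proof (induction k)
      case (Suc k)
      from DERIV_mult[OF DERIV_inverse[of "norm x"] Suc] x show ?case
        by (simp add: algebra_simps power2_eq_square)
    qed simp
    have "((\<lambda>t. \<Theta> t * inverse t ^ k) has_real_derivative
        frechet_derivative \<Theta> (at (norm x)) 1 * inverse (norm x) ^ k
        - real k * \<Theta> (norm x) * inverse (norm x) ^ (k + 1)) (at (norm x))"
      using DERIV_mult[OF d\<Theta>[folded has_field_derivative_def] pk, of k]
      by (simp add: algebra_simps)
    from has_derivative_compose[OF dn this[unfolded has_field_derivative_def]]
    have "((\<lambda>x. \<Theta> (norm x) * inverse (norm x) ^ k * g x) has_derivative (\<lambda>v.
       \<Theta> (norm x) * inverse (norm x) ^ k * frechet_derivative g (at x) v +
       ((frechet_derivative \<Theta> (at (norm x)) 1 * inverse (norm x) ^ k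
        - real k * \<Theta> (norm x) * inverse (norm x) ^ (k + 1)) * (x \<bullet> v / norm x)) * g x)) (at x)"
      using that(2) by (intro has_derivative_mult smooth_has_derivative)
    then show ?thesis
      by (rule has_derivative_eq_rhs) (simp add: fun_eq_iff algebra_simps divide_inverse)
  qed
  have "?h \<Theta> 0 (\<lambda>x. 1) \<in> span_class ?S" using mem[of \<Theta> "\<lambda>x. 1" 0] assms by simp
  then have "smooth (?h \<Theta> 0 (\<lambda>x. 1 :: real) :: 'a \<Rightarrow> real)"
  proof (rule smooth_span_classI[of ?S, rotated 2])
    fix f :: "'a \<Rightarrow> real" and b :: 'a assume "f \<in> ?S" and b: "b \<in> Basis"
    then obtain \<Theta> k g where f: "f = ?h \<Theta> k g" "?P \<Theta>" "smooth g" by auto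
    have sb: "smooth (\<lambda>x. (x \<bullet> b) * g x)"
      by (intro smooth_mult smooth_inner_left f)
    show "pd b f \<in> span_class ?S"
      unfolding f(1) pd_eqI[OF der[OF f(2,3)]]
      by (intro span_class.add mem P' f sb smooth_pd b)
         (use f(2) smooth_cmult[of \<Theta> "- real k"] in auto)
  next
    fix f :: "'a \<Rightarrow> real" and x assume "f \<in> ?S"
    then show "f differentiable (at x)" using der unfolding differentiable_def by blast
  qed
  then show ?thesis by simp
qed

text \<open>\<open>\<Psi>\<close> is 1 near 0, so \<open>\<Psi>\<close> minus 1 is the profile to
  which \<open>smooth_radial\<close> applies; a dilation and the addition of 1 restore
  \<open>Psi \<Psi> j\<close>.\<close>

lemma smooth_Psi:
  assumes "cutoff \<Psi>"
  shows "smooth (Psi \<Psi> j :: 'a::euclidean_space \<Rightarrow> real)"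
proof -
  have "smooth (\<lambda>x::'a. \<Psi> (norm x) - 1)"
    using assms by (intro smooth_radial[of "\<lambda>t. \<Psi> t - 1" "11/10"] smooth_diff) (auto simp: cutoff_def)
  from smooth_affine_comp[OF this bounded_linear_scaleR_right, of "2 powr - real j" 0]
  have "smooth (\<lambda>x::'a. (\<Psi> (norm ((2 powr - real j) *\<^sub>R x)) - 1) + 1)"
    by (intro smooth_add) auto
  then show ?thesis by (simp add: Psi_def[abs_def])
qed

lemma Psi_eq_0: "cutoff \<Psi> \<Longrightarrow> norm \<xi> > 13/10 * 2 ^ j \<Longrightarrow> Psi \<Psi> j \<xi> = 0"
  by (auto simp: Psi_def cutoff_def powr_minus powr_realpow field_simps)

lemma Psi_eq_1: "cutoff \<Psi> \<Longrightarrow> norm \<xi> < 11/10 * 2 ^ j \<Longrightarrow> Psi \<Psi> j \<xi> = 1"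
  by (auto simp: Psi_def cutoff_def powr_minus powr_realpow field_simps)

lemma Psi_test:
  assumes "cutoff \<Psi>"
  shows "(\<lambda>\<xi>::'a::euclidean_space. complex_of_real (Psi \<Psi> j \<xi>)) \<in> test_functions"
  unfolding test_functions_def test_functions_on_def
proof (intro UN_I[of "cball 0 (13/10 * 2 ^ j)"] CollectI conjI allI impI)
  show "smooth (\<lambda>\<xi>::'a. complex_of_real (Psi \<Psi> j \<xi>))"
    using smooth_of_real[OF smooth_Psi[OF assms]] .
  fix \<xi> :: 'a assume "\<xi> \<notin> cball 0 (13/10 * 2 ^ j)"
  then show "complex_of_real (Psi \<Psi> j \<xi>) = 0" by (simp add: Psi_eq_0[OF assms])
qed auto

lemma Psi_schwartz: "cutoff \<Psi> \<Longrightarrow> (\<lambda>\<xi>. complex_of_real (Psi \<Psi> j \<xi>)) \<in> schwartz"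
  by (intro test_function_schwartz Psi_test)

lemma Phi_schwartz: "cutoff \<Psi> \<Longrightarrow> (\<lambda>\<xi>. complex_of_real (Phi \<Psi> j \<xi>)) \<in> schwartz"
  by (cases "j = 0") (auto simp: Phi_def[abs_def] intro: Psi_schwartz schwartz_diff)

lemma sum_Phi: "(\<Sum>i\<le>j. Phi \<Psi> i \<xi>) = Psi \<Psi> j \<xi>"
  by (induction j) (auto simp: Phi_def)

text \<open>\<open>Phi \<Psi> j\<close> vanishes beyond 13/10 * 2^j, while
  \<open>Psi \<Psi> (Suc j)\<close> equals 1 up to 22/10 * 2^j. This is the origin of the
  reproducing formula for the blocks.\<close>

lemma Psi_mult_Phi:
  assumes "cutoff \<Psi>"
  shows "Psi \<Psi> (Suc j) \<xi> * Phi \<Psi> j \<xi> = Phi \<Psi> j \<xi>"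
proof (cases "norm \<xi> < 11/10 * 2 ^ Suc j")
  case True
  then show ?thesis using Psi_eq_1[OF assms True] by simp
next
  case False
  then have "11/10 * (2 * 2 ^ j) \<le> norm \<xi>" by simp
  with zero_less_power[of "2::real" j] have 1: "norm \<xi> > 13/10 * 2 ^ j" by linarith
  moreover have "norm \<xi> > 13/10 * 2 ^ (j - 1)"
    using 1 by (rule le_less_trans[rotated]) simp
  ultimately have "Psi \<Psi> j \<xi> = 0" "Psi \<Psi> (j - 1) \<xi> = 0"
    by (auto intro: Psi_eq_0[OF assms])
  then show ?thesis by (cases "j = 0") (simp_all add: Phi_def)
qed

text \<open>The mean value inequality along the segment from \<open>y + b\<close> to \<open>y + a\<close>.\<close>

lemma schwartz_translate_diff_bound:
  fixes f :: "'a::euclidean_space \<Rightarrow> complex"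
  assumes "f \<in> schwartz"
  obtains C where "C > 0" "\<And>y a b. (1 + norm y) ^ m * norm (f (y + a) - f (y + b))
    \<le> C * norm (a - b) * (1 + norm a + norm b) ^ m"
proof -
  have "\<forall>v\<in>Basis. \<exists>C>0. \<forall>x. (1 + norm x) ^ m * norm (pd v f x) \<le> C"
  proof
    fix v :: 'a assume "v \<in> Basis"
    then show "\<exists>C>0. \<forall>x. (1 + norm x) ^ m * norm (pd v f x) \<le> C"
      using schwartz_bounded[OF schwartz_pd[OF assms], of v m] by metis
  qed
  then obtain C where C: "\<And>v. v \<in> Basis \<Longrightarrow> C v > 0"
    "\<And>v x. v \<in> Basis \<Longrightarrow> (1 + norm x) ^ m * norm (pd v f x) \<le> C v" by metis
  define D where "D = (\<Sum>v\<in>Basis. C v)"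
  have D: "D > 0" unfolding D_def by (intro sum_pos) (auto simp: C)
  have "(1 + norm y) ^ m * norm (f (y + a) - f (y + b))
    \<le> D * norm (a - b) * (1 + norm a + norm b) ^ m" for y a b
  proof -
    have "norm (of_real ((1 + norm y) ^ m) * f (y + a) - of_real ((1 + norm y) ^ m) * f (y + b))
      \<le> (D * (1 + norm a + norm b) ^ m) * norm ((y + a) - (y + b))"
    proof (rule differentiable_bound[of "closed_segment (y + b) (y + a)"
            "\<lambda>x. of_real ((1 + norm y) ^ m) * f x"
            "\<lambda>x v. of_real ((1 + norm y) ^ m) * frechet_derivative f (at x) v"])
      fix x assume "x \<in> closed_segment (y + b) (y + a)"
      show "((\<lambda>x. of_real ((1 + norm y) ^ m) * f x) has_derivative
          (\<lambda>v. of_real ((1 + norm y) ^ m) * frechet_derivative f (at x) v))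
          (at x within closed_segment (y + b) (y + a))"
        by (rule has_derivative_mult_right[OF has_derivative_at_withinI[OF
              smooth_has_derivative[OF schwartz_smooth[OF assms]]]])
    next
      fix x assume "x \<in> closed_segment (y + b) (y + a)"
      then obtain u where u: "0 \<le> u" "u \<le> 1" "x = (1 - u) *\<^sub>R (y + b) + u *\<^sub>R (y + a)"
        by (auto simp: in_segment)
      \<comment> \<open>Every point of the segment is y + w with |w| \<le> |a| + |b|, so the weight
        at y is exchanged for the weight at x at a price independent of the position on the
        segment.\<close>
      define w where "w = (1 - u) *\<^sub>R b + u *\<^sub>R a"
      have x: "x = y + w" using u(3) by (simp add: w_def algebra_simps)
      have "norm w \<le> (1 - u) * norm b + u * norm a"
        unfolding w_def using u norm_triangle_ineq[of "(1 - u) *\<^sub>R b" "u *\<^sub>R a"] by simp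
      also have "\<dots> \<le> 1 * norm b + 1 * norm a"
        using u by (intro add_mono mult_right_mono) auto
      finally have w: "norm w \<le> norm a + norm b" by simp
      have "1 + norm y \<le> (1 + norm x) * (1 + norm a + norm b)"
        using one_plus_norm_shift[of y w] w unfolding x
        by (smt (verit) mult_left_mono norm_ge_zero)
      then have "(1 + norm y) ^ m \<le> ((1 + norm x) * (1 + norm a + norm b)) ^ m"
        by (intro power_mono) auto
      then have pw: "(1 + norm y) ^ m \<le> (1 + norm a + norm b) ^ m * (1 + norm x) ^ m"
        by (simp add: power_mult_distrib mult.commute)
      show "onorm (\<lambda>v. of_real ((1 + norm y) ^ m) * frechet_derivative f (at x) v)
          \<le> D * (1 + norm a + norm b) ^ m"
      proof (rule onorm_le)
        fix v
        have "norm (of_real ((1 + norm y) ^ m) * frechet_derivative f (at x) v)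
          \<le> (1 + norm y) ^ m * ((\<Sum>b\<in>Basis. norm (pd b f x)) * norm v)"
          unfolding norm_mult norm_of_real
          using norm_frechet_derivative_le[OF smooth_differentiable[OF schwartz_smooth[OF assms]]]
          by (simp add: mult_left_mono)
        also have "\<dots> \<le> ((1 + norm a + norm b) ^ m * (1 + norm x) ^ m) * ((\<Sum>b\<in>Basis. norm (pd b f x)) * norm v)"
          by (intro mult_right_mono pw mult_nonneg_nonneg sum_nonneg) auto
        also have "\<dots> = (1 + norm a + norm b) ^ m * (\<Sum>b\<in>Basis. (1 + norm x) ^ m * norm (pd b f x)) * norm v"
          by (simp add: sum_distrib_left mult.assoc)
        also have "\<dots> \<le> (1 + norm a + norm b) ^ m * D * norm v"
          unfolding D_def by (intro mult_right_mono mult_left_mono sum_mono C) auto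
        finally show "norm (of_real ((1 + norm y) ^ m) * frechet_derivative f (at x) v)
          \<le> D * (1 + norm a + norm b) ^ m * norm v" by (simp add: mult.commute)
      qed
    qed auto
    moreover have "norm (of_real ((1 + norm y) ^ m) * f (y + a) - of_real ((1 + norm y) ^ m) * f (y + b))
      = (1 + norm y) ^ m * norm (f (y + a) - f (y + b))"
      unfolding right_diff_distrib[symmetric] norm_mult norm_of_real by simp
    ultimately show ?thesis by (simp add: mult.assoc mult.left_commute mult.commute)
  qed
  then show ?thesis using that[of D] D by blast
qed

section \<open>The Fourier transformation on Schwartz functions\<close>

lemma integrable_inverse_one_plus_square: "integrable lborel (\<lambda>x::real. inverse (1 + x\<^sup>2))"
  using integrable_inverse_1_plus_square by (simp add: set_integrable_def einterval_def)

text \<open>Since |x . b| \<le> |x|, two powers of the weight dominate one Cauchy factor 1 + (x .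
  b)^2. One pair of powers per coordinate bounds the integrand by a product of integrable functions
  of one variable.\<close>

lemma nn_integral_weight_finite:
  "(\<integral>\<^sup>+x. ennreal (1 / (1 + norm (x::'a::euclidean_space)) ^ (2 * DIM('a))) \<partial>lborel) < \<infinity>"
proof -
  have le: "1 / (1 + norm x) ^ (2 * DIM('a)) \<le> (\<Prod>b\<in>Basis. inverse (1 + (x \<bullet> b)\<^sup>2))" for x :: 'a
  proof -
    have "(\<Prod>b\<in>(Basis::'a set). inverse (1 + norm x) ^ 2) \<le> (\<Prod>b\<in>Basis. inverse (1 + (x \<bullet> b)\<^sup>2))"
    proof (intro prod_mono conjI)
      fix b :: 'a assume b: "b \<in> Basis"
      have "(x \<bullet> b)\<^sup>2 \<le> (norm x)\<^sup>2" using abs_le_square_iff[of "x \<bullet> b" "norm x"] Basis_le_norm[OF b, of x] by simp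
      then have "1 + (x \<bullet> b)\<^sup>2 \<le> (1 + norm x)\<^sup>2" by (simp add: power2_sum add_increasing2)
      then show "inverse (1 + norm x) ^ 2 \<le> inverse (1 + (x \<bullet> b)\<^sup>2)"
        unfolding power_inverse by (intro le_imp_inverse_le) (auto simp: add_pos_nonneg)
    qed simp
    then show ?thesis by (simp add: power_mult divide_inverse power_inverse)
  qed
  have "(\<integral>\<^sup>+x. ennreal (1 / (1 + norm (x::'a)) ^ (2 * DIM('a))) \<partial>lborel)
      \<le> (\<integral>\<^sup>+x. (\<Prod>b\<in>Basis. ennreal (inverse (1 + (x \<bullet> b)\<^sup>2))) \<partial>(lborel::'a measure))"
    using le by (intro nn_integral_mono) (simp add: prod_ennreal ennreal_leI)
  also have "\<dots> = (\<Prod>b\<in>(Basis::'a set). (\<integral>\<^sup>+x. ennreal (inverse (1 + x\<^sup>2)) \<partial>lborel))"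
    by (subst nn_integral_lborel_prod) auto
  also have "\<dots> < \<infinity>"
    using integrable_inverse_one_plus_square
    by (simp add: less_top[symmetric] ennreal_prod_eq_top integrable_iff_bounded power_eq_top_ennreal)
  finally show ?thesis .
qed

lemma integrable_weight:
  "integrable lborel (\<lambda>x::'a::euclidean_space. 1 / (1 + norm x) ^ (2 * DIM('a)))"
  using nn_integral_weight_finite by (intro integrableI_bounded) (auto simp: norm_divide)

text \<open>What integration needs of a Schwartz weight: in the superpositions below all derivatives
  fall on the other factor.\<close>

definition rapid :: "('a::euclidean_space \<Rightarrow> complex) \<Rightarrow> bool" where
  "rapid w \<longleftrightarrow> w \<in> borel_measurable borel \<and> (\<forall>m. \<exists>C. \<forall>x. (1 + norm x) ^ m * norm (w x) \<le> C)"

lemma rapid_measurable [measurable_dest]: "rapid w \<Longrightarrow> w \<in> borel_measurable borel"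
  by (simp add: rapid_def)

lemma schwartz_rapid: "w \<in> schwartz \<Longrightarrow> rapid w"
  unfolding rapid_def by (meson schwartz_bounded schwartz_smooth smooth_measurable)

lemma rapid_integrable_mult:
  fixes w :: "'a::euclidean_space \<Rightarrow> complex" and g :: "'a \<Rightarrow> complex"
  assumes w: "rapid w" and g[measurable]: "g \<in> borel_measurable borel"
    and "\<And>x. norm (g x) \<le> A * (1 + norm x) ^ m"
  shows "integrable lborel (\<lambda>x. w x * g x)"
proof -
  note [measurable] = rapid_measurable[OF w]
  obtain C where C: "\<And>x. (1 + norm x) ^ (m + 2 * DIM('a)) * norm (w x) \<le> C"
    using w unfolding rapid_def by meson
  have A: "0 \<le> A" using assms(3)[of 0] norm_ge_zero[of "g 0"] by (simp del: norm_ge_zero)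
  have "norm (w x * g x) \<le> norm (A * C * (1 / (1 + norm x) ^ (2 * DIM('a))))" for x
  proof -
    have "norm (w x * g x) \<le> norm (w x) * (A * (1 + norm x) ^ m)"
      unfolding norm_mult by (intro mult_left_mono assms) auto
    also have "\<dots> = A * ((1 + norm x) ^ (m + 2 * DIM('a)) * norm (w x)) / (1 + norm x) ^ (2 * DIM('a))"
      by (simp add: power_add field_simps add_nonneg_eq_0_iff)
    also have "\<dots> \<le> A * C / (1 + norm x) ^ (2 * DIM('a))"
      by (intro divide_right_mono mult_left_mono C A) auto
    also have "\<dots> \<le> norm (A * C * (1 / (1 + norm x) ^ (2 * DIM('a))))"
      by (simp add: divide_right_mono)
    finally show ?thesis .
  qed
  then show ?thesis
    by (intro Bochner_Integration.integrable_bound[OF integrable_mult_right[OF integrable_weight, of "A * C"]])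
       auto
qed

lemma rapid_integrable: "rapid w \<Longrightarrow> integrable lborel w"
  using rapid_integrable_mult[of w "\<lambda>_. 1" 1 0] by simp

lemma rapid_integrable_norm_mult:
  assumes w: "rapid w"
  shows "integrable lborel (\<lambda>x. norm (w x) * (1 + c * norm x) ^ m)"
proof -
  have "integrable lborel (\<lambda>x. w x * of_real ((1 + c * norm x) ^ m))"
  proof (rule rapid_integrable_mult[OF w])
    show "norm (complex_of_real ((1 + c * norm x) ^ m)) \<le> (1 + \<bar>c\<bar>) ^ m * (1 + norm x) ^ m" for x :: 'a
    proof -
      have "\<bar>1 + c * norm x\<bar> \<le> 1 + \<bar>c\<bar> * norm x"
        using abs_triangle_ineq[of 1 "c * norm x"] by (simp add: abs_mult)
      also have "\<dots> \<le> (1 + \<bar>c\<bar>) * (1 + norm x)" by (simp add: algebra_simps)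
      finally show ?thesis unfolding norm_of_real power_abs power_mult_distrib[symmetric]
        by (intro power_mono) auto
    qed
  qed measurable
  from integrable_norm[OF this] have "integrable lborel (\<lambda>x. \<bar>norm (w x) * (1 + c * norm x) ^ m\<bar>)"
    by (simp only: norm_mult norm_of_real abs_mult abs_norm_cancel)
  moreover have "(\<lambda>x. norm (w x) * (1 + c * norm x) ^ m) \<in> borel_measurable borel"
    using rapid_measurable[OF w] by measurable
  ultimately show ?thesis by (subst (asm) integrable_abs_iff) simp_all
qed

text \<open>The mean value inequality on the unit ball around \<open>y0\<close> bounds the
  difference quotients, with the linear part subtracted, by 2 h; dominated convergence along
  sequences then gives the Frechet derivative.\<close>

lemma has_derivative_lebesgue_integral:
  fixes f :: "'x::euclidean_space \<Rightarrow> 'a::euclidean_space \<Rightarrow> complex"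
  assumes der: "\<And>x y. (f x has_derivative f' x y) (at y)"
    and int: "\<And>y. integrable M (\<lambda>x. f x y)"
    and meas: "\<And>v. (\<lambda>x. f' x y0 v) \<in> borel_measurable M"
    and bound: "\<And>x y v. norm (y - y0) \<le> 1 \<Longrightarrow> norm (f' x y v) \<le> h x * norm v"
    and h: "integrable M h" "\<And>x. 0 \<le> h x"
  shows "((\<lambda>y. LINT x|M. f x y) has_derivative (\<lambda>v. LINT x|M. f' x y0 v)) (at y0)"
proof -
  have bl: "bounded_linear (f' x y)" for x y using der has_derivative_bounded_linear by blast
  have int': "integrable M (\<lambda>x. f' x y0 v)" for v
    by (rule Bochner_Integration.integrable_bound[OF integrable_mult_left[OF h(1), of "norm v"] meas])
       (use bound[of y0] h(2) in \<open>auto intro!: always_eventually order_trans[OF bound[of y0]]\<close>)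
  have lin: "bounded_linear (\<lambda>v. LINT x|M. f' x y0 v)"
  proof (rule bounded_linear_intro[where K="LINT x|M. h x"])
    fix v w show "(LINT x|M. f' x y0 (v + w)) = (LINT x|M. f' x y0 v) + (LINT x|M. f' x y0 w)"
      by (subst Bochner_Integration.integral_add[symmetric, OF int' int'])
         (simp add: linear_add[OF bounded_linear.linear[OF bl]])
  next
    fix r v show "(LINT x|M. f' x y0 (r *\<^sub>R v)) = r *\<^sub>R (LINT x|M. f' x y0 v)"
      by (subst integral_scaleR_right[symmetric]) (simp add: linear_scale[OF bounded_linear.linear[OF bl]] int')
  next
    fix v
    have "norm (LINT x|M. f' x y0 v) \<le> (LINT x|M. h x * norm v)"
      by (intro Bochner_Integration.integral_norm_bound_integral[of M "\<lambda>x. f' x y0 v" "\<lambda>x. h x * norm v"] int' integrable_mult_left h bound) simp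
    then show "norm (LINT x|M. f' x y0 v) \<le> norm v * (LINT x|M. h x)" by (simp add: mult.commute)
  qed
  let ?q = "\<lambda>x k. (f x (y0 + k) - f x y0 - f' x y0 k) /\<^sub>R norm k"
  \<comment> \<open>Restricting to the ball keeps each increment in the region where
    \<open>bound\<close> is available; the filter is the same as \<open>at 0\<close>.\<close>
  have "((\<lambda>k. LINT x|M. ?q x k) \<longlongrightarrow> 0) (at 0 within ball 0 1)"
    unfolding tendsto_at_iff_sequentially
  proof (intro allI impI)
    fix X :: "nat \<Rightarrow> 'a"
    assume X: "\<forall>i. X i \<in> ball 0 1 - {0}" and X0: "X \<longlonglongrightarrow> 0"
    have "(\<lambda>i. LINT x|M. ?q x (X i)) \<longlonglongrightarrow> (LINT x|M. 0)"
    proof (rule integral_dominated_convergence[where w="\<lambda>x. 2 * h x"])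
      show "(\<lambda>x. ?q x (X i)) \<in> borel_measurable M" for i
        using int[THEN borel_measurable_integrable] meas by measurable
      show "AE x in M. (\<lambda>i. ?q x (X i)) \<longlonglongrightarrow> 0"
      proof (rule AE_I2)
        fix x
        have "((\<lambda>k. norm (f x (y0 + k) - f x y0 - f' x y0 k) / norm k) \<longlongrightarrow> 0) (at 0)"
          using der[of x y0] by (simp add: has_derivative_at)
        moreover have "filterlim X (at 0) sequentially"
          using X X0 by (auto simp: filterlim_at intro!: always_eventually)
        ultimately have "(\<lambda>i. norm (?q x (X i))) \<longlonglongrightarrow> 0"
          by (drule_tac filterlim_compose) (auto simp: divide_inverse mult.commute)
        then show "(\<lambda>i. ?q x (X i)) \<longlonglongrightarrow> 0" by (rule tendsto_norm_zero_cancel)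
      qed
      show "AE x in M. norm (?q x (X i)) \<le> 2 * h x" for i
      proof (rule AE_I2)
        fix x
        have k: "X i \<noteq> 0" "norm (X i) \<le> 1" using X by (auto simp: less_imp_le)
        have "norm (f x (y0 + X i) - f x y0) \<le> h x * norm (y0 + X i - y0)"
        proof (rule differentiable_bound[of "cball y0 1" "f x" "f' x"])
          fix y assume "y \<in> cball y0 1"
          then show "onorm (f' x y) \<le> h x"
            by (intro onorm_le bound) (auto simp: dist_norm norm_minus_commute)
        qed (use k der in \<open>auto intro: has_derivative_at_withinI simp: dist_norm\<close>)
        moreover have "norm (f' x y0 (X i)) \<le> h x * norm (X i)" by (rule bound) simp
        ultimately have "norm (f x (y0 + X i) - f x y0 - f' x y0 (X i)) \<le> 2 * h x * norm (X i)"
          using norm_triangle_ineq4[of "f x (y0 + X i) - f x y0" "f' x y0 (X i)"] by simp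
        then show "norm (?q x (X i)) \<le> 2 * h x"
          using k unfolding norm_scaleR abs_norm_cancel abs_inverse by (simp add: inverse_eq_divide pos_divide_le_eq mult.commute)
      qed
    qed (use h in auto)
    then show "((\<lambda>k. LINT x|M. ?q x k) \<circ> X) \<longlonglongrightarrow> 0" by (simp add: comp_def)
  qed
  moreover have "at (0::'a) within ball 0 1 = at 0" by (rule at_within_open) auto
  ultimately have "((\<lambda>k. LINT x|M. ?q x k) \<longlongrightarrow> 0) (at 0)" by (simp only:)
  moreover have "(LINT x|M. ?q x k)
      = ((LINT x|M. f x (y0 + k)) - (LINT x|M. f x y0) - (LINT x|M. f' x y0 k)) /\<^sub>R norm k" for k
    using int int' by simp
  ultimately have "((\<lambda>k. ((LINT x|M. f x (y0 + k)) - (LINT x|M. f x y0) - (LINT x|M. f' x y0 k)) /\<^sub>R norm k) \<longlongrightarrow> 0) (at 0)"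
    by (simp only:)
  from tendsto_norm_zero[OF this] show ?thesis
    using lin by (simp add: has_derivative_at divide_inverse mult.commute)
qed

section \<open>Changes of variable and Fourier integrals\<close>

lemma integral_lborel_translate:
  fixes f :: "'a::euclidean_space \<Rightarrow> 'b::{banach, second_countable_topology}"
  assumes [measurable]: "f \<in> borel_measurable borel"
  shows "(LINT x|lborel. f (x + a)) = (LINT x|lborel. f x)"
proof -
  have "(LINT x|lborel. f x) = (LINT x|distr lborel borel ((+) a). f x)"
    by (simp add: lborel_distr_plus)
  also have "\<dots> = (LINT x|lborel. f (x + a))" by (subst integral_distr) (auto simp: add.commute)
  finally show ?thesis ..
qed

lemma integral_lborel_scale:
  fixes f :: "'a::euclidean_space \<Rightarrow> 'b::{banach, second_countable_topology}"
  assumes [measurable]: "f \<in> borel_measurable borel" and c: "c \<noteq> 0"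
  shows "(LINT x|lborel. f x) = \<bar>c\<bar> ^ DIM('a) *\<^sub>R (LINT x|lborel. f (t + c *\<^sub>R x))"
proof -
  have "(LINT x|lborel. f x) = (LINT x|density (distr lborel borel (\<lambda>x. t + c *\<^sub>R x)) (\<lambda>_. ennreal (\<bar>c\<bar>^DIM('a))). f x)"
    using lborel_affine[OF c, of t] by simp
  also have "\<dots> = (LINT x|distr lborel borel (\<lambda>x. t + c *\<^sub>R x). \<bar>c\<bar>^DIM('a) *\<^sub>R f x)"
    by (subst integral_density) auto
  also have "\<dots> = (LINT x|lborel. \<bar>c\<bar>^DIM('a) *\<^sub>R f (t + c *\<^sub>R x))"
    by (subst integral_distr) auto
  finally show ?thesis using c by simp
qed

lemma nn_integral_lborel_scale:
  fixes f :: "'a::euclidean_space \<Rightarrow> ennreal"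
  assumes [measurable]: "f \<in> borel_measurable borel" and c: "c \<noteq> 0"
  shows "(\<integral>\<^sup>+x. f x \<partial>lborel) = ennreal (\<bar>c\<bar> ^ DIM('a)) * (\<integral>\<^sup>+x. f (t + c *\<^sub>R x) \<partial>lborel)"
  by (subst lborel_affine[OF c, of t]) (simp add: nn_integral_density nn_integral_distr nn_integral_cmult)

lemma fourier_integrable:
  fixes \<phi> :: "'a::euclidean_space \<Rightarrow> complex"
  assumes "rapid \<phi>"
  shows "integrable lborel (\<lambda>x. exp (- \<i> * of_real (x \<bullet> \<xi>)) * \<phi> x)"
proof -
  have "integrable lborel (\<lambda>x. \<phi> x * exp (- \<i> * of_real (x \<bullet> \<xi>)))"
    by (rule rapid_integrable_mult[OF assms, of _ 1 0]) auto
  then show ?thesis by (simp add: mult.commute)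
qed

lemma has_derivative_cexp:
  fixes g :: "'a::real_normed_vector \<Rightarrow> complex"
  assumes "(g has_derivative g') (at x)"
  shows "((\<lambda>x. exp (g x)) has_derivative (\<lambda>v. exp (g x) * g' v)) (at x)"
  using has_derivative_compose[OF assms DERIV_exp[unfolded has_field_derivative_def]] .

lemma fourier_has_derivative:
  fixes \<phi> :: "'a::euclidean_space \<Rightarrow> complex"
  assumes "\<phi> \<in> schwartz"
  shows "(fourier \<phi> has_derivative (\<lambda>v. fourier (\<lambda>x. - \<i> * of_real (x \<bullet> v) * \<phi> x) \<xi>)) (at \<xi>)"
proof -
  note r = schwartz_rapid[OF assms] and [measurable] = rapid_measurable[OF schwartz_rapid[OF assms]]
  have "((\<lambda>\<xi>. LINT x|lborel. exp (- \<i> * of_real (x \<bullet> \<xi>)) * \<phi> x) has_derivative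
      (\<lambda>v. LINT x|lborel. exp (- \<i> * of_real (x \<bullet> \<xi>)) * (- \<i> * of_real (x \<bullet> v) * \<phi> x))) (at \<xi>)"
  proof (rule has_derivative_lebesgue_integral[where h="\<lambda>x. norm (\<phi> x) * (1 + 1 * norm x) ^ 1"
        and f="\<lambda>x \<xi>. exp (- \<i> * of_real (x \<bullet> \<xi>)) * \<phi> x"
        and f'="\<lambda>x \<xi> v. exp (- \<i> * of_real (x \<bullet> \<xi>)) * (- \<i> * of_real (x \<bullet> v) * \<phi> x)"])
    fix x y :: 'a
    show "((\<lambda>\<xi>. exp (- \<i> * of_real (x \<bullet> \<xi>)) * \<phi> x) has_derivative
      (\<lambda>v. exp (- \<i> * of_real (x \<bullet> y)) * (- \<i> * of_real (x \<bullet> v) * \<phi> x))) (at y)"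
      by (rule has_derivative_eq_rhs[OF has_derivative_mult_left[OF has_derivative_cexp]])
         (auto intro!: derivative_eq_intros)
  next
    fix x v y :: 'a
    have "\<bar>x \<bullet> v\<bar> * norm (\<phi> x) \<le> ((1 + norm x) * norm v) * norm (\<phi> x)"
      using Cauchy_Schwarz_ineq2[of x v] by (intro mult_right_mono) (auto simp: algebra_simps add_increasing)
    then show "norm (exp (- \<i> * of_real (x \<bullet> y)) * (- \<i> * of_real (x \<bullet> v) * \<phi> x))
        \<le> norm (\<phi> x) * (1 + 1 * norm x) ^ 1 * norm v"
      by (simp add: norm_mult ac_simps)
  qed (use fourier_integrable[OF r] rapid_integrable_norm_mult[OF r, of 1 1] in auto)
  then show ?thesis by (simp add: fourier_def[abs_def])
qed

text \<open>Instead of integrating by parts, the transform of the translate of \<phi> by t b is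
  differentiated at t = 0 in two ways: under the integral, and through the character exp (i t (\<xi>
  . b)) that the translation produces.\<close>

lemma fourier_pd:
  fixes \<phi> :: "'a::euclidean_space \<Rightarrow> complex"
  assumes "\<phi> \<in> schwartz" "b \<in> Basis"
  shows "fourier (pd b \<phi>) \<xi> = \<i> * of_real (\<xi> \<bullet> b) * fourier \<phi> \<xi>"
proof -
  note sm = schwartz_smooth[OF assms(1)]
  note [measurable] = rapid_measurable[OF schwartz_rapid[OF assms(1)]]
    rapid_measurable[OF schwartz_rapid[OF schwartz_pd[OF assms]]]
  obtain C where C: "C > 0" "\<And>x. (1 + norm x) ^ (2 * DIM('a)) * norm (pd b \<phi> x) \<le> C"
    using schwartz_bounded[OF schwartz_pd[OF assms]] by blast
  let ?e = "\<lambda>x. exp (- \<i> * of_real (x \<bullet> \<xi>))"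
  have tr: "(\<lambda>x. \<phi> (x + a)) \<in> schwartz" for a by (rule schwartz_translate[OF assms(1)])
  have "((\<lambda>t::real. LINT x|lborel. ?e x * \<phi> (x + t *\<^sub>R b)) has_derivative
      (\<lambda>v. LINT x|lborel. ?e x * (of_real v * pd b \<phi> (x + 0 *\<^sub>R b)))) (at 0)"
  proof (rule has_derivative_lebesgue_integral[where f="\<lambda>x t. ?e x * \<phi> (x + t *\<^sub>R b)"
        and f'="\<lambda>x t v. ?e x * (of_real v * pd b \<phi> (x + t *\<^sub>R b))"
        and h="\<lambda>x. (2 ^ (2 * DIM('a)) * C) * (1 / (1 + norm x) ^ (2 * DIM('a)))"])
    fix x :: 'a and t :: real
    have "((\<lambda>t. \<phi> (x + t *\<^sub>R b)) has_derivative (\<lambda>v. frechet_derivative \<phi> (at (x + t *\<^sub>R b)) (v *\<^sub>R b))) (at t)"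
      by (rule has_derivative_compose[OF _ smooth_has_derivative[OF sm]]) (auto intro!: derivative_eq_intros)
    then have "((\<lambda>t. \<phi> (x + t *\<^sub>R b)) has_derivative (\<lambda>v. of_real v * pd b \<phi> (x + t *\<^sub>R b))) (at t)"
      by (simp add: linear_scale[OF linear_frechet_derivative[OF smooth_differentiable[OF sm]]] scaleR_conv_of_real)
    then show "((\<lambda>t. ?e x * \<phi> (x + t *\<^sub>R b)) has_derivative
        (\<lambda>v. ?e x * (of_real v * pd b \<phi> (x + t *\<^sub>R b)))) (at t)"
      by (rule has_derivative_mult_right)
  next
    fix t :: real
    show "integrable lborel (\<lambda>x. ?e x * \<phi> (x + t *\<^sub>R b))"
      by (rule fourier_integrable[OF schwartz_rapid[OF tr]])
  next
    fix x :: 'a and t v :: real assume t: "norm (t - 0) \<le> 1"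
    let ?y = "x + t *\<^sub>R b"
    have "1 + norm x \<le> (1 + norm ?y) * (1 + norm (t *\<^sub>R b))" by (rule one_plus_norm_shift)
    \<comment> \<open>With |t| \<le> 1 and |b| = 1, each power of the weight costs a factor 2; this
      is the power of 2 in the majorant.\<close>
    also have "\<dots> \<le> (1 + norm ?y) * 2" using t assms(2) by (intro mult_left_mono) auto
    finally have "(1 + norm x) ^ (2 * DIM('a)) \<le> ((1 + norm ?y) * 2) ^ (2 * DIM('a))"
      by (intro power_mono) auto
    then have "(1 + norm x) ^ (2 * DIM('a)) * norm (pd b \<phi> ?y)
        \<le> ((1 + norm ?y) * 2) ^ (2 * DIM('a)) * norm (pd b \<phi> ?y)"
      by (rule mult_right_mono) simp
    also have "\<dots> \<le> 2 ^ (2 * DIM('a)) * C"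
      using mult_left_mono[OF C(2), of "2 ^ (2 * DIM('a))" ?y]
      by (simp only: power_mult_distrib ac_simps) simp
    finally have "norm (pd b \<phi> ?y) \<le> (2 ^ (2 * DIM('a)) * C) * (1 / (1 + norm x) ^ (2 * DIM('a)))"
      by (simp add: pos_le_divide_eq add_pos_nonneg mult.commute)
    from mult_right_mono[OF this norm_ge_zero, of v]
    show "norm (?e x * (of_real v * pd b \<phi> ?y))
        \<le> (2 ^ (2 * DIM('a)) * C) * (1 / (1 + norm x) ^ (2 * DIM('a))) * norm v"
      by (simp add: norm_mult mult.commute)
  qed (use integrable_mult_right[OF integrable_weight] C in auto)
  moreover have "(LINT x|lborel. ?e x * \<phi> (x + t *\<^sub>R b)) = exp (\<i> * of_real (t * (\<xi> \<bullet> b))) * fourier \<phi> \<xi>" for t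
  proof -
    have "exp (\<i> * of_real (t * (\<xi> \<bullet> b))) * fourier \<phi> \<xi>
        = (LINT x|lborel. exp (\<i> * of_real (t * (\<xi> \<bullet> b))) * (?e x * \<phi> x))"
      unfolding fourier_def using fourier_integrable[OF schwartz_rapid[OF assms(1)]] by simp
    also have "\<dots> = (LINT x|lborel. exp (\<i> * of_real (t * (\<xi> \<bullet> b))) * (?e (x + t *\<^sub>R b) * \<phi> (x + t *\<^sub>R b)))"
      by (subst integral_lborel_translate) auto
    also have "\<dots> = (LINT x|lborel. ?e x * \<phi> (x + t *\<^sub>R b))"
    proof -
      have "\<i> * of_real (t * (\<xi> \<bullet> b)) + - \<i> * of_real ((x + t *\<^sub>R b) \<bullet> \<xi>) = - \<i> * of_real (x \<bullet> \<xi>)" for x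
        by (simp add: inner_add_left inner_commute[of b \<xi>] distrib_left)
      then show ?thesis unfolding mult.assoc[symmetric] mult_exp_exp by simp
    qed
    finally show ?thesis ..
  qed
  ultimately have "((\<lambda>t. exp (\<i> * of_real (t * (\<xi> \<bullet> b))) * fourier \<phi> \<xi>) has_derivative
      (\<lambda>v. LINT x|lborel. ?e x * (of_real v * pd b \<phi> x))) (at (0::real))" by simp
  moreover have "((\<lambda>t. exp (\<i> * of_real (t * (\<xi> \<bullet> b))) * fourier \<phi> \<xi>) has_derivative
      (\<lambda>v. of_real v * (\<i> * of_real (\<xi> \<bullet> b) * fourier \<phi> \<xi>))) (at (0::real))"
    by (rule has_derivative_eq_rhs[OF has_derivative_mult_left[OF has_derivative_cexp]])
       (auto intro!: derivative_eq_intros simp: algebra_simps)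
  ultimately have "(\<lambda>v. LINT x|lborel. ?e x * (of_real v * pd b \<phi> x))
      = (\<lambda>v. of_real v * (\<i> * of_real (\<xi> \<bullet> b) * fourier \<phi> \<xi>))"
    by (rule has_derivative_unique)
  from fun_cong[OF this, of 1] show ?thesis by (simp add: fourier_def)
qed

text \<open>One more factor 1 + |\<xi>| is at most 1 plus the sum of the |\<xi> . b|, and
  \<open>fourier_pd\<close> converts each of these into the transform of a partial derivative. Hence
  the induction is over all Schwartz functions at once.\<close>

lemma fourier_weight_bound:
  assumes "\<phi> \<in> schwartz"
  shows "\<exists>C. \<forall>\<xi>. (1 + norm \<xi>) ^ m * norm (fourier \<phi> \<xi>) \<le> C"
  using assms
proof (induction m arbitrary: \<phi>)
  case 0
  have "norm (fourier \<phi> \<xi>) \<le> (LINT x|lborel. norm (exp (- \<i> * of_real (x \<bullet> \<xi>)) * \<phi> x))" for \<xi>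
    unfolding fourier_def by (rule integral_norm_bound)
  then have "norm (fourier \<phi> \<xi>) \<le> (LINT x|lborel. norm (\<phi> x))" for \<xi>
    by (simp add: norm_mult)
  then show ?case by auto
next
  case (Suc m)
  obtain C where C: "\<And>\<xi>. (1 + norm \<xi>) ^ m * norm (fourier \<phi> \<xi>) \<le> C" using Suc by blast
  have "\<forall>b\<in>Basis. \<exists>D. \<forall>\<xi>. (1 + norm \<xi>) ^ m * norm (fourier (pd b \<phi>) \<xi>) \<le> D"
    using Suc.IH[OF schwartz_pd[OF Suc.prems]] by blast
  then obtain D where D: "\<And>b \<xi>. b \<in> Basis \<Longrightarrow> (1 + norm \<xi>) ^ m * norm (fourier (pd b \<phi>) \<xi>) \<le> D b"
    by metis
  have "(1 + norm \<xi>) ^ Suc m * norm (fourier \<phi> \<xi>) \<le> C + (\<Sum>b\<in>Basis. D b)" for \<xi>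
  proof -
    have "(1 + norm \<xi>) * norm (fourier \<phi> \<xi>) \<le> (1 + (\<Sum>b\<in>Basis. \<bar>\<xi> \<bullet> b\<bar>)) * norm (fourier \<phi> \<xi>)"
      by (intro mult_right_mono add_left_mono norm_le_l1) auto
    also have "\<dots> = norm (fourier \<phi> \<xi>) + (\<Sum>b\<in>Basis. norm (fourier (pd b \<phi>) \<xi>))"
      by (simp add: fourier_pd[OF Suc.prems] norm_mult distrib_right sum_distrib_right)
    finally have "(1 + norm \<xi>) ^ m * ((1 + norm \<xi>) * norm (fourier \<phi> \<xi>))
        \<le> (1 + norm \<xi>) ^ m * (norm (fourier \<phi> \<xi>) + (\<Sum>b\<in>Basis. norm (fourier (pd b \<phi>) \<xi>)))"
      by (intro mult_left_mono) auto
    also have "\<dots> = (1 + norm \<xi>) ^ m * norm (fourier \<phi> \<xi>)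
        + (\<Sum>b\<in>Basis. (1 + norm \<xi>) ^ m * norm (fourier (pd b \<phi>) \<xi>))"
      by (simp add: distrib_left sum_distrib_left)
    also have "\<dots> \<le> C + (\<Sum>b\<in>Basis. D b)" by (intro add_mono C sum_mono D)
    finally show ?thesis by (simp add: ac_simps)
  qed
  then show ?case by blast
qed

lemma fourier_schwartz:
  fixes \<phi> :: "'a::euclidean_space \<Rightarrow> complex"
  assumes "\<phi> \<in> schwartz"
  shows "fourier \<phi> \<in> schwartz"
proof (rule schwartz_classI[of "fourier ` schwartz"])
  fix f :: "'a \<Rightarrow> complex" and x assume "f \<in> fourier ` schwartz"
  then show "f differentiable (at x)"
    using fourier_has_derivative by (auto simp: differentiable_def)
next
  fix f :: "'a \<Rightarrow> complex" and b :: 'a assume "f \<in> fourier ` schwartz" and b: "b \<in> Basis"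
  then obtain \<phi> where f: "f = fourier \<phi>" "\<phi> \<in> schwartz" by auto
  have "pd b f = fourier (\<lambda>x. - \<i> * (of_real (x \<bullet> b) * \<phi> x))"
    unfolding f by (simp add: pd_eqI[OF fourier_has_derivative[OF f(2)]] mult.assoc)
  then show "pd b f \<in> fourier ` schwartz"
    by (simp only:) (intro imageI schwartz_cmult schwartz_mult_inner f b)
next
  fix f :: "'a \<Rightarrow> complex" and m assume "f \<in> fourier ` schwartz"
  then show "\<exists>C. \<forall>x. (1 + norm x) ^ m * norm (f x) \<le> C" using fourier_weight_bound by auto
qed (use assms in auto)

lemma inv_fourier_eq:
  "inv_fourier \<phi> x = of_real (1 / (2 * pi) ^ DIM('a)) * fourier \<phi> (- (x::'a::euclidean_space))"
  by (simp add: inv_fourier_def fourier_def inner_commute)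

lemma inv_fourier_schwartz: "\<phi> \<in> schwartz \<Longrightarrow> inv_fourier \<phi> \<in> schwartz"
  unfolding inv_fourier_eq[abs_def] by (intro schwartz_cmult schwartz_reflect fourier_schwartz)

section \<open>Superpositions of translates\<close>

text \<open>Superpositions of translates of a Schwartz function: for \<open>h x = - x\<close> a convolution, for
  \<open>h x = c *\<^sub>R x\<close> a mollification.\<close>

definition superpose :: "('a::euclidean_space \<Rightarrow> complex) \<Rightarrow> ('a \<Rightarrow> 'a) \<Rightarrow> ('a \<Rightarrow> complex) \<Rightarrow> 'a \<Rightarrow> complex"
  where "superpose w h G y = (LINT x|lborel. w x * G (y + h x))"

text \<open>The factor 2 leaves room for simple functions approximating x \<mapsto> - x, which
  satisfy |s x| \<le> 2 |x|.\<close>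

definition linear_growth :: "('a::euclidean_space \<Rightarrow> 'a) \<Rightarrow> bool" where
  "linear_growth h \<longleftrightarrow> h \<in> borel_measurable borel \<and> (\<forall>x. norm (h x) \<le> 2 * norm x)"

lemma superpose_integrable:
  fixes w :: "'a::euclidean_space \<Rightarrow> complex"
  assumes "rapid w" "linear_growth h" "G \<in> schwartz"
  shows "integrable lborel (\<lambda>x. w x * G (y + h x))"
proof -
  obtain C where C: "\<And>x. (1 + norm x) ^ 0 * norm (G x) \<le> C"
    using schwartz_bounded[OF assms(3), of 0] by blast
  have [measurable]: "h \<in> borel_measurable borel" "G \<in> borel_measurable borel"
    using assms schwartz_smooth smooth_measurable by (auto simp: linear_growth_def)
  show ?thesis
    by (rule rapid_integrable_mult[OF assms(1), of _ C 0]) (use C in auto)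
qed

lemma superpose_has_derivative:
  fixes w :: "'a::euclidean_space \<Rightarrow> complex"
  assumes w: "rapid w" and h: "linear_growth h" and G: "G \<in> schwartz"
  shows "(superpose w h G has_derivative
    (\<lambda>v. LINT x|lborel. w x * frechet_derivative G (at (y + h x)) v)) (at y)"
proof -
  note [measurable] = rapid_measurable[OF w]
  have [measurable]: "h \<in> borel_measurable borel" using h by (simp add: linear_growth_def)
  note sd = smooth_differentiable[OF schwartz_smooth[OF G]]
  have "\<forall>b\<in>Basis. \<exists>C. \<forall>x. norm (pd b G x) \<le> C"
  proof
    fix b :: 'a assume "b \<in> Basis"
    then show "\<exists>C. \<forall>x. norm (pd b G x) \<le> C"
      using schwartz_bounded[OF schwartz_pd[OF G], of b 0] by (metis mult_1 power_0)
  qed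
  then obtain C where C: "\<And>b x. b \<in> Basis \<Longrightarrow> norm (pd b G x) \<le> C b" by metis
  have le: "norm (frechet_derivative G (at x) v) \<le> (\<Sum>b\<in>Basis. C b) * norm v" for x v
    using norm_frechet_derivative_le[OF sd] by (rule order_trans) (intro mult_right_mono sum_mono C, auto)
  have "((\<lambda>y. LINT x|lborel. w x * G (y + h x)) has_derivative
      (\<lambda>v. LINT x|lborel. w x * frechet_derivative G (at (y + h x)) v)) (at y)"
  proof (rule has_derivative_lebesgue_integral[where f="\<lambda>x y. w x * G (y + h x)"
        and h="\<lambda>x. norm (w x) * (\<Sum>b\<in>Basis. C b)"])
    fix x y
    have "((\<lambda>y. G (y + h x)) has_derivative frechet_derivative G (at (y + h x))) (at y)"
      by (rule has_derivative_compose[OF _ smooth_has_derivative[OF schwartz_smooth[OF G]]])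
         (auto intro!: derivative_eq_intros)
    then show "((\<lambda>y. w x * G (y + h x)) has_derivative (\<lambda>v. w x * frechet_derivative G (at (y + h x)) v)) (at y)"
      by (rule has_derivative_mult_right)
  next
    fix v
    have "(\<lambda>x. frechet_derivative G (at (y + h x)) v) \<in> borel_measurable lborel"
    proof -
      have [measurable]: "pd b G \<in> borel_measurable borel" if "b \<in> Basis" for b
        by (rule smooth_measurable[OF smooth_pd[OF schwartz_smooth[OF G] that]])
      have "(\<lambda>x. \<Sum>b\<in>Basis. (v \<bullet> b) *\<^sub>R pd b G (y + h x)) \<in> borel_measurable lborel"
        by measurable
      then show ?thesis by (subst frechet_derivative_Basis[OF sd])
    qed
    then show "(\<lambda>x. w x * frechet_derivative G (at (y + h x)) v) \<in> borel_measurable lborel" by measurable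
  next
    fix x z v
    show "norm (w x * frechet_derivative G (at (z + h x)) v) \<le> norm (w x) * (\<Sum>b\<in>Basis. C b) * norm v"
      using mult_left_mono[OF le norm_ge_zero, of "w x" "z + h x" v] by (simp add: norm_mult mult.assoc)
  next
    fix x
    have "0 \<le> (\<Sum>b\<in>Basis. C b)" by (intro sum_nonneg) (use C norm_ge_zero order_trans in blast)
    then show "0 \<le> norm (w x) * (\<Sum>b\<in>Basis. C b)" by simp
  qed (use superpose_integrable[OF assms] rapid_integrable[OF w] in auto)
  then show ?thesis by (simp add: superpose_def[abs_def])
qed

lemma superpose_pd:
  assumes "rapid w" "linear_growth h" "G \<in> schwartz"
  shows "pd b (superpose w h G) = superpose w h (pd b G)"
  by (simp add: pd_eqI[OF superpose_has_derivative[OF assms]] superpose_def fun_eq_iff)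

lemma superpose_pderivs:
  assumes "rapid w" "linear_growth h" "G \<in> schwartz" "set vs \<subseteq> Basis"
  shows "pderivs vs (superpose w h G) = superpose w h (pderivs vs G)"
  using assms(4) by (induction vs) (auto simp: superpose_pd[OF assms(1,2) schwartz_pderivs[OF assms(3)]])

lemma norm_integral_rapid_mult_le:
  fixes w :: "'a::euclidean_space \<Rightarrow> complex"
  assumes "rapid w"
    and "\<And>x. norm (F x) \<le> D * (1 + 2 * norm x) ^ m"
  shows "norm (LINT x|lborel. w x * F x) \<le> D * (LINT x|lborel. norm (w x) * (1 + 2 * norm x) ^ m)"
proof -
  have "norm (LINT x|lborel. w x * F x) \<le> (LINT x|lborel. norm (w x * F x))"
    by (rule integral_norm_bound)
  also have "\<dots> \<le> (LINT x|lborel. D * (norm (w x) * (1 + 2 * norm x) ^ m))"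
  proof (rule integral_mono')
    show "integrable lborel (\<lambda>x. D * (norm (w x) * (1 + 2 * norm x) ^ m))"
      using rapid_integrable_norm_mult[OF assms(1), of 2 m] by simp
    fix x show "norm (w x * F x) \<le> D * (norm (w x) * (1 + 2 * norm x) ^ m)"
      using mult_left_mono[OF assms(2)[of x], of "norm (w x)"] by (simp add: norm_mult ac_simps)
    have "0 \<le> D" using order_trans[OF norm_ge_zero assms(2)[of 0]] by simp
    then show "0 \<le> D * (norm (w x) * (1 + 2 * norm x) ^ m)" by simp
  qed
  finally show ?thesis by simp
qed

text \<open>Peetre's inequality moves the weight from y to y + h x; the price (1 + 2 |x|)^m is
  absorbed by the decay of w. Derivatives pass to G, so superpositions form a stable class.\<close>

lemma superpose_schwartz:
  fixes w :: "'a::euclidean_space \<Rightarrow> complex"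
  assumes w: "rapid w" and h: "linear_growth h" and G: "G \<in> schwartz"
  shows "superpose w h G \<in> schwartz"
proof (rule schwartz_classI[of "superpose w h ` schwartz"])
  fix f and m :: nat assume "f \<in> superpose w h ` schwartz"
  then obtain G where f: "f = superpose w h G" "G \<in> schwartz" by auto
  obtain C where C: "C > 0" "\<And>x. (1 + norm x) ^ m * norm (G x) \<le> C"
    using schwartz_bounded[OF f(2)] by blast
  have "(1 + norm y) ^ m * norm (f y) \<le> C * (LINT x|lborel. norm (w x) * (1 + 2 * norm x) ^ m)" for y
  proof -
    have "norm (of_real ((1 + norm y) ^ m) * G (y + h x)) \<le> C * (1 + 2 * norm x) ^ m" for x
    proof -
      have "1 + norm y \<le> (1 + norm (y + h x)) * (1 + norm (h x))" by (rule one_plus_norm_shift)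
      also have "\<dots> \<le> (1 + norm (y + h x)) * (1 + 2 * norm x)"
        using h by (intro mult_left_mono) (auto simp: linear_growth_def)
      finally have "(1 + norm y) ^ m \<le> ((1 + norm (y + h x)) * (1 + 2 * norm x)) ^ m"
        by (intro power_mono) auto
      from mult_right_mono[OF this norm_ge_zero, of "G (y + h x)"]
      have "(1 + norm y) ^ m * norm (G (y + h x))
          \<le> ((1 + norm (y + h x)) ^ m * norm (G (y + h x))) * (1 + 2 * norm x) ^ m"
        by (simp only: power_mult_distrib ac_simps)
      also have "\<dots> \<le> C * (1 + 2 * norm x) ^ m" by (intro mult_right_mono C) auto
      finally show ?thesis unfolding norm_mult norm_of_real by simp
    qed
    from norm_integral_rapid_mult_le[OF w this]
    have "norm (LINT x|lborel. w x * (of_real ((1 + norm y) ^ m) * G (y + h x)))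
        \<le> C * (LINT x|lborel. norm (w x) * (1 + 2 * norm x) ^ m)" .
    moreover have "(LINT x|lborel. w x * (of_real ((1 + norm y) ^ m) * G (y + h x))) = of_real ((1 + norm y) ^ m) * f y"
      unfolding f superpose_def
      by (subst integral_mult_right_zero[symmetric]) (simp add: ac_simps)
    ultimately show ?thesis by (simp only: norm_mult norm_of_real) simp
  qed
  then show "\<exists>C. \<forall>x. (1 + norm x) ^ m * norm (f x) \<le> C" by blast
next
  fix f and x assume "f \<in> superpose w h ` schwartz"
  then show "f differentiable (at x)"
    using superpose_has_derivative[OF w h] by (auto simp: differentiable_def)
next
  fix f and b :: 'a assume "f \<in> superpose w h ` schwartz" and b: "b \<in> Basis"
  then obtain G where f: "f = superpose w h G" and G: "G \<in> schwartz" by auto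
  show "pd b f \<in> superpose w h ` schwartz"
    unfolding f superpose_pd[OF w h G] by (intro imageI schwartz_pd G b)
qed (use G in auto)

section \<open>Tempered functionals applied to superpositions\<close>

lemma finite_multi_indices: "finite (multi_indices N)"
  unfolding multi_indices_def by (rule finite_lists_length_le[OF finite_Basis])

text \<open>In this form a single pointwise bound e controls u, and neither suprema nor sums of
  seminorms appear in the estimates. The order N depends on u only.\<close>

lemma tempered_bound:
  fixes u :: "('a::euclidean_space \<Rightarrow> complex) \<Rightarrow> complex"
  assumes "u \<in> tempered"
  obtains N C where "C > 0" "\<And>\<phi> e. \<phi> \<in> schwartz \<Longrightarrow>
     (\<And>vs x. vs \<in> multi_indices N \<Longrightarrow> (1 + norm x) ^ N * norm (pderivs vs \<phi> x) \<le> e) \<Longrightarrow> norm (u \<phi>) \<le> C * e"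
proof -
  obtain C N where u: "\<And>\<phi>. \<phi> \<in> schwartz \<Longrightarrow> norm (u \<phi>) \<le>
        C * (\<Sum>vs\<in>multi_indices N. SUP x. (1 + norm x) ^ N * norm (pderivs vs \<phi> x))"
    using assms unfolding tempered_def by blast
  let ?C = "\<bar>C\<bar> * card (multi_indices N :: 'a list set) + 1"
  have "norm (u \<phi>) \<le> ?C * e" if \<phi>: "\<phi> \<in> schwartz"
    and e: "\<And>vs x. vs \<in> multi_indices N \<Longrightarrow> (1 + norm x) ^ N * norm (pderivs vs \<phi> x) \<le> e" for \<phi> e
  proof -
    let ?s = "\<lambda>vs. SUP x. (1 + norm x) ^ N * norm (pderivs vs \<phi> x)"
    have s: "0 \<le> ?s vs" "?s vs \<le> e" if vs: "vs \<in> multi_indices N" for vs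
    proof -
      have "set vs \<subseteq> Basis" using vs by (simp add: multi_indices_def)
      then have "bdd_above (range (\<lambda>x. (1 + norm x) ^ N * norm (pderivs vs \<phi> x)))"
        using \<phi> by (simp add: schwartz_def)
      from cSUP_upper[OF UNIV_I this, of 0] show "0 \<le> ?s vs"
        by (rule order_trans[rotated]) simp
      show "?s vs \<le> e" by (rule cSUP_least) (use e[OF vs] in auto)
    qed
    have "[] \<in> multi_indices N" by (simp add: multi_indices_def)
    with s have e0: "0 \<le> e" by (meson order_trans)
    have "norm (u \<phi>) \<le> C * (\<Sum>vs\<in>multi_indices N. ?s vs)" by (rule u[OF \<phi>])
    also have "\<dots> \<le> \<bar>C\<bar> * (\<Sum>vs\<in>multi_indices N. ?s vs)"
      by (intro mult_right_mono sum_nonneg s) auto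
    also have "\<dots> \<le> \<bar>C\<bar> * (\<Sum>vs\<in>(multi_indices N :: 'a list set). e)"
      by (intro mult_left_mono sum_mono s) auto
    also have "\<dots> \<le> ?C * e" using e0 by (simp add: algebra_simps)
    finally show ?thesis .
  qed
  moreover have "0 < ?C" by (simp add: add_nonneg_pos)
  ultimately show ?thesis using that[of ?C N] by blast
qed

lemma tempered_add: "u \<in> tempered \<Longrightarrow> f \<in> schwartz \<Longrightarrow> g \<in> schwartz \<Longrightarrow> u (\<lambda>x. f x + g x) = u f + u g"
  by (simp add: tempered_def linear_functional_on_def)

lemma tempered_cmult: "u \<in> tempered \<Longrightarrow> f \<in> schwartz \<Longrightarrow> u (\<lambda>x. c * f x) = c * u f"
  by (simp add: tempered_def linear_functional_on_def)

lemma tempered_diff: "u \<in> tempered \<Longrightarrow> f \<in> schwartz \<Longrightarrow> g \<in> schwartz \<Longrightarrow> u (\<lambda>x. f x - g x) = u f - u g"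
  using tempered_add[of u f "\<lambda>x. (-1) * g x"] tempered_cmult[of u g "-1"] schwartz_cmult[of g "-1"] by simp

lemma tempered_sum:
  assumes "u \<in> tempered" "\<And>i. i \<in> I \<Longrightarrow> f i \<in> schwartz"
  shows "u (\<lambda>x. \<Sum>i\<in>I. f i x) = (\<Sum>i\<in>I. u (f i))"
  using assms(2)
proof (induction I rule: infinite_finite_induct)
  case (insert i I)
  then show ?case using tempered_add[OF assms(1), of "f i" "\<lambda>x. \<Sum>i\<in>I. f i x"] schwartz_sum[of I f] by simp
qed (use tempered_cmult[OF assms(1) schwartz_zero, of 0] in simp_all)

lemma schwartz_pderivs_translate_diff_bound:
  fixes G :: "'a::euclidean_space \<Rightarrow> complex"
  assumes G: "G \<in> schwartz"
  obtains E where "0 \<le> E" "\<And>vs y a b. vs \<in> multi_indices N \<Longrightarrow>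
    (1 + norm y) ^ N * norm (pderivs vs G (y + a) - pderivs vs G (y + b))
    \<le> E * norm (a - b) * (1 + norm a + norm b) ^ N"
proof -
  have "\<forall>vs\<in>multi_indices N. \<exists>D>0. \<forall>y a b. (1 + norm y) ^ N * norm (pderivs vs G (y + a) - pderivs vs G (y + b))
    \<le> D * norm (a - b) * (1 + norm a + norm b) ^ N"
  proof
    fix vs :: "'a list" assume "vs \<in> multi_indices N"
    then have "set vs \<subseteq> Basis" by (simp add: multi_indices_def)
    from schwartz_translate_diff_bound[OF schwartz_pderivs[OF G this], of N]
    show "\<exists>D>0. \<forall>y a b. (1 + norm y) ^ N * norm (pderivs vs G (y + a) - pderivs vs G (y + b))
        \<le> D * norm (a - b) * (1 + norm a + norm b) ^ N" by metis
  qed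
  then obtain D where D: "\<And>vs. vs \<in> multi_indices N \<Longrightarrow> D vs > 0"
    "\<And>vs y a b. vs \<in> multi_indices N \<Longrightarrow>
      (1 + norm y) ^ N * norm (pderivs vs G (y + a) - pderivs vs G (y + b))
      \<le> D vs * norm (a - b) * (1 + norm a + norm b) ^ N"
    by metis
  define E where "E = (\<Sum>vs\<in>multi_indices N. D vs)"
  have E0: "0 \<le> E" unfolding E_def using D(1) by (intro sum_nonneg) (auto intro: less_imp_le)
  have E: "D vs \<le> E" if "vs \<in> multi_indices N" for vs
    unfolding E_def using D(1) by (intro member_le_sum that finite_multi_indices) (auto intro: less_imp_le)
  have "(1 + norm y) ^ N * norm (pderivs vs G (y + a) - pderivs vs G (y + b))
      \<le> E * norm (a - b) * (1 + norm a + norm b) ^ N" if vs: "vs \<in> multi_indices N" for vs y a b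
    using D(2)[OF vs] by (rule order_trans) (intro mult_right_mono E vs, auto)
  then show ?thesis using that E0 by blast
qed

text \<open>The difference of the two superpositions is small in every Schwartz seminorm: by the
  mean value bound for translates, the seminorm is at most the integral of |w| |H i - h| times a
  power, which tends to 0 by dominated convergence. It serves twice, for simple-function
  approximations of - x and for dilations that shrink to 0.\<close>

lemma superpose_tendsto:
  fixes w :: "'a::euclidean_space \<Rightarrow> complex"
  assumes u: "u \<in> tempered" and w: "rapid w" and G: "G \<in> schwartz"
    and h: "linear_growth h" "\<And>i::nat. linear_growth (H i)"
    and lim: "\<And>x. (\<lambda>i. H i x) \<longlonglongrightarrow> h x"
  shows "(\<lambda>i. u (superpose w (H i) G)) \<longlonglongrightarrow> u (superpose w h G)"
proof -
  note [measurable] = rapid_measurable[OF w]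
  have [measurable]: "h \<in> borel_measurable borel" "\<And>i. H i \<in> borel_measurable borel"
    using h by (auto simp: linear_growth_def)
  obtain N C where C: "C > 0" "\<And>\<phi> e. \<phi> \<in> schwartz \<Longrightarrow>
     (\<And>vs x. vs \<in> multi_indices N \<Longrightarrow> (1 + norm x) ^ N * norm (pderivs vs \<phi> x) \<le> e) \<Longrightarrow> norm (u \<phi>) \<le> C * e"
    using tempered_bound[OF u] by metis
  obtain E where E0: "0 \<le> E" and E: "\<And>vs y a b. vs \<in> multi_indices N \<Longrightarrow>
      (1 + norm y) ^ N * norm (pderivs vs G (y + a) - pderivs vs G (y + b))
      \<le> E * norm (a - b) * (1 + norm a + norm b) ^ N"
    using schwartz_pderivs_translate_diff_bound[OF G] by blast
  \<comment> \<open>Both maps grow at most like 2 |x|, so 1 + 4 |x| dominates 1 + |H i x| + |h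
    x|.\<close>
  let ?\<rho> = "\<lambda>i x. norm (w x) * (norm (H i x - h x) * (1 + 4 * norm x) ^ N)"
  have \<rho>_le: "?\<rho> i x \<le> norm (w x) * (1 + 4 * norm x) ^ Suc N" for i x
  proof -
    have "norm (H i x - h x) \<le> norm (H i x) + norm (h x)" by (rule norm_triangle_ineq4)
    also have "\<dots> \<le> 2 * norm x + 2 * norm x" using h by (intro add_mono) (auto simp: linear_growth_def)
    also have "\<dots> \<le> 1 + 4 * norm x" by simp
    finally show ?thesis by (simp add: mult_left_mono mult_right_mono)
  qed
  have \<rho>int: "integrable lborel (?\<rho> i)" for i
    by (rule Bochner_Integration.integrable_bound[OF rapid_integrable_norm_mult[OF w, of 4 "Suc N"]])
       (use \<rho>_le in \<open>auto simp: abs_mult\<close>)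
  have "(\<lambda>i. LINT x|lborel. ?\<rho> i x) \<longlonglongrightarrow> (LINT x|(lborel :: 'a measure). (0::real))"
  proof (rule integral_dominated_convergence[where w="\<lambda>x. norm (w x) * (1 + 4 * norm x) ^ Suc N"])
    show "integrable lborel (\<lambda>x. norm (w x) * (1 + 4 * norm x) ^ Suc N)"
      by (rule rapid_integrable_norm_mult[OF w])
    show "AE x in lborel. (\<lambda>i. ?\<rho> i x) \<longlonglongrightarrow> 0"
    proof (rule AE_I2)
      fix x
      have "(\<lambda>i. ?\<rho> i x) \<longlonglongrightarrow> norm (w x) * (norm (h x - h x) * (1 + 4 * norm x) ^ N)"
        by (intro tendsto_intros lim)
      then show "(\<lambda>i. ?\<rho> i x) \<longlonglongrightarrow> 0" by simp
    qed
    show "AE x in lborel. norm (?\<rho> i x) \<le> norm (w x) * (1 + 4 * norm x) ^ Suc N" for i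
      using \<rho>_le by (auto simp: abs_mult)
  qed auto
  then have lim0: "(\<lambda>i. C * (E * (LINT x|lborel. ?\<rho> i x))) \<longlonglongrightarrow> C * (E * 0)"
    by (intro tendsto_intros) simp
  have "norm (u (superpose w (H i) G) - u (superpose w h G)) \<le> C * (E * (LINT x|lborel. ?\<rho> i x))" for i
  proof -
    have S: "superpose w (H i) G \<in> schwartz" "superpose w h G \<in> schwartz"
      using superpose_schwartz[OF w _ G] h by auto
    have "norm (u (\<lambda>y. superpose w (H i) G y - superpose w h G y)) \<le> C * (E * (LINT x|lborel. ?\<rho> i x))"
    proof (rule C(2)[OF schwartz_diff[OF S]])
      fix vs :: "'a list" and y assume vs: "vs \<in> multi_indices N"
      then have B: "set vs \<subseteq> Basis" by (simp add: multi_indices_def)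
      note vG = schwartz_pderivs[OF G B]
      have "pderivs vs (\<lambda>y. superpose w (H i) G y - superpose w h G y) y
          = (LINT x|lborel. w x * (pderivs vs G (y + H i x) - pderivs vs G (y + h x)))"
        unfolding pderivs_diff[OF schwartz_smooth[OF S(1)] schwartz_smooth[OF S(2)] B]
          superpose_pderivs[OF w h(2) G B] superpose_pderivs[OF w h(1) G B]
        unfolding superpose_def right_diff_distrib
        using superpose_integrable[OF w _ vG] h by simp
      then have "(1 + norm y) ^ N * norm (pderivs vs (\<lambda>y. superpose w (H i) G y - superpose w h G y) y)
          = norm (LINT x|lborel. of_real ((1 + norm y) ^ N) * (w x * (pderivs vs G (y + H i x) - pderivs vs G (y + h x))))"
        by (subst integral_mult_right_zero) (simp only: norm_mult norm_of_real, simp)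
      also have "\<dots> \<le> (LINT x|lborel. norm (of_real ((1 + norm y) ^ N) * (w x * (pderivs vs G (y + H i x) - pderivs vs G (y + h x)))))"
        by (rule integral_norm_bound)
      also have "\<dots> \<le> (LINT x|lborel. E * ?\<rho> i x)"
      proof (rule integral_mono')
        fix x
        have "norm (H i x) \<le> 2 * norm x" "norm (h x) \<le> 2 * norm x" using h by (auto simp: linear_growth_def)
        then have "(1 + norm (H i x) + norm (h x)) ^ N \<le> (1 + 4 * norm x) ^ N" by (intro power_mono) auto
        then have le: "E * norm (H i x - h x) * (1 + norm (H i x) + norm (h x)) ^ N
            \<le> E * norm (H i x - h x) * (1 + 4 * norm x) ^ N"
          using E0 by (intro mult_left_mono) auto
        have "norm (w x) * ((1 + norm y) ^ N * norm (pderivs vs G (y + H i x) - pderivs vs G (y + h x)))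
            \<le> norm (w x) * (E * norm (H i x - h x) * (1 + 4 * norm x) ^ N)"
          by (intro mult_left_mono order_trans[OF E[OF vs] le]) auto
        then show "norm (of_real ((1 + norm y) ^ N) * (w x * (pderivs vs G (y + H i x) - pderivs vs G (y + h x))))
            \<le> E * ?\<rho> i x"
          unfolding norm_mult norm_of_real by (simp add: ac_simps)
      qed (use \<rho>int E0 in auto)
      finally show "(1 + norm y) ^ N * norm (pderivs vs (\<lambda>y. superpose w (H i) G y - superpose w h G y) y)
          \<le> E * (LINT x|lborel. ?\<rho> i x)" using \<rho>int by simp
    qed
    then show ?thesis by (simp add: tempered_diff[OF u S])
  qed
  then have ev: "\<forall>\<^sub>F i in sequentially. norm (u (superpose w (H i) G) - u (superpose w h G))
      \<le> C * (E * (LINT x|lborel. ?\<rho> i x))" by (intro always_eventually allI)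
  have "(\<lambda>i. u (superpose w (H i) G) - u (superpose w h G)) \<longlonglongrightarrow> 0"
    by (rule Lim_null_comparison[OF ev]) (use lim0 in \<open>simp only: mult_zero_right\<close>)
  then show ?thesis by (simp add: LIM_zero_cancel)
qed

text \<open>In the usual notation, \<open>pair_translate u G (- x) = (u * G')(x)\<close> with \<open>G'(z) = G(- z)\<close>.\<close>

definition pair_translate :: "(('a::euclidean_space \<Rightarrow> complex) \<Rightarrow> complex) \<Rightarrow> ('a \<Rightarrow> complex) \<Rightarrow> 'a \<Rightarrow> complex" where
  "pair_translate u G a = u (\<lambda>y. G (y + a))"

text \<open>The order of the quantifiers matters: N is obtained before G, since it is the order of
  u. Later G is the kernel of the j-th block, and the growth exponent must not depend on j.\<close>

lemma pair_translate_lipschitz: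
  fixes u :: "('a::euclidean_space \<Rightarrow> complex) \<Rightarrow> complex"
  assumes u: "u \<in> tempered"
  obtains N where "\<And>G. G \<in> schwartz \<Longrightarrow> \<exists>B\<ge>0. \<forall>a b.
    norm (pair_translate u G a - pair_translate u G b) \<le> B * norm (a - b) * (1 + norm a + norm b) ^ N"
proof -
  obtain N C where C: "C > 0" "\<And>\<phi> e. \<phi> \<in> schwartz \<Longrightarrow>
     (\<And>vs x. vs \<in> multi_indices N \<Longrightarrow> (1 + norm x) ^ N * norm (pderivs vs \<phi> x) \<le> e) \<Longrightarrow> norm (u \<phi>) \<le> C * e"
    using tempered_bound[OF u] by metis
  show ?thesis
  proof (rule that)
    fix G :: "'a \<Rightarrow> complex" assume G: "G \<in> schwartz"
    obtain E where E0: "0 \<le> E" and E: "\<And>vs y a b. vs \<in> multi_indices N \<Longrightarrow>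
        (1 + norm y) ^ N * norm (pderivs vs G (y + a) - pderivs vs G (y + b))
        \<le> E * norm (a - b) * (1 + norm a + norm b) ^ N"
      using schwartz_pderivs_translate_diff_bound[OF G] by blast
    note S = schwartz_translate[OF G]
    have "norm (u (\<lambda>y. G (y + a) - G (y + b))) \<le> C * (E * norm (a - b) * (1 + norm a + norm b) ^ N)" for a b
    proof (rule C(2)[OF schwartz_diff[OF S S]])
      fix vs :: "'a list" and y assume vs: "vs \<in> multi_indices N"
      then have B: "set vs \<subseteq> Basis" by (simp add: multi_indices_def)
      show "(1 + norm y) ^ N * norm (pderivs vs (\<lambda>y. G (y + a) - G (y + b)) y)
          \<le> E * norm (a - b) * (1 + norm a + norm b) ^ N"
        unfolding pderivs_diff[OF schwartz_smooth[OF S] schwartz_smooth[OF S] B] pderivs_translate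
        by (rule E[OF vs])
    qed
    then show "\<exists>B\<ge>0. \<forall>a b. norm (pair_translate u G a - pair_translate u G b)
        \<le> B * norm (a - b) * (1 + norm a + norm b) ^ N"
      using C(1) E0 by (intro exI[of _ "C * E"]) (simp add: tempered_diff[OF u S S] pair_translate_def mult.assoc)
  qed
qed

text \<open>Comparison with the value at 0 through the Lipschitz bound; the factor |a| accounts for
  the additional power.\<close>

lemma pair_translate_growth:
  fixes u :: "('a::euclidean_space \<Rightarrow> complex) \<Rightarrow> complex"
  assumes "u \<in> tempered"
  obtains N where "\<And>G. G \<in> schwartz \<Longrightarrow> \<exists>A. \<forall>a. norm (pair_translate u G a) \<le> A * (1 + norm a) ^ N"
proof -
  obtain N where N: "\<And>G. G \<in> schwartz \<Longrightarrow> \<exists>B\<ge>0. \<forall>a b.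
      norm (pair_translate u G a - pair_translate u G b) \<le> B * norm (a - b) * (1 + norm a + norm b) ^ N"
    using pair_translate_lipschitz[OF assms] by blast
  show ?thesis
  proof (rule that[of "Suc N"])
    fix G :: "'a \<Rightarrow> complex" assume "G \<in> schwartz"
    then obtain B where B: "B \<ge> 0" "\<And>a b.
        norm (pair_translate u G a - pair_translate u G b) \<le> B * norm (a - b) * (1 + norm a + norm b) ^ N"
      using N by meson
    let ?v = "norm (pair_translate u G 0)"
    have "norm (pair_translate u G a) \<le> (?v + B) * (1 + norm a) ^ Suc N" for a
    proof -
      have "norm (pair_translate u G a) \<le> ?v + norm (pair_translate u G a - pair_translate u G 0)"
        using norm_triangle_sub by blast
      also have "\<dots> \<le> ?v + B * norm a * (1 + norm a) ^ N"
        using B(2)[of a 0] by simp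
      also have "\<dots> \<le> ?v * (1 + norm a) ^ Suc N + B * (1 + norm a) * (1 + norm a) ^ N"
        using B(1) one_le_power[of "1 + norm a" "Suc N"]
        by (intro add_mono mult_right_mono mult_left_mono mult_right_le_one_le) (auto simp: mult_le_cancel_left1 simp del: power_Suc)
      finally show ?thesis by (simp add: algebra_simps)
    qed
    then show "\<exists>A. \<forall>a. norm (pair_translate u G a) \<le> A * (1 + norm a) ^ Suc N" by blast
  qed
qed

lemma pair_translate_continuous:
  fixes G :: "'a::euclidean_space \<Rightarrow> complex"
  assumes "u \<in> tempered" "G \<in> schwartz"
  shows "continuous_on UNIV (pair_translate u G)"
proof -
  obtain N B where le: "\<And>a b.
      norm (pair_translate u G a - pair_translate u G b) \<le> B * norm (a - b) * (1 + norm a + norm b) ^ N"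
    using pair_translate_lipschitz[OF assms(1)] assms(2) by metis
  have "isCont (pair_translate u G) b" for b
  proof -
    have "((\<lambda>a. B * norm (a - b) * (1 + norm a + norm b) ^ N) \<longlongrightarrow> B * norm (b - b) * (1 + norm b + norm b) ^ N) (at b)"
      by (intro tendsto_intros)
    then have "((\<lambda>a. B * norm (a - b) * (1 + norm a + norm b) ^ N) \<longlongrightarrow> 0) (at b)" by simp
    with always_eventually[OF allI[OF le[of _ b]]]
    have "((\<lambda>a. pair_translate u G a - pair_translate u G b) \<longlongrightarrow> 0) (at b)"
      by (rule Lim_null_comparison)
    then show ?thesis unfolding isCont_def by (rule LIM_zero_cancel)
  qed
  then show ?thesis by (simp add: continuous_at_imp_continuous_on)
qed

lemma pair_translate_measurable:
  fixes G :: "'a::euclidean_space \<Rightarrow> complex"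
  shows "u \<in> tempered \<Longrightarrow> G \<in> schwartz \<Longrightarrow> pair_translate u G \<in> borel_measurable borel"
  by (intro borel_measurable_continuous_onI pair_translate_continuous)

lemma pair_translate_integrable:
  fixes G :: "'a::euclidean_space \<Rightarrow> complex"
  assumes "u \<in> tempered" "rapid w" "G \<in> schwartz" "linear_growth h"
  shows "integrable lborel (\<lambda>x. w x * pair_translate u G (h x))"
proof -
  note [measurable] = pair_translate_measurable[OF assms(1,3)]
  have [measurable]: "h \<in> borel_measurable borel" using assms(4) by (simp add: linear_growth_def)
  obtain N A where A: "\<And>a. norm (pair_translate u G a) \<le> A * (1 + norm a) ^ N"
    using pair_translate_growth[OF assms(1)] assms(3) by metis
  have A0: "0 \<le> A" using order_trans[OF norm_ge_zero A[of 0]] by simp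
  show ?thesis
  proof (rule rapid_integrable_mult[OF assms(2), of _ "A * 2 ^ N" N])
    fix x
    have "norm (h x) \<le> 2 * norm x" using assms(4) by (auto simp: linear_growth_def)
    then have "(1 + norm (h x)) ^ N \<le> (2 * (1 + norm x)) ^ N" by (intro power_mono) auto
    from mult_left_mono[OF this A0] have "A * (1 + norm (h x)) ^ N \<le> A * 2 ^ N * (1 + norm x) ^ N"
      by (simp only: power_mult_distrib mult.assoc)
    then show "norm (pair_translate u G (h x)) \<le> A * 2 ^ N * (1 + norm x) ^ N"
      using A order_trans by blast
  qed measurable
qed

text \<open>For a simple function s the superposition is a finite linear combination of translates
  of G, so linearity of u alone gives the interchange.\<close>

lemma tempered_superpose_simple:
  fixes G :: "'a::euclidean_space \<Rightarrow> complex"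
  assumes u: "u \<in> tempered" and w: "rapid w" and G: "G \<in> schwartz"
    and s: "simple_function borel s" "linear_growth s"
  shows "u (superpose w s G) = (LINT x|lborel. w x * pair_translate u G (s x))"
proof -
  note [measurable] = rapid_measurable[OF w]
  have fin: "finite (range s)" using s(1) by (simp add: simple_function_def)
  have ms[measurable]: "s -` {c} \<in> sets borel" for c
  proof (cases "c \<in> range s")
    case False
    then have "s -` {c} = {}" by auto
    then show ?thesis by simp
  qed (use s(1) in \<open>auto simp: simple_function_def vimage_def\<close>)
  have int: "integrable lborel (\<lambda>x. indicator (s -` {c}) x *\<^sub>R w x)" for c
    using rapid_integrable[OF w] by (intro integrable_mult_indicator) auto
  \<comment> \<open>Stated for an arbitrary g, so that it serves both for the translates of G and
    for the values of \<open>pair_translate\<close>.\<close>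
  have eq: "w x * g (s x) = (\<Sum>c\<in>range s. (indicator (s -` {c}) x *\<^sub>R w x) * g c)" for x and g :: "'a \<Rightarrow> complex"
  proof -
    have "(\<Sum>c\<in>range s. (indicator (s -` {c}) x *\<^sub>R w x) * g c) = (\<Sum>c\<in>range s. if c = s x then w x * g c else 0)"
      by (intro sum.cong) (auto simp: indicator_def)
    then show ?thesis using fin by simp
  qed
  have int_eq: "(LINT x|lborel. w x * g (s x)) = (\<Sum>c\<in>range s. (LINT x|lborel. indicator (s -` {c}) x *\<^sub>R w x) * g c)"
    for g :: "'a \<Rightarrow> complex"
    unfolding eq integral_mult_left_zero[symmetric]
    by (rule Bochner_Integration.integral_sum) (rule integrable_mult_left[OF int])
  have "superpose w s G = (\<lambda>y. \<Sum>c\<in>range s. (LINT x|lborel. indicator (s -` {c}) x *\<^sub>R w x) * G (y + c))"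
    unfolding superpose_def using int_eq[of "\<lambda>c. G (y + c)" for y] by auto
  then have "u (superpose w s G) = (\<Sum>c\<in>range s. (LINT x|lborel. indicator (s -` {c}) x *\<^sub>R w x) * pair_translate u G c)"
    using schwartz_translate[OF G] by (simp add: tempered_sum[OF u] schwartz_cmult tempered_cmult[OF u] pair_translate_def)
  then show ?thesis by (simp add: int_eq)
qed

text \<open>The interchange of u with an integral of translates. Approximating x \<mapsto> - x by
  simple functions, the left side converges by \<open>superpose_tendsto\<close> and the right side
  by dominated convergence, as \<open>pair_translate u G\<close> is continuous and of polynomial
  growth.\<close>

lemma tempered_superpose:
  fixes G :: "'a::euclidean_space \<Rightarrow> complex"
  assumes u: "u \<in> tempered" and w: "rapid w" and G: "G \<in> schwartz"
  shows "u (superpose w uminus G) = (LINT x|lborel. w x * pair_translate u G (- x))"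
proof -
  obtain s where s: "\<And>i. simple_function borel (s i)" "\<And>x::'a. (\<lambda>i. s i x) \<longlonglongrightarrow> - x"
    "\<And>i x. norm (s i x) \<le> 2 * norm x"
    using borel_measurable_implies_sequence_metric[of uminus "borel :: 'a measure" "0::'a"] by auto
  have lg: "linear_growth (s i)" "linear_growth (uminus :: 'a \<Rightarrow> 'a)" for i
    using s(3) borel_measurable_simple_function[OF s(1)] by (auto simp: linear_growth_def)
  note [measurable] = rapid_measurable[OF w] pair_translate_measurable[OF u G] borel_measurable_simple_function[OF s(1)]
  obtain N A where A: "\<And>a. norm (pair_translate u G a) \<le> A * (1 + norm a) ^ N"
    using pair_translate_growth[OF u] G by metis
  have A0: "0 \<le> A" using order_trans[OF norm_ge_zero A[of 0]] by simp
  have "(\<lambda>i. LINT x|lborel. w x * pair_translate u G (s i x)) \<longlonglongrightarrow> (LINT x|lborel. w x * pair_translate u G (- x))"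
  proof (rule integral_dominated_convergence[where w="\<lambda>x. A * (norm (w x) * (1 + 2 * norm x) ^ N)"])
    show "integrable lborel (\<lambda>x. A * (norm (w x) * (1 + 2 * norm x) ^ N))"
      by (intro integrable_mult_right rapid_integrable_norm_mult[OF w])
    show "AE x in lborel. (\<lambda>i. w x * pair_translate u G (s i x)) \<longlonglongrightarrow> w x * pair_translate u G (- x)"
    proof (intro AE_I2 tendsto_mult tendsto_const)
      fix x
      have "isCont (pair_translate u G) (- x)"
        using pair_translate_continuous[OF u G] by (simp add: continuous_on_eq_continuous_at)
      then show "(\<lambda>i. pair_translate u G (s i x)) \<longlonglongrightarrow> pair_translate u G (- x)"
        using s(2) by (rule isCont_tendsto_compose)
    qed
    show "AE x in lborel. norm (w x * pair_translate u G (s i x)) \<le> A * (norm (w x) * (1 + 2 * norm x) ^ N)" for i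
    proof (rule AE_I2)
      fix x
      have "(1 + norm (s i x)) ^ N \<le> (1 + 2 * norm x) ^ N" using s(3) by (intro power_mono) auto
      then have "norm (pair_translate u G (s i x)) \<le> A * (1 + 2 * norm x) ^ N"
        using A[of "s i x"] A0 by (meson mult_left_mono order_trans)
      from mult_left_mono[OF this norm_ge_zero, of "w x"]
      show "norm (w x * pair_translate u G (s i x)) \<le> A * (norm (w x) * (1 + 2 * norm x) ^ N)"
        by (simp add: norm_mult ac_simps)
    qed
  qed measurable
  moreover have "(\<lambda>i. u (superpose w (s i) G)) \<longlonglongrightarrow> u (superpose w uminus G)"
    by (rule superpose_tendsto[OF u w G lg(2,1) s(2)])
  ultimately show ?thesis
    unfolding tempered_superpose_simple[OF u w G s(1) lg(1)] using LIMSEQ_unique by blast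
qed

section \<open>Fourier inversion and Littlewood--Paley blocks\<close>

text \<open>Fubini's theorem, with a symmetric kernel of modulus 1. It is applied with Gaussians for
  the inversion formula and with the symbols of multipliers.\<close>

lemma fourier_mult_formula:
  fixes f g :: "'a::euclidean_space \<Rightarrow> complex"
  assumes "integrable lborel f" "integrable lborel g"
  shows "(LINT \<xi>|lborel. g \<xi> * fourier f \<xi>) = (LINT x|lborel. f x * fourier g x)"
proof -
  let ?h = "\<lambda>(\<xi>, x). g \<xi> * (exp (- \<i> * of_real (x \<bullet> \<xi>)) * f x)"
  note [measurable] = borel_measurable_integrable[OF assms(1)] borel_measurable_integrable[OF assms(2)]
  have "integrable (lborel \<Otimes>\<^sub>M lborel) ?h"
  proof (rule lborel_pair.Fubini_integrable)
    show "integrable lborel (\<lambda>\<xi>. LINT x|lborel. norm (?h (\<xi>, x)))"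
      using assms by (simp add: norm_mult)
    show "AE \<xi> in lborel. integrable lborel (\<lambda>x. ?h (\<xi>, x))"
    proof (rule AE_I2)
      fix \<xi>
      have "integrable lborel (\<lambda>x. exp (- \<i> * of_real (x \<bullet> \<xi>)) * f x)"
        by (rule Bochner_Integration.integrable_bound[OF assms(1)]) (auto simp: norm_mult)
      then show "integrable lborel (\<lambda>x. ?h (\<xi>, x))" by simp
    qed
  qed measurable
  from lborel_pair.Fubini_integral[OF this]
  have "(LINT x|lborel. LINT \<xi>|lborel. g \<xi> * (exp (- \<i> * of_real (x \<bullet> \<xi>)) * f x))
      = (LINT \<xi>|lborel. LINT x|lborel. g \<xi> * (exp (- \<i> * of_real (x \<bullet> \<xi>)) * f x))" by simp
  moreover have "(LINT \<xi>|lborel. g \<xi> * (exp (- \<i> * of_real (x \<bullet> \<xi>)) * f x)) = f x * fourier g x" for x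
    unfolding fourier_def integral_mult_right_zero[symmetric] by (simp add: inner_commute ac_simps)
  moreover have "(LINT x|lborel. g \<xi> * (exp (- \<i> * of_real (x \<bullet> \<xi>)) * f x)) = g \<xi> * fourier f \<xi>" for \<xi>
    unfolding fourier_def by simp
  ultimately show ?thesis by (simp only:)
qed

section \<open>The Gaussian and Fourier inversion\<close>

lemma integral_lborel_prod_Basis:
  fixes f :: "'a::euclidean_space \<Rightarrow> real \<Rightarrow> complex"
  assumes "\<And>b. b \<in> Basis \<Longrightarrow> integrable lborel (f b)"
  shows "(LINT x|lborel. (\<Prod>b\<in>Basis. f b (x \<bullet> b))) = (\<Prod>b\<in>Basis. (LINT t|lborel. f b t))"
proof -
  interpret product_sigma_finite "\<lambda>_::'a. lborel :: real measure" by standard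
  have [measurable]: "f b \<in> borel_measurable borel" if "b \<in> Basis" for b
    using borel_measurable_integrable[OF assms[OF that]] by simp
  have "(LINT x|lborel. (\<Prod>b\<in>Basis. f b (x \<bullet> b)))
      = (LINT g|(\<Pi>\<^sub>M b\<in>(Basis::'a set). lborel). (\<Prod>b\<in>Basis. f b ((\<Sum>b\<in>Basis. g b *\<^sub>R b) \<bullet> b)))"
    unfolding lborel_eq[where 'a='a] by (subst integral_distr) auto
  also have "\<dots> = (LINT g|(\<Pi>\<^sub>M b\<in>(Basis::'a set). lborel). (\<Prod>b\<in>Basis. f b (g b)))"
    by (intro Bochner_Integration.integral_cong prod.cong) (auto simp: inner_sum_left_Basis)
  also have "\<dots> = (\<Prod>b\<in>Basis. (LINT t|lborel. f b t))"
    by (rule product_integral_prod) (auto simp: assms)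
  finally show ?thesis .
qed

text \<open>In this normalisation the Gaussian is an eigenfunction of \<open>fourier\<close>, with
  eigenvalue (2 \<pi>)^(n/2) in dimension n.\<close>

definition gauss :: "'a::euclidean_space \<Rightarrow> complex" where
  "gauss x = of_real (exp (- (norm x)\<^sup>2 / 2))"

lemma gauss_eq_prod:
  "gauss x = (\<Prod>b\<in>Basis. complex_of_real (exp (- (x \<bullet> b)\<^sup>2 / 2)))"
proof -
  have "- (norm x)\<^sup>2 / 2 = (\<Sum>b\<in>Basis. - (x \<bullet> b)\<^sup>2 / 2)"
    unfolding sum_divide_distrib[symmetric] sum_negf power2_norm_eq_inner
    by (subst euclidean_inner) (simp add: power2_eq_square)
  then show ?thesis unfolding gauss_def by (simp add: exp_sum)
qed

text \<open>Up to the normalising constant this is the characteristic function of the standard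
  normal distribution at - t.\<close>

lemma gauss_fourier_real:
  "integrable lborel (\<lambda>x. exp (- \<i> * of_real (x * t)) * complex_of_real (exp (- x\<^sup>2 / 2)))"
  "(LINT x|lborel. exp (- \<i> * of_real (x * t)) * complex_of_real (exp (- x\<^sup>2 / 2)))
    = of_real (sqrt (2 * pi)) * complex_of_real (exp (- t\<^sup>2 / 2))"
proof -
  have int: "integrable lborel std_normal_density" using integrable_normal_moment_nz_1[of 1 0]
    by (simp add: integrable_normal_density)
  have eq: "complex_of_real (exp (- x\<^sup>2 / 2)) = of_real (sqrt (2 * pi)) * of_real (std_normal_density x)" for x
    by (simp add: std_normal_density_def)
  show "integrable lborel (\<lambda>x. exp (- \<i> * of_real (x * t)) * complex_of_real (exp (- x\<^sup>2 / 2)))"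
    unfolding eq
    by (rule Bochner_Integration.integrable_bound[OF integrable_mult_right[OF int, of "sqrt (2 * pi)"]])
       (auto simp: norm_mult)
  have "(LINT x|lborel. std_normal_density x *\<^sub>R iexp ((- t) * x)) = complex_of_real (exp (- (- t)\<^sup>2 / 2))"
    using fun_cong[OF char_std_normal_distribution, of "- t"]
    by (simp add: char_def integral_density normal_density_nonneg)
  moreover have "exp (- \<i> * of_real (x * t)) * complex_of_real (exp (- x\<^sup>2 / 2))
      = of_real (sqrt (2 * pi)) * (std_normal_density x *\<^sub>R iexp ((- t) * x))" for x
    unfolding eq by (simp add: scaleR_conv_of_real ac_simps)
  then have "(LINT x|lborel. exp (- \<i> * of_real (x * t)) * complex_of_real (exp (- x\<^sup>2 / 2)))
      = of_real (sqrt (2 * pi)) * (LINT x|lborel. std_normal_density x *\<^sub>R iexp ((- t) * x))"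
    by (simp only: integral_mult_right_zero)
  ultimately show "(LINT x|lborel. exp (- \<i> * of_real (x * t)) * complex_of_real (exp (- x\<^sup>2 / 2)))
    = of_real (sqrt (2 * pi)) * complex_of_real (exp (- t\<^sup>2 / 2))" by simp
qed

lemma fourier_gauss:
  "fourier gauss \<xi> = of_real (sqrt (2 * pi)) ^ DIM('a) * gauss (\<xi>::'a::euclidean_space)"
proof -
  have "exp (- \<i> * of_real (x \<bullet> \<xi>)) * gauss x
      = (\<Prod>b\<in>Basis. exp (- \<i> * of_real ((x \<bullet> b) * (\<xi> \<bullet> b))) * complex_of_real (exp (- (x \<bullet> b)\<^sup>2 / 2)))" for x
    unfolding gauss_eq_prod prod.distrib
    by (simp add: euclidean_inner[of x \<xi>] sum_distrib_left sum_negf[symmetric] exp_sum)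
  then have "fourier gauss \<xi> = (\<Prod>b\<in>Basis. LINT x|lborel. exp (- \<i> * of_real (x * (\<xi> \<bullet> b))) * complex_of_real (exp (- x\<^sup>2 / 2)))"
    unfolding fourier_def by (simp only:) (rule integral_lborel_prod_Basis, rule gauss_fourier_real)
  then show ?thesis unfolding gauss_fourier_real(2) by (simp add: prod.distrib gauss_eq_prod)
qed

lemma gauss_measurable [measurable]: "gauss \<in> borel_measurable borel"
  unfolding gauss_def[abs_def] by measurable

text \<open>The integral of a non-integrable function is 0 by convention, whereas
  \<open>fourier_gauss\<close> gives a nonzero value at the origin.\<close>

lemma gauss_integrable: "integrable lborel (gauss :: 'a::euclidean_space \<Rightarrow> complex)"
proof (rule ccontr)
  assume "\<not> integrable lborel (gauss :: 'a \<Rightarrow> complex)"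
  then have "fourier gauss (0::'a) = 0" by (simp add: fourier_def not_integrable_integral_eq)
  then show False by (simp add: fourier_gauss gauss_def)
qed

lemma integral_gauss: "(LINT x|lborel. gauss (x::'a::euclidean_space)) = of_real (sqrt (2 * pi)) ^ DIM('a)"
  using fourier_gauss[of "0::'a"] by (simp add: fourier_def gauss_def)

text \<open>Gaussian summation is needed at the origin only: translation takes care of the other points.\<close>

lemma integral_fourier:
  fixes \<theta> :: "'a::euclidean_space \<Rightarrow> complex"
  assumes "\<theta> \<in> schwartz"
  shows "(LINT \<xi>|lborel. fourier \<theta> \<xi>) = of_real ((2 * pi) ^ DIM('a)) * \<theta> 0"
proof -
  define \<epsilon> where "\<epsilon> i = inverse (real (Suc i))" for i
  have \<epsilon>: "\<epsilon> i > 0" "\<epsilon> \<longlonglongrightarrow> 0" for i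
    using LIMSEQ_inverse_real_of_nat by (auto simp: \<epsilon>_def[abs_def])
  note F = fourier_schwartz[OF assms]
  note [measurable] = rapid_measurable[OF schwartz_rapid[OF assms]] rapid_measurable[OF schwartz_rapid[OF F]]
  let ?c = "complex_of_real (sqrt (2 * pi)) ^ DIM('a)"
  have gint: "integrable lborel (\<lambda>\<xi>::'a. gauss (\<epsilon> i *\<^sub>R \<xi>))" for i
  proof (rule ccontr)
    assume "\<not> ?thesis"
    then have "(LINT \<xi>|(lborel :: 'a measure). gauss (0 + \<epsilon> i *\<^sub>R \<xi>)) = 0"
      by (simp add: not_integrable_integral_eq)
    then have "(LINT x|lborel. gauss (x::'a)) = 0"
      using \<epsilon>(1)[of i] by (subst integral_lborel_scale[of _ "\<epsilon> i" 0]) auto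
    then show False by (simp add: integral_gauss)
  qed
  \<comment> \<open>The multiplication formula followed by the substitution x \<rightarrow>
    \<epsilon> x, which moves the dilation from the Gaussian to \<theta>. As \<epsilon> tends to 0,
    the left side tends to the integral of \<open>fourier \<theta>\<close> and the right side to
    \<theta> 0 times \<open>?c\<close> times the integral of the Gaussian, which is again
    \<open>?c\<close>.\<close>
  have eq: "(LINT \<xi>|lborel. gauss (\<epsilon> i *\<^sub>R \<xi>) * fourier \<theta> \<xi>) = (LINT x|lborel. \<theta> (\<epsilon> i *\<^sub>R x) * (?c * gauss x))" for i
  proof -
    have "(LINT \<xi>|lborel. gauss (\<epsilon> i *\<^sub>R \<xi>) * fourier \<theta> \<xi>)
        = (LINT x|lborel. \<theta> x * fourier (\<lambda>\<xi>. gauss (\<epsilon> i *\<^sub>R \<xi>)) x)"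
      by (rule fourier_mult_formula[OF rapid_integrable[OF schwartz_rapid[OF assms]] gint])
    also have "\<dots> = \<bar>\<epsilon> i\<bar> ^ DIM('a) *\<^sub>R (LINT x|lborel. \<theta> (0 + \<epsilon> i *\<^sub>R x) * fourier (\<lambda>\<xi>. gauss (\<epsilon> i *\<^sub>R \<xi>)) (0 + \<epsilon> i *\<^sub>R x))"
    proof (rule integral_lborel_scale)
      show "(\<lambda>x. \<theta> x * fourier (\<lambda>\<xi>. gauss (\<epsilon> i *\<^sub>R \<xi>)) x) \<in> borel_measurable borel"
        unfolding fourier_def by measurable
    qed (use \<epsilon>(1)[of i] in simp)
    also have "\<dots> = (LINT x|lborel. \<theta> (\<epsilon> i *\<^sub>R x) * (\<bar>\<epsilon> i\<bar> ^ DIM('a) *\<^sub>R fourier (\<lambda>\<xi>. gauss (\<epsilon> i *\<^sub>R \<xi>)) (\<epsilon> i *\<^sub>R x)))"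
      unfolding integral_scaleR_right[symmetric] by simp
    also have "(\<lambda>x::'a. \<bar>\<epsilon> i\<bar> ^ DIM('a) *\<^sub>R fourier (\<lambda>\<xi>. gauss (\<epsilon> i *\<^sub>R \<xi>)) (\<epsilon> i *\<^sub>R x)) = (\<lambda>x. ?c * gauss x)"
    proof
      fix x :: 'a
      have "fourier gauss x = \<bar>\<epsilon> i\<bar> ^ DIM('a) *\<^sub>R (LINT \<xi>|lborel. exp (- \<i> * of_real ((0 + \<epsilon> i *\<^sub>R \<xi>) \<bullet> x)) * gauss (0 + \<epsilon> i *\<^sub>R \<xi>))"
        unfolding fourier_def using \<epsilon>(1)[of i]
        by (intro integral_lborel_scale[of "\<lambda>\<xi>. exp (- \<i> * of_real (\<xi> \<bullet> x)) * gauss \<xi>" "\<epsilon> i" 0]) auto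
      then show "\<bar>\<epsilon> i\<bar> ^ DIM('a) *\<^sub>R fourier (\<lambda>\<xi>. gauss (\<epsilon> i *\<^sub>R \<xi>)) (\<epsilon> i *\<^sub>R x) = ?c * gauss x"
        by (simp add: fourier_def fourier_gauss[symmetric])
    qed
    finally show ?thesis .
  qed
  have l1: "(\<lambda>i. LINT \<xi>|lborel. gauss (\<epsilon> i *\<^sub>R \<xi>) * fourier \<theta> \<xi>) \<longlonglongrightarrow> (LINT \<xi>|lborel. gauss (0::'a) * fourier \<theta> \<xi>)"
  proof (rule integral_dominated_convergence[where w="\<lambda>\<xi>. norm (fourier \<theta> \<xi>)"])
    show "AE \<xi> in lborel. (\<lambda>i. gauss (\<epsilon> i *\<^sub>R \<xi>) * fourier \<theta> \<xi>) \<longlonglongrightarrow> gauss (0::'a) * fourier \<theta> \<xi>"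
    proof (intro AE_I2 tendsto_mult tendsto_const)
      fix \<xi> :: 'a
      have "(\<lambda>i. gauss (\<epsilon> i *\<^sub>R \<xi>)) \<longlonglongrightarrow> gauss (0 *\<^sub>R \<xi>)"
        unfolding gauss_def by (intro tendsto_intros \<epsilon>(2)) auto
      then show "(\<lambda>i. gauss (\<epsilon> i *\<^sub>R \<xi>)) \<longlonglongrightarrow> gauss (0::'a)" by simp
    qed
    show "AE \<xi> in lborel. norm (gauss (\<epsilon> i *\<^sub>R \<xi>) * fourier \<theta> \<xi>) \<le> norm (fourier \<theta> \<xi>)" for i
      by (intro AE_I2) (auto simp: norm_mult gauss_def intro!: mult_left_le_one_le)
    show "integrable lborel (\<lambda>\<xi>. norm (fourier \<theta> \<xi>))"
      using rapid_integrable[OF schwartz_rapid[OF F]] by simp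
  qed measurable
  have l2: "(\<lambda>i. LINT x|lborel. \<theta> (\<epsilon> i *\<^sub>R x) * (?c * gauss x)) \<longlonglongrightarrow> (LINT x|(lborel::'a measure). \<theta> 0 * (?c * gauss x))"
  proof -
    obtain D where D: "D > 0" "\<And>x. (1 + norm x) ^ 0 * norm (\<theta> x) \<le> D" using schwartz_bounded[OF assms] by blast
    show ?thesis
    proof (rule integral_dominated_convergence[where w="\<lambda>x. D * norm (?c * gauss x)"])
      show "integrable lborel (\<lambda>x::'a. D * norm (?c * gauss x))"
        by (intro integrable_mult_right integrable_norm gauss_integrable)
      show "AE x in lborel. (\<lambda>i. \<theta> (\<epsilon> i *\<^sub>R x) * (?c * gauss x)) \<longlonglongrightarrow> \<theta> 0 * (?c * gauss x)"
      proof (intro AE_I2 tendsto_mult tendsto_const)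
        fix x :: 'a
        have "isCont \<theta> 0"
          using smooth_continuous_on[OF schwartz_smooth[OF assms], of UNIV] by (simp add: continuous_on_eq_continuous_at)
        moreover have "(\<lambda>i. \<epsilon> i *\<^sub>R x) \<longlonglongrightarrow> 0 *\<^sub>R x" by (intro tendsto_intros \<epsilon>(2))
        then have "(\<lambda>i. \<epsilon> i *\<^sub>R x) \<longlonglongrightarrow> 0" by simp
        ultimately show "(\<lambda>i. \<theta> (\<epsilon> i *\<^sub>R x)) \<longlonglongrightarrow> \<theta> 0" by (rule isCont_tendsto_compose)
      qed
      show "AE x in lborel. norm (\<theta> (\<epsilon> i *\<^sub>R x) * (?c * gauss x)) \<le> D * norm (?c * gauss x)" for i
        unfolding norm_mult[of "\<theta> _"] using D(2) by (intro AE_I2 mult_right_mono) auto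
    qed measurable
  qed
  have "(LINT \<xi>|lborel. gauss (0::'a) * fourier \<theta> \<xi>) = (LINT x|(lborel::'a measure). \<theta> 0 * (?c * gauss x))"
    by (rule LIMSEQ_unique[OF l1]) (use l2 in \<open>simp only: eq\<close>)
  moreover have "?c * ?c = of_real ((2 * pi) ^ DIM('a))"
  proof -
    have "?c * ?c = of_real (sqrt (2 * pi) * sqrt (2 * pi)) ^ DIM('a)"
      by (simp only: power_mult_distrib of_real_mult)
    also have "sqrt (2 * pi) * sqrt (2 * pi) = 2 * pi" by (rule real_sqrt_mult_self[THEN trans]) simp
    finally show ?thesis by simp
  qed
  ultimately show ?thesis by (simp add: gauss_def[of 0] integral_gauss mult.commute)
qed

lemma fourier_translate:
  fixes \<phi> :: "'a::euclidean_space \<Rightarrow> complex"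
  assumes [measurable]: "\<phi> \<in> borel_measurable borel"
  shows "fourier (\<lambda>x. \<phi> (x + a)) \<xi> = exp (\<i> * of_real (a \<bullet> \<xi>)) * fourier \<phi> \<xi>"
proof -
  have "exp (\<i> * of_real (a \<bullet> \<xi>)) * fourier \<phi> \<xi>
      = (LINT x|lborel. exp (\<i> * of_real (a \<bullet> \<xi>)) * (exp (- \<i> * of_real (x \<bullet> \<xi>)) * \<phi> x))"
    unfolding fourier_def by simp
  also have "\<dots> = (LINT x|lborel. exp (\<i> * of_real (a \<bullet> \<xi>)) * (exp (- \<i> * of_real ((x + a) \<bullet> \<xi>)) * \<phi> (x + a)))"
    by (subst integral_lborel_translate) auto
  also have "\<dots> = fourier (\<lambda>x. \<phi> (x + a)) \<xi>"
  proof -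
    have "\<i> * of_real (a \<bullet> \<xi>) + - \<i> * of_real ((x + a) \<bullet> \<xi>) = - \<i> * of_real (x \<bullet> \<xi>)" for x
      by (simp add: inner_add_left distrib_left)
    then show ?thesis unfolding mult.assoc[symmetric] mult_exp_exp fourier_def by simp
  qed
  finally show ?thesis ..
qed

lemma fourier_inversion:
  fixes \<theta> :: "'a::euclidean_space \<Rightarrow> complex"
  assumes "\<theta> \<in> schwartz"
  shows "inv_fourier (fourier \<theta>) = \<theta>"
proof
  fix x
  have "(LINT \<xi>|lborel. exp (\<i> * of_real (x \<bullet> \<xi>)) * fourier \<theta> \<xi>) = (LINT \<xi>|lborel. fourier (\<lambda>y. \<theta> (y + x)) \<xi>)"
    by (simp add: fourier_translate rapid_measurable[OF schwartz_rapid[OF assms]])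
  also have "\<dots> = of_real ((2 * pi) ^ DIM('a)) * \<theta> x"
    by (simp add: integral_fourier[OF schwartz_translate[OF assms]])
  finally show "inv_fourier (fourier \<theta>) x = \<theta> x" by (simp add: inv_fourier_def)
qed

text \<open>With \<open>kern \<Phi> z = (2\<pi>)\<^sup>-\<^sup>n (\<F> \<Phi>)(z) = (\<F>\<^sup>-\<^sup>1 \<Phi>)(- z)\<close> no reflection is needed below.\<close>

definition kern :: "('a::euclidean_space \<Rightarrow> complex) \<Rightarrow> 'a \<Rightarrow> complex" where
  "kern \<Phi> z = of_real (1 / (2 * pi) ^ DIM('a)) * fourier \<Phi> z"

lemma kern_schwartz: "\<Phi> \<in> schwartz \<Longrightarrow> kern \<Phi> \<in> schwartz"
  unfolding kern_def[abs_def] by (intro schwartz_cmult fourier_schwartz)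

lemma linear_growth_uminus: "linear_growth (uminus :: 'a::euclidean_space \<Rightarrow> 'a)"
  by (simp add: linear_growth_def)

text \<open>The Fourier multiplier \<Phi>, in the transposed form in which it meets a test function,
  is convolution with \<open>kern \<Phi>\<close>. It is read as a superposition of translates of
  \<open>kern \<Phi>\<close> with weight \<phi>, to which \<open>tempered_superpose\<close>
  applies.\<close>

lemma fourier_multiplier:
  fixes \<Phi> \<phi> :: "'a::euclidean_space \<Rightarrow> complex"
  assumes "\<Phi> \<in> schwartz" "\<phi> \<in> schwartz"
  shows "fourier (\<lambda>\<xi>. \<Phi> \<xi> * inv_fourier \<phi> \<xi>) = superpose \<phi> uminus (kern \<Phi>)"
proof
  fix y
  let ?k = "complex_of_real (1 / (2 * pi) ^ DIM('a))"
  let ?b = "\<lambda>\<xi>. exp (- \<i> * of_real (\<xi> \<bullet> y)) * \<Phi> \<xi>"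
  note [measurable] = rapid_measurable[OF schwartz_rapid[OF assms(1)]] rapid_measurable[OF schwartz_rapid[OF assms(2)]]
    rapid_measurable[OF schwartz_rapid[OF fourier_schwartz[OF assms(1)]]]
  have inv: "inv_fourier \<phi> \<xi> = ?k * fourier (\<lambda>x. \<phi> (- x)) \<xi>" for \<xi>
  proof -
    have "(LINT x|lborel. exp (\<i> * of_real (\<xi> \<bullet> x)) * \<phi> x)
        = (LINT x|lborel. exp (\<i> * of_real (\<xi> \<bullet> (0 + (-1) *\<^sub>R x))) * \<phi> (0 + (-1) *\<^sub>R x))"
      by (subst integral_lborel_scale[of _ "-1" 0]) auto
    then show ?thesis by (simp add: inv_fourier_def fourier_def inner_commute)
  qed
  have "fourier (\<lambda>\<xi>. \<Phi> \<xi> * inv_fourier \<phi> \<xi>) y = ?k * (LINT \<xi>|lborel. ?b \<xi> * fourier (\<lambda>x. \<phi> (- x)) \<xi>)"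
  proof -
    have "exp (- \<i> * of_real (\<xi> \<bullet> y)) * (\<Phi> \<xi> * inv_fourier \<phi> \<xi>) = ?k * (?b \<xi> * fourier (\<lambda>x. \<phi> (- x)) \<xi>)" for \<xi>
      unfolding inv by (simp only: ac_simps)
    then show ?thesis by (subst fourier_def) (simp only: integral_mult_right_zero)
  qed
  also have "(LINT \<xi>|lborel. ?b \<xi> * fourier (\<lambda>x. \<phi> (- x)) \<xi>) = (LINT x|lborel. \<phi> (- x) * fourier ?b x)"
    by (intro fourier_mult_formula rapid_integrable schwartz_rapid schwartz_reflect assms
        fourier_integrable[OF schwartz_rapid[OF assms(1)], of y])
  also have "\<dots> = (LINT x|lborel. \<phi> (- x) * fourier \<Phi> (y + x))"
  proof -
    have "fourier ?b x = fourier \<Phi> (y + x)" for x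
      unfolding fourier_def mult.assoc[symmetric] mult_exp_exp
      by (simp add: inner_add_right distrib_left add.commute)
    then show ?thesis by simp
  qed
  also have "\<dots> = (LINT x|lborel. \<phi> x * fourier \<Phi> (y - x))"
    by (subst integral_lborel_scale[of "\<lambda>x. \<phi> x * fourier \<Phi> (y - x)" "-1" 0]) auto
  also have "?k * \<dots> = superpose \<phi> uminus (kern \<Phi>) y"
    unfolding superpose_def kern_def integral_mult_right_zero[symmetric] by (simp add: ac_simps)
  finally show "fourier (\<lambda>\<xi>. \<Phi> \<xi> * inv_fourier \<phi> \<xi>) y = superpose \<phi> uminus (kern \<Phi>) y" .
qed

text \<open>The multiplier formula for \<phi> = \<open>fourier \<theta>\<close>: inversion turns its
  left side into the transform of \<Phi> \<theta> = \<Phi>.\<close>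

lemma kern_reproducing:
  fixes \<Phi> \<theta> :: "'a::euclidean_space \<Rightarrow> complex"
  assumes "\<Phi> \<in> schwartz" "\<theta> \<in> schwartz" "\<And>\<xi>. \<Phi> \<xi> * \<theta> \<xi> = \<Phi> \<xi>"
  shows "superpose (kern \<theta>) uminus (kern \<Phi>) = kern \<Phi>"
proof -
  have "fourier (\<lambda>\<xi>. \<Phi> \<xi> * inv_fourier (fourier \<theta>) \<xi>) = superpose (fourier \<theta>) uminus (kern \<Phi>)"
    by (rule fourier_multiplier[OF assms(1) fourier_schwartz[OF assms(2)]])
  then have "fourier \<Phi> = superpose (fourier \<theta>) uminus (kern \<Phi>)"
    by (simp add: fourier_inversion[OF assms(2)] assms(3))
  moreover have "superpose (kern \<theta>) uminus (kern \<Phi>) y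
      = of_real (1 / (2 * pi) ^ DIM('a)) * superpose (fourier \<theta>) uminus (kern \<Phi>) y" for y
    unfolding superpose_def kern_def[of \<theta>] integral_mult_right_zero[symmetric] by (simp add: ac_simps)
  ultimately show ?thesis by (simp add: fun_eq_iff kern_def[of \<Phi>])
qed

text \<open>The shift by a is put into the weight \<open>kern \<theta> (w + a)\<close>, not into the
  translated kernel. Then u meets a superposition of translates of \<open>kern \<Phi>\<close>, and
  the interchange returns the same function \<open>pair_translate u (kern \<Phi>)\<close> under the
  integral.\<close>

lemma pair_translate_reproducing:
  fixes \<Phi> \<theta> :: "'a::euclidean_space \<Rightarrow> complex"
  assumes u: "u \<in> tempered" and "\<Phi> \<in> schwartz" "\<theta> \<in> schwartz" "\<And>\<xi>. \<Phi> \<xi> * \<theta> \<xi> = \<Phi> \<xi>"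
  shows "pair_translate u (kern \<Phi>) a
    = (LINT w|lborel. kern \<theta> (w + a) * pair_translate u (kern \<Phi>) (- w))"
proof -
  note k = kern_schwartz[OF assms(2)] kern_schwartz[OF assms(3)]
  note [measurable] = rapid_measurable[OF schwartz_rapid[OF k(1)]] rapid_measurable[OF schwartz_rapid[OF k(2)]]
  have "kern \<Phi> (y + a) = superpose (\<lambda>w. kern \<theta> (w + a)) uminus (kern \<Phi>) y" for y
  proof -
    have "kern \<Phi> (y + a) = superpose (kern \<theta>) uminus (kern \<Phi>) (y + a)"
      using kern_reproducing[OF assms(2-4)] by simp
    also have "\<dots> = (LINT x|lborel. kern \<theta> x * kern \<Phi> ((y + a) + - x))" by (simp add: superpose_def)
    also have "\<dots> = (LINT w|lborel. kern \<theta> (w + a) * kern \<Phi> ((y + a) + - (w + a)))"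
      by (rule integral_lborel_translate[symmetric]) measurable
    finally show ?thesis by (simp add: superpose_def)
  qed
  then have "pair_translate u (kern \<Phi>) a = u (superpose (\<lambda>w. kern \<theta> (w + a)) uminus (kern \<Phi>))"
    by (simp add: pair_translate_def)
  also have "\<dots> = (LINT w|lborel. kern \<theta> (w + a) * pair_translate u (kern \<Phi>) (- w))"
    by (rule tempered_superpose[OF u schwartz_rapid[OF schwartz_translate[OF k(2)]] k(1)])
  finally show ?thesis .
qed

section \<open>Blocks as continuous functions, and their sum\<close>

abbreviation cPsi :: "(real \<Rightarrow> real) \<Rightarrow> nat \<Rightarrow> 'a::euclidean_space \<Rightarrow> complex" where
  "cPsi \<Psi> j \<equiv> \<lambda>\<xi>. complex_of_real (Psi \<Psi> j \<xi>)"

abbreviation cPhi :: "(real \<Rightarrow> real) \<Rightarrow> nat \<Rightarrow> 'a::euclidean_space \<Rightarrow> complex" where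
  "cPhi \<Psi> j \<equiv> \<lambda>\<xi>. complex_of_real (Phi \<Psi> j \<xi>)"

lemma kern_Psi_scale:
  assumes "cutoff \<Psi>"
  shows "kern (cPsi \<Psi> j) (z::'a::euclidean_space) = of_real ((2 ^ j) ^ DIM('a)) * kern (cPsi \<Psi> 0) (2 ^ j *\<^sub>R z)"
proof -
  note [measurable] = rapid_measurable[OF schwartz_rapid[OF Psi_schwartz[OF assms]]]
  have "fourier (cPsi \<Psi> j) z = \<bar>2 ^ j\<bar> ^ DIM('a) *\<^sub>R
      (LINT x|lborel. exp (- \<i> * of_real ((0 + 2 ^ j *\<^sub>R x) \<bullet> z)) * cPsi \<Psi> j (0 + 2 ^ j *\<^sub>R x))"
    unfolding fourier_def by (rule integral_lborel_scale) auto
  moreover have "Psi \<Psi> j (2 ^ j *\<^sub>R x) = Psi \<Psi> 0 x" for x :: 'a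
    by (simp add: Psi_def powr_minus powr_realpow mult.assoc[symmetric])
  ultimately show ?thesis by (simp add: kern_def fourier_def scaleR_conv_of_real ac_simps)
qed

lemma lp_block_eq:
  assumes "cutoff \<Psi>" "\<phi> \<in> schwartz"
  shows "lp_block \<Psi> j u \<phi> = u (fourier (\<lambda>\<xi>. cPhi \<Psi> j \<xi> * inv_fourier \<phi> \<xi>))"
  using assms schwartz_mult[OF Phi_schwartz[OF assms(1)] inv_fourier_schwartz[OF assms(2)], of j]
  by (simp add: lp_block_def inv_tfourier_def tmult_def tfourier_def inv_fourier_schwartz)

lemma lp_block_eq_superpose:
  assumes "cutoff \<Psi>" "\<phi> \<in> schwartz"
  shows "lp_block \<Psi> j u \<phi> = u (superpose \<phi> uminus (kern (cPhi \<Psi> j)))"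
  using lp_block_eq[OF assms] fourier_multiplier[OF Phi_schwartz[OF assms(1)] assms(2)] by simp

lemma lp_block_eq_integral:
  assumes "cutoff \<Psi>" "u \<in> tempered" "\<phi> \<in> schwartz"
  shows "lp_block \<Psi> j u \<phi> = (LINT x|lborel. pair_translate u (kern (cPhi \<Psi> j)) (- x) * \<phi> x)"
  unfolding lp_block_eq_superpose[OF assms(1,3)]
  using tempered_superpose[OF assms(2) schwartz_rapid[OF assms(3)] kern_schwartz[OF Phi_schwartz[OF assms(1)]]]
  by (simp add: mult.commute)

text \<open>The sum of the blocks up to N tests u against a mollification of \<phi> at scale 2^(-N).
  As N grows, the mollified functions tend to \<phi> in the Schwartz seminorms, because the kernel
  has mass \<open>Psi \<Psi> 0 0\<close> = 1.\<close>

lemma lp_block_sums: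
  fixes u :: "('a::euclidean_space \<Rightarrow> complex) \<Rightarrow> complex"
  assumes \<Psi>: "cutoff \<Psi>" and u: "u \<in> tempered" and \<phi>: "\<phi> \<in> schwartz"
  shows "(\<lambda>j. lp_block \<Psi> j u \<phi>) sums u \<phi>"
proof -
  define k where "k = kern (cPsi \<Psi> 0 :: 'a \<Rightarrow> complex)"
  have k: "k \<in> schwartz" unfolding k_def by (rule kern_schwartz[OF Psi_schwartz[OF \<Psi>]])
  note [measurable] = rapid_measurable[OF schwartz_rapid[OF \<phi>]] rapid_measurable[OF schwartz_rapid[OF k]]
  define H :: "nat \<Rightarrow> 'a \<Rightarrow> 'a" where "H N z = - ((1/2) ^ N) *\<^sub>R z" for N z
  have H: "linear_growth (H N)" for N
  proof -
    have "(1/2::real) ^ N \<le> 2" using power_le_one[of "1/2::real" N] by simp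
    then have "norm (H N z) \<le> 2 * norm z" for z
      unfolding H_def by (simp add: mult_right_mono)
    then show ?thesis unfolding linear_growth_def H_def[abs_def] by simp
  qed
  have partial: "(\<Sum>j\<le>N. lp_block \<Psi> j u \<phi>) = u (superpose k (H N) \<phi>)" for N
  proof -
    let ?f = "\<lambda>j \<xi>. cPhi \<Psi> j \<xi> * inv_fourier \<phi> \<xi>"
    have f: "?f j \<in> schwartz" for j
      by (rule schwartz_mult[OF Phi_schwartz[OF \<Psi>] inv_fourier_schwartz[OF \<phi>]])
    have "(\<Sum>j\<le>N. lp_block \<Psi> j u \<phi>) = u (\<lambda>y. \<Sum>j\<le>N. fourier (?f j) y)"
      unfolding lp_block_eq[OF \<Psi> \<phi>] by (rule tempered_sum[OF u fourier_schwartz[OF f], symmetric])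
    also have "(\<lambda>y. \<Sum>j\<le>N. fourier (?f j) y) = fourier (\<lambda>\<xi>. cPsi \<Psi> N \<xi> * inv_fourier \<phi> \<xi>)"
    proof
      fix y
      have "(\<Sum>j\<le>N. fourier (?f j) y) = (LINT \<xi>|lborel. (\<Sum>j\<le>N. exp (- \<i> * of_real (\<xi> \<bullet> y)) * ?f j \<xi>))"
        unfolding fourier_def
        by (rule Bochner_Integration.integral_sum[symmetric]) (rule fourier_integrable[OF schwartz_rapid[OF f]])
      also have "\<dots> = fourier (\<lambda>\<xi>. cPsi \<Psi> N \<xi> * inv_fourier \<phi> \<xi>) y"
        unfolding fourier_def sum_Phi[symmetric] of_real_sum sum_distrib_right sum_distrib_left ..
      finally show "(\<Sum>j\<le>N. fourier (?f j) y) = fourier (\<lambda>\<xi>. cPsi \<Psi> N \<xi> * inv_fourier \<phi> \<xi>) y" .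
    qed
    also have "\<dots> = superpose \<phi> uminus (kern (cPsi \<Psi> N))"
      by (rule fourier_multiplier[OF Psi_schwartz[OF \<Psi>] \<phi>])
    \<comment> \<open>The substitution x = y - 2^(-N) z cancels the dilation factor of the kernel
      and exchanges the roles: now \<phi> is translated and the fixed kernel k is the
      weight.\<close>
    also have "\<dots> = superpose k (H N) \<phi>"
    proof
      fix y
      have "superpose \<phi> uminus (kern (cPsi \<Psi> N)) y
          = (LINT x|lborel. \<phi> x * (of_real ((2 ^ N) ^ DIM('a)) * k (2 ^ N *\<^sub>R (y + - x))))"
        unfolding superpose_def kern_Psi_scale[OF \<Psi>, of N] k_def ..
      also have "\<dots> = \<bar>- ((1/2) ^ N)\<bar> ^ DIM('a) *\<^sub>R (LINT x|lborel. \<phi> (y + (- ((1/2) ^ N)) *\<^sub>R x) *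
          (of_real ((2 ^ N) ^ DIM('a)) * k (2 ^ N *\<^sub>R (y + - (y + (- ((1/2) ^ N)) *\<^sub>R x)))))"
      proof (rule integral_lborel_scale)
        show "(\<lambda>x. \<phi> x * (of_real ((2 ^ N) ^ DIM('a)) * k (2 ^ N *\<^sub>R (y + - x)))) \<in> borel_measurable borel"
          by measurable
      qed simp
      also have "\<dots> = (LINT x|lborel. (((1/2) ^ N) ^ DIM('a) * (2 ^ N) ^ DIM('a)) *\<^sub>R (k ((2 ^ N * (1/2) ^ N) *\<^sub>R x) * \<phi> (y + H N x)))"
        unfolding integral_scaleR_right[symmetric] by (simp add: H_def scaleR_conv_of_real ac_simps)
      also have "(2::real) ^ N * (1/2) ^ N = 1" unfolding power_mult_distrib[symmetric] by simp
      also have "((1/2::real) ^ N) ^ DIM('a) * (2 ^ N) ^ DIM('a) = 1"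
        unfolding power_mult_distrib[symmetric] by simp
      finally show "superpose \<phi> uminus (kern (cPsi \<Psi> N)) y = superpose k (H N) \<phi> y"
        by (simp add: superpose_def)
    qed
    finally show ?thesis .
  qed
  have "(\<lambda>N. u (superpose k (H N) \<phi>)) \<longlonglongrightarrow> u (superpose k (\<lambda>z. 0) \<phi>)"
  proof (rule superpose_tendsto[OF u schwartz_rapid[OF k] \<phi> _ H])
    show "linear_growth (\<lambda>z::'a. 0::'a)" by (simp add: linear_growth_def)
    fix x :: 'a
    have "(\<lambda>N. - ((1/2::real) ^ N) *\<^sub>R x) \<longlonglongrightarrow> - 0 *\<^sub>R x"
      by (intro tendsto_intros LIMSEQ_power_zero) simp
    then show "(\<lambda>N. H N x) \<longlonglongrightarrow> 0" by (simp add: H_def)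
  qed
  moreover have "superpose k (\<lambda>z. 0) \<phi> = \<phi>"
  proof -
    have "(LINT x|lborel. k x) = Psi \<Psi> 0 (0::'a)"
      unfolding k_def kern_def using integral_fourier[OF Psi_schwartz[OF \<Psi>, of 0, where 'a='a]] by simp
    then show ?thesis by (simp add: superpose_def[abs_def] Psi_eq_1[OF \<Psi>])
  qed
  ultimately show ?thesis unfolding sums_def_le partial by simp
qed

text \<open>Testing with bumps concentrated near a recovers g a - h a up to the oscillation of g -
  h. The cutoff serves as the source of bumps; the lemma is used for the blocks and for functions of
  t.\<close>

lemma continuous_eq_if_eq_on_test_functions:
  fixes g :: "'a::euclidean_space \<Rightarrow> complex"
  assumes \<Psi>: "cutoff \<Psi>" and "continuous_on UNIV g" "continuous_on UNIV h"
    and eq: "\<And>\<phi>. \<phi> \<in> test_functions \<Longrightarrow> (LINT x|lborel. g x * \<phi> x) = (LINT x|lborel. h x * \<phi> x)"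
  shows "g = h"
proof
  fix a
  have cont: "continuous_on UNIV (\<lambda>x. g x - h x)" by (intro continuous_intros assms)
  note [measurable] = borel_measurable_continuous_onI[OF assms(2)] borel_measurable_continuous_onI[OF assms(3)]
  have "norm (g a - h a) \<le> e" if e: "e > 0" for e
  proof -
    obtain d where d: "d > 0" "\<And>x. dist x a < d \<Longrightarrow> dist (g x - h x) (g a - h a) < e"
      using cont e unfolding continuous_on_iff by (metis UNIV_I)
    \<comment> \<open>The square makes the bump nonnegative, as \<open>\<Psi>\<close> may change
      sign between 11/10 and 13/10. The factor 2/d puts the support inside the ball of radius d and
      the plateau around the ball of radius d/2.\<close>
    define \<theta> where "\<theta> x = (Psi \<Psi> 0 ((2 / d) *\<^sub>R x + (- (2 / d) *\<^sub>R a)))\<^sup>2" for x :: 'a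
    have \<theta>: "\<theta> x = (Psi \<Psi> 0 ((2 / d) *\<^sub>R (x - a)))\<^sup>2" for x
      by (simp add: \<theta>_def algebra_simps)
    have \<theta>0: "\<theta> x = 0" if "dist x a \<ge> d" for x
    proof -
      have "2 \<le> 2 / d * norm (x - a)" using that d(1) by (simp add: dist_norm field_simps)
      also have "\<dots> = norm ((2 / d) *\<^sub>R (x - a))" using d(1) by simp
      finally have "Psi \<Psi> 0 ((2 / d) *\<^sub>R (x - a)) = 0" by (intro Psi_eq_0[OF \<Psi>]) simp
      then show ?thesis by (simp add: \<theta>)
    qed
    have "smooth (\<lambda>x. complex_of_real (\<theta> x))"
      unfolding \<theta>_def power2_eq_square
      by (intro smooth_of_real smooth_mult smooth_affine_comp[OF smooth_Psi[OF \<Psi>] bounded_linear_scaleR_right])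
    then have test: "(\<lambda>x. complex_of_real (\<theta> x)) \<in> test_functions"
      unfolding test_functions_def test_functions_on_def
      by (intro UN_I[of "cball a d"] CollectI conjI) (auto simp: dist_commute intro!: \<theta>0)
    have \<theta>int: "integrable lborel (\<lambda>x. complex_of_real (\<theta> x))"
      by (rule rapid_integrable[OF schwartz_rapid[OF test_function_schwartz[OF test]]])
    then have \<theta>int': "integrable lborel \<theta>" using integrable_Re[OF \<theta>int] by simp
    have bint: "integrable lborel (\<lambda>x. f x * complex_of_real (\<theta> x))" if f: "continuous_on UNIV f" for f
    proof -
      note [measurable] = borel_measurable_continuous_onI[OF f]
      have "bounded (f ` cball a d)"
        by (intro compact_imp_bounded compact_continuous_image continuous_on_subset[OF f]) auto
      then obtain B where "\<forall>x\<in>cball a d. norm (f x) \<le> B" by (auto simp: bounded_iff)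
      then have B: "norm (f x) \<le> B" if "dist x a \<le> d" for x using that by (simp add: dist_commute)
      have "norm (f x * complex_of_real (\<theta> x)) \<le> norm (B * norm (complex_of_real (\<theta> x)))" for x
      proof (cases "dist x a \<le> d")
        case True
        then have "norm (f x) \<le> \<bar>B\<bar>" using B[OF True] by simp
        then show ?thesis by (simp add: norm_mult abs_mult mult_right_mono)
      next
        case False
        then show ?thesis using \<theta>0[of x] by simp
      qed
      then show ?thesis
        by (intro Bochner_Integration.integrable_bound[OF integrable_mult_right[OF integrable_norm[OF \<theta>int], of B]])
           (use borel_measurable_integrable[OF \<theta>int] in auto)
    qed
    let ?I = "LINT x|lborel. \<theta> x"
    have "?I \<ge> (LINT x|lborel. indicator (ball a (d/2)) x)"
    proof (rule integral_mono)
      fix x :: 'a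
      show "indicat_real (ball a (d/2)) x \<le> \<theta> x"
      proof (cases "dist a x < d/2")
        case True
        then have "2 / d * norm (x - a) < 11/10"
          using d(1) by (simp add: dist_norm norm_minus_commute field_simps)
        then have "norm ((2 / d) *\<^sub>R (x - a)) < 11/10 * 2 ^ 0" using d(1) by simp
        from Psi_eq_1[OF \<Psi> this] show ?thesis using True by (simp add: \<theta>)
      qed (simp add: \<theta>)
    next
      show "integrable lborel (indicat_real (ball a (d/2)))"
        by (rule integrable_real_indicator) (use emeasure_bounded_finite[of "ball a (d/2)"] in auto)
    qed (use \<theta>int' in auto)
    then have "measure lborel (ball a (d/2)) \<le> ?I" by simp
    moreover have "0 < measure lborel (ball a (d/2))" by (rule content_ball_pos) (use d(1) in simp)
    ultimately have Ipos: "?I > 0" by linarith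
    have "(LINT x|lborel. (g x - h x) * \<theta> x) = 0"
      using eq[OF test] bint[OF assms(2)] bint[OF assms(3)] by (simp add: left_diff_distrib)
    then have "(g a - h a) * ?I = (LINT x|lborel. ((g a - h a) - (g x - h x)) * \<theta> x)"
      using bint[OF cont] \<theta>int by (simp add: left_diff_distrib[of "g a - h a"])
    then have "norm (g a - h a) * ?I = norm (LINT x|lborel. ((g a - h a) - (g x - h x)) * \<theta> x)"
      using Ipos by (metis abs_of_pos norm_mult norm_of_real)
    also have "\<dots> \<le> (LINT x|lborel. norm (((g a - h a) - (g x - h x)) * \<theta> x))" by (rule integral_norm_bound)
    also have "\<dots> \<le> (LINT x|lborel. e * \<theta> x)"
    proof (rule integral_mono')
      fix x
      show "norm (((g a - h a) - (g x - h x)) * complex_of_real (\<theta> x)) \<le> e * \<theta> x"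
      proof (cases "dist x a < d")
        case True
        then have "norm ((g a - h a) - (g x - h x)) \<le> e"
          using d(2)[OF True] by (simp add: dist_norm norm_minus_commute less_imp_le)
        then show ?thesis unfolding norm_mult norm_of_real by (simp add: \<theta> mult_right_mono)
      qed (simp add: \<theta>0)
    next
      show "integrable lborel (\<lambda>x. e * \<theta> x)" using \<theta>int' by simp
    qed (use e in \<open>simp add: \<theta>\<close>)
    also have "\<dots> = e * ?I" by simp
    finally show ?thesis using Ipos by simp
  qed
  then have "norm (g a - h a) \<le> 0" using field_le_epsilon[of "norm (g a - h a)" 0] by simp
  then show "g a = h a" by simp
qed

text \<open>The definite description in \<open>fun_of_distr\<close> denotes something only after
  existence and uniqueness of a continuous representative. Existence is the integral formula for the
  block, uniqueness the preceding test with bumps.\<close>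

lemma lp_fun_eq:
  assumes \<Psi>: "cutoff \<Psi>" and u: "u \<in> tempered"
  shows "lp_fun \<Psi> j u = (\<lambda>x. pair_translate u (kern (cPhi \<Psi> j)) (- x))"
proof -
  let ?g = "\<lambda>x. pair_translate u (kern (cPhi \<Psi> j)) (- x)"
  have "continuous_on UNIV (pair_translate u (kern (cPhi \<Psi> j)))"
    by (rule pair_translate_continuous[OF u kern_schwartz[OF Phi_schwartz[OF \<Psi>]]])
  then have cont: "continuous_on UNIV ?g"
    by (rule continuous_on_compose2) (auto intro!: continuous_intros)
  have d: "distr_of_fun ?g = distr_of_tempered (lp_block \<Psi> j u)"
    unfolding distr_of_fun_def distr_of_tempered_def restrict_def
    using lp_block_eq_integral[OF \<Psi> u test_function_schwartz] by auto
  show ?thesis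
    unfolding lp_fun_def fun_of_distr_def
  proof (rule the_equality)
    fix h assume h: "continuous_on UNIV h \<and> distr_of_fun h = distr_of_tempered (lp_block \<Psi> j u)"
    show "h = ?g"
    proof (rule continuous_eq_if_eq_on_test_functions[OF \<Psi>])
      fix \<phi> :: "'a \<Rightarrow> complex" assume "\<phi> \<in> test_functions"
      moreover have "distr_of_fun h \<phi> = distr_of_fun ?g \<phi>" using h d by simp
      ultimately show "(LINT x|lborel. h x * \<phi> x) = (LINT x|lborel. ?g x * \<phi> x)"
        by (simp add: distr_of_fun_def)
    qed (use h cont in auto)
  qed (use cont d in auto)
qed

section \<open>Estimates on slices\<close>

text \<open>For a > l the factor (a/l)^(p-1) is at least 1, so the second summand already exceeds
  a.\<close>

lemma le_add_powr:
  fixes a l p :: real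
  assumes "0 \<le> a" "0 < l" "1 \<le> p"
  shows "a \<le> l + l powr (1 - p) * a powr p"
proof (cases "a \<le> l")
  case True
  then show ?thesis by (simp add: add_increasing2)
next
  case False
  then have "a powr (1 - p) \<le> l powr (1 - p)" using assms by (intro powr_mono2') auto
  then have "a powr (1 - p) * a powr p \<le> l powr (1 - p) * a powr p" by (rule mult_right_mono) simp
  moreover have "a powr (1 - p) * a powr p = a" using False assms by (simp add: powr_add[symmetric])
  ultimately show ?thesis using assms(2) by simp
qed

text \<open>A substitute for Hoelder's inequality: \<open>a \<le> l + l powr (1 - p) * a powr p\<close> with the best \<open>l\<close>.\<close>

lemma nn_integral_le_power_mean:
  fixes a :: "'x \<Rightarrow> real"
  assumes [measurable]: "a \<in> borel_measurable M" and a: "\<And>x. 0 \<le> a x" and p: "1 \<le> p"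
    and m: "emeasure M (space M) \<le> ennreal m" "0 \<le> m"
    and J: "(\<integral>\<^sup>+x. ennreal (a x powr p) \<partial>M) \<le> ennreal J" "0 \<le> J"
  shows "(\<integral>\<^sup>+x. ennreal (a x) \<partial>M) \<le> ennreal ((m + 1) * J powr (1 / p))"
proof (cases "J = 0")
  case True
  then have "AE x in M. ennreal (a x powr p) = 0"
    using J by (subst nn_integral_0_iff_AE[symmetric]) auto
  then have "AE x in M. ennreal (a x) = 0"
    by eventually_elim (use a in \<open>auto simp: powr_eq_0_iff ennreal_eq_0_iff\<close>)
  then show ?thesis by (subst (asm) nn_integral_0_iff_AE[symmetric]) auto
next
  case False
  \<comment> \<open>With this choice both contributions are multiples of J^(1/p): the first is m l,
    and l^(1-p) J = l. Hence the constant m + 1; J = 0 was treated apart because l has to be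
    positive.\<close>
  define l where "l = J powr (1 / p)"
  have l: "l > 0" using False by (simp add: l_def)
  have "(\<integral>\<^sup>+x. ennreal (a x) \<partial>M) \<le> (\<integral>\<^sup>+x. ennreal l + ennreal (l powr (1 - p)) * ennreal (a x powr p) \<partial>M)"
    using le_add_powr[OF a l p] l
    by (intro nn_integral_mono) (simp add: ennreal_plus[symmetric] ennreal_mult[symmetric] ennreal_leI del: ennreal_plus)
  also have "\<dots> = ennreal l * emeasure M (space M) + ennreal (l powr (1 - p)) * (\<integral>\<^sup>+x. ennreal (a x powr p) \<partial>M)"
    by (subst nn_integral_add) (auto simp: nn_integral_cmult)
  also have "\<dots> \<le> ennreal l * ennreal m + ennreal (l powr (1 - p)) * ennreal J"
    by (intro add_mono mult_left_mono m J) auto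
  also have "\<dots> = ennreal (l * m + l powr (1 - p) * J)"
    using l m(2) J(2) by (simp add: ennreal_mult ennreal_plus)
  also have "l powr (1 - p) * J = l"
  proof -
    have "l powr (1 - p) * J = J powr ((1 / p) * (1 - p)) * J powr 1"
      using J(2) False by (simp add: l_def powr_powr)
    also have "\<dots> = J powr ((1 / p) * (1 - p) + 1)" by (simp add: powr_add)
    also have "(1 / p) * (1 - p) + 1 = 1 / p" using p by (simp add: field_simps)
    finally show ?thesis by (simp add: l_def)
  qed
  finally show ?thesis by (simp add: l_def algebra_simps)
qed

text \<open>The weight \<open>weight r m (x - y)\<close> has mass independent of \<open>r\<close> and majorises the convolution
  kernels of frequency \<open>r\<close>.\<close>

definition weight :: "real \<Rightarrow> nat \<Rightarrow> 'a::euclidean_space \<Rightarrow> real" where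
  "weight r m z = r ^ DIM('a) / (1 + r * norm z) ^ m"

definition weight_mass :: "'a::euclidean_space itself \<Rightarrow> nat \<Rightarrow> ennreal" where
  "weight_mass _ m = (\<integral>\<^sup>+z. ennreal (1 / (1 + norm (z::'a)) ^ m) \<partial>lborel)"

abbreviation average :: "real \<Rightarrow> nat \<Rightarrow> ('a::euclidean_space \<Rightarrow> real) \<Rightarrow> 'a \<Rightarrow> ennreal" where
  "average r m f x \<equiv> (\<integral>\<^sup>+y. ennreal (f y * weight r m (x - y)) \<partial>lborel)"

lemma weight_measurable [measurable]: "weight r m \<in> borel_measurable borel"
  unfolding weight_def by measurable

lemma weight_nonneg: "0 \<le> r \<Longrightarrow> 0 \<le> weight r m z"
  by (simp add: weight_def)

lemma weight_le: "0 \<le> r \<Longrightarrow> weight r m (z::'a::euclidean_space) \<le> r ^ DIM('a)"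
  unfolding weight_def by (intro divide_le_eq_1[THEN iffD2] mult_imp_div_pos_le)
    (auto intro!: mult_right_le_one_le simp: add_pos_nonneg mult_le_cancel_left1 one_le_power)

lemma nn_integral_weight:
  fixes x :: "'a::euclidean_space"
  assumes "r > 0"
  shows "(\<integral>\<^sup>+y. ennreal (weight r m (x - y)) \<partial>lborel) = weight_mass TYPE('a) m"
proof -
  have "(\<integral>\<^sup>+y. ennreal (weight r m (x - y)) \<partial>lborel)
      = ennreal (\<bar>- 1 / r\<bar> ^ DIM('a)) * (\<integral>\<^sup>+z. ennreal (weight r m (x - (x + (- 1 / r) *\<^sub>R z))) \<partial>(lborel::'a measure))"
    using assms by (intro nn_integral_lborel_scale) auto
  also have "\<dots> = (\<integral>\<^sup>+z. ennreal (1 / (1 + norm z) ^ m) \<partial>(lborel::'a measure))"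
    using assms
    by (subst nn_integral_cmult[symmetric])
       (auto simp: weight_def ennreal_mult'[symmetric] power_divide intro!: nn_integral_cong)
  finally show ?thesis by (simp add: weight_mass_def)
qed

lemma weight_mass_finite:
  assumes "2 * DIM('a::euclidean_space) \<le> m"
  shows "weight_mass TYPE('a) m < \<infinity>"
proof -
  have "weight_mass TYPE('a) m \<le> (\<integral>\<^sup>+x. ennreal (1 / (1 + norm (x::'a)) ^ (2 * DIM('a))) \<partial>lborel)"
    unfolding weight_mass_def
    using assms by (intro nn_integral_mono ennreal_leI divide_left_mono power_increasing) (auto simp: add_pos_nonneg)
  also have "\<dots> < \<infinity>" by (rule nn_integral_weight_finite)
  finally show ?thesis .
qed

text \<open>With the weight as density, the space has mass \<kappa> for every r and x; the power
  mean inequality for that measure raises the exponent under the average from 1 to p.\<close>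

lemma subaverage_ge_1:
  fixes g :: "'a::euclidean_space \<Rightarrow> complex"
  assumes [measurable]: "g \<in> borel_measurable borel" and "1 \<le> p" "C > 0" "r \<ge> 1"
    and fin: "weight_mass TYPE('a) m = ennreal \<kappa>" "0 \<le> \<kappa>"
    and sub: "\<And>x. ennreal (norm (g x)) \<le> ennreal C * average r m (\<lambda>y. norm (g y)) x"
  shows "ennreal (norm (g x) powr p)
    \<le> ennreal ((C * (\<kappa> + 1)) powr p) * average r m (\<lambda>y. norm (g y) powr p) x"
proof (cases "average r m (\<lambda>y. norm (g y) powr p) x")
  case top
  then show ?thesis using assms by (simp add: ennreal_mult_top)
next
  case (real J)
  let ?M = "density lborel (\<lambda>y. ennreal (weight r m (x - y)))"
  have w: "0 \<le> weight r m z" for z :: 'a using assms by (simp add: weight_nonneg)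
  have "(\<integral>\<^sup>+y. ennreal (norm (g y)) \<partial>?M) \<le> ennreal ((\<kappa> + 1) * J powr (1 / p))"
  proof (rule nn_integral_le_power_mean)
    show "emeasure ?M (space ?M) \<le> ennreal \<kappa>"
      using nn_integral_weight[of r m x] assms(4) fin by (simp add: emeasure_density)
    show "(\<integral>\<^sup>+y. ennreal (norm (g y) powr p) \<partial>?M) \<le> ennreal J"
      using real w by (simp add: nn_integral_density ennreal_mult'[symmetric] mult.commute)
  qed (use assms real in auto)
  then have "average r m (\<lambda>y. norm (g y)) x \<le> ennreal ((\<kappa> + 1) * J powr (1 / p))"
    using w by (simp add: nn_integral_density ennreal_mult'[symmetric] mult.commute)
  with sub[of x] have "ennreal (norm (g x)) \<le> ennreal C * ennreal ((\<kappa> + 1) * J powr (1 / p))"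
    by (meson mult_left_mono order_trans zero_le)
  then have "norm (g x) \<le> C * ((\<kappa> + 1) * J powr (1 / p))"
    using assms fin by (simp add: ennreal_mult'[symmetric] ennreal_le_iff)
  then have "norm (g x) powr p \<le> (C * ((\<kappa> + 1) * J powr (1 / p))) powr p"
    using assms by (intro powr_mono2) auto
  also have "\<dots> = (C * (\<kappa> + 1)) powr p * J"
    using assms real fin by (simp add: powr_mult powr_powr mult.assoc)
  finally have "ennreal (norm (g x) powr p) \<le> ennreal ((C * (\<kappa> + 1)) powr p) * ennreal J"
    by (simp add: ennreal_mult'[symmetric] ennreal_leI)
  then show ?thesis using real by simp
qed

text \<open>For \<open>p < 1\<close> the trick is to pass to Peetre's maximal function, which is finite by the growth
  assumption.\<close>

lemma subaverage_less_1:
  fixes g :: "'a::euclidean_space \<Rightarrow> complex"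
  assumes [measurable]: "g \<in> borel_measurable borel" and p: "0 < p" "p < 1" and C: "C > 0" and r: "r \<ge> 1"
    and growth: "\<And>x. norm (g x) \<le> A * (1 + norm x) ^ N" and M: "N \<le> M" "real m \<le> real M * p"
    and sub: "\<And>x. ennreal (norm (g x)) \<le> ennreal C * average r M (\<lambda>y. norm (g y)) x"
  shows "ennreal (norm (g x) powr p)
    \<le> ennreal C * average r m (\<lambda>y. norm (g y) powr p) x"
proof -
  have A0: "0 \<le> A" using order_trans[OF norm_ge_zero growth[of 0]] by simp
  define v where "v y = norm (g y) / (1 + r * norm (x - y)) ^ M" for y
  have [measurable]: "v \<in> borel_measurable borel" unfolding v_def by measurable
  have pos: "0 < 1 + r * norm z" "1 \<le> 1 + r * norm z" for z :: 'a using r by (auto intro: add_pos_nonneg)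
  have v0: "0 \<le> v y" for y unfolding v_def using pos by (simp add: less_imp_le)
  have v_le: "v y \<le> A * (1 + norm x) ^ N" for y
  proof -
    have "1 + norm y \<le> (1 + norm (y + (x - y))) * (1 + norm (x - y))" by (rule one_plus_norm_shift)
    also have "\<dots> \<le> (1 + norm x) * (1 + r * norm (x - y))"
      using r by (intro mult_mono) (auto simp: mult_le_cancel_right1)
    finally have "(1 + norm y) ^ N \<le> ((1 + norm x) * (1 + r * norm (x - y))) ^ N"
      by (intro power_mono) auto
    also have "\<dots> \<le> (1 + norm x) ^ N * (1 + r * norm (x - y)) ^ M"
      unfolding power_mult_distrib using pos M by (intro mult_left_mono power_increasing) auto
    finally have "norm (g y) \<le> A * ((1 + norm x) ^ N * (1 + r * norm (x - y)) ^ M)"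
      using growth[of y] A0 by (meson mult_left_mono order_trans)
    then show ?thesis using pos by (simp add: v_def pos_divide_le_eq ac_simps)
  qed
  define S where "S = (SUP y. v y)"
  have bdd: "bdd_above (range v)" using v_le by (auto simp: bdd_above_def)
  have vS: "v y \<le> S" for y unfolding S_def by (rule cSUP_upper[OF UNIV_I bdd])
  have S0: "0 \<le> S" using v0 vS order_trans by blast
  have gx: "norm (g x) \<le> S" using vS[of x] by (simp add: v_def)
  let ?L = "\<integral>\<^sup>+z. ennreal (v z powr p) \<partial>lborel"
  \<comment> \<open>The p-th power weakens the decay from order M to order M p, which is still at
    least m by the choice of M.\<close>
  have "(1 / (1 + r * norm z) ^ M) powr p \<le> 1 / (1 + r * norm z) ^ m" for z :: 'a
  proof -
    have "((1 + r * norm z) ^ M) powr p = (1 + r * norm z) powr (real M * p)"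
      using pos by (simp add: powr_powr[symmetric] powr_realpow)
    also have "\<dots> \<ge> (1 + r * norm z) powr real m" using pos M by (intro powr_mono) auto
    finally have "(1 + r * norm z) ^ m \<le> ((1 + r * norm z) ^ M) powr p" using pos by (simp add: powr_realpow)
    moreover have "0 < ((1 + r * norm z) ^ M) powr p" "0 < (1 + r * norm z) ^ m"
      using pos(1)[of z] by auto
    ultimately have "1 / ((1 + r * norm z) ^ M) powr p \<le> 1 / (1 + r * norm z) ^ m"
      by (intro divide_left_mono) auto
    then show ?thesis using pos by (simp add: powr_divide less_imp_le)
  qed
  then have vp: "v z powr p \<le> norm (g z) powr p * (1 / (1 + r * norm (x - z)) ^ m)" for z
    unfolding v_def divide_inverse[of "norm (g z)"] inverse_eq_divide
    using pos by (simp add: powr_mult mult_left_mono less_imp_le del: times_divide_eq_right)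
  have L_le: "ennreal (r ^ DIM('a)) * ?L \<le> average r m (\<lambda>y. norm (g y) powr p) x"
  proof -
    have "ennreal (r ^ DIM('a)) * ?L = (\<integral>\<^sup>+z. ennreal (r ^ DIM('a) * v z powr p) \<partial>lborel)"
      using r by (subst nn_integral_cmult[symmetric]) (auto simp: ennreal_mult')
    also have "\<dots> \<le> average r m (\<lambda>y. norm (g y) powr p) x"
    proof (intro nn_integral_mono ennreal_leI)
      fix z
      have "r ^ DIM('a) * v z powr p \<le> r ^ DIM('a) * (norm (g z) powr p * (1 / (1 + r * norm (x - z)) ^ m))"
        using r by (intro mult_left_mono vp) auto
      then show "r ^ DIM('a) * v z powr p \<le> norm (g z) powr p * weight r m (x - z)"
        by (simp add: weight_def ac_simps)
    qed
    finally show ?thesis .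
  qed
  show ?thesis
  proof (cases "S = 0")
    case True
    then show ?thesis using gx p by simp
  next
    case False
    then have S: "S > 0" using S0 by simp
    show ?thesis
    proof (cases ?L)
      case top
      then have "ennreal (r ^ DIM('a)) * ?L = \<top>" using r by (simp add: ennreal_mult_top)
      with L_le have "average r m (\<lambda>y. norm (g y) powr p) x = \<top>"
        by (simp add: top_unique)
      then show ?thesis using C by (simp add: ennreal_mult_top)
    next
      case (real L)
      have "v y \<le> C * (r ^ DIM('a) * (S powr (1 - p) * L))" for y
      proof -
        \<comment> \<open>The weights are submultiplicative, so the decay around y and the decay of
          y around x combine to decay around x, which produces v z. Splitting v = v^(1-p) v^p and
          bounding the first factor by S^(1-p) leaves an integral of v^p.\<close>
        have "norm (g z) * weight r M (y - z) / (1 + r * norm (x - y)) ^ M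
            \<le> r ^ DIM('a) * (S powr (1 - p) * v z powr p)" for z
        proof -
          have "1 + r * norm (x - z) \<le> 1 + r * (norm (x - y) + norm (y - z))"
            using r norm_triangle_ineq[of "x - y" "y - z"] by (simp add: mult_left_mono)
          also have "\<dots> \<le> (1 + r * norm (y - z)) * (1 + r * norm (x - y))"
            using r by (simp add: algebra_simps)
          finally have "(1 + r * norm (x - z)) ^ M \<le> ((1 + r * norm (y - z)) * (1 + r * norm (x - y))) ^ M"
            using pos by (intro power_mono) (auto simp: less_imp_le)
          then have "norm (g z) * r ^ DIM('a) / ((1 + r * norm (y - z)) * (1 + r * norm (x - y))) ^ M
              \<le> norm (g z) * r ^ DIM('a) / (1 + r * norm (x - z)) ^ M"
            using pos r by (intro divide_left_mono) (auto intro!: mult_pos_pos zero_less_power)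
          then have "norm (g z) * weight r M (y - z) / (1 + r * norm (x - y)) ^ M \<le> r ^ DIM('a) * v z"
            by (simp add: weight_def v_def power_mult_distrib ac_simps)
          also have "v z = v z powr (1 - p) * v z powr p"
            using v0[of z] by (simp add: powr_add[symmetric])
          also have "\<dots> \<le> S powr (1 - p) * v z powr p"
            using v0 vS p by (intro mult_right_mono powr_mono2) auto
          finally show ?thesis using r by (simp add: mult_left_mono)
        qed
        note le = this
        have "ennreal (v y) = ennreal (1 / (1 + r * norm (x - y)) ^ M) * ennreal (norm (g y))"
          using pos by (simp add: v_def ennreal_mult'[symmetric] less_imp_le)
        also have "\<dots> \<le> ennreal (1 / (1 + r * norm (x - y)) ^ M) *
            (ennreal C * (\<integral>\<^sup>+z. ennreal (norm (g z) * weight r M (y - z)) \<partial>lborel))"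
          by (intro mult_left_mono sub) auto
        also have "\<dots> = ennreal C * (\<integral>\<^sup>+z. ennreal (norm (g z) * weight r M (y - z) / (1 + r * norm (x - y)) ^ M) \<partial>lborel)"
          unfolding mult.left_commute[of _ "ennreal C"]
          using pos by (subst nn_integral_cmult[symmetric]) (auto simp: ennreal_mult'[symmetric] less_imp_le)
        also have "\<dots> \<le> ennreal C * (\<integral>\<^sup>+z. ennreal (r ^ DIM('a) * S powr (1 - p)) * ennreal (v z powr p) \<partial>lborel)"
          using le r by (intro mult_left_mono nn_integral_mono) (auto simp: ennreal_mult'[symmetric] mult.assoc intro!: ennreal_leI)
        also have "\<dots> = ennreal C * (ennreal (r ^ DIM('a) * S powr (1 - p)) * ennreal L)"
          using real by (subst nn_integral_cmult) auto
        also have "\<dots> = ennreal (C * (r ^ DIM('a) * (S powr (1 - p) * L)))"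
          using C r real by (simp add: ennreal_mult'[symmetric] mult.assoc)
        finally show ?thesis using C r real by (subst (asm) ennreal_le_iff) auto
      qed
      then have "S \<le> C * (r ^ DIM('a) * (S powr (1 - p) * L))" unfolding S_def by (intro cSUP_least) (auto simp: S_def[symmetric])
      \<comment> \<open>S occurs on both sides; being finite and positive, its power S^(1-p) can be
        cancelled, and S^p remains on the left.\<close>
      then have "S powr (p - 1) * S \<le> S powr (p - 1) * (C * (r ^ DIM('a) * (S powr (1 - p) * L)))"
        by (rule mult_left_mono) simp
      also have "\<dots> = (S powr (p - 1) * S powr (1 - p)) * (C * (r ^ DIM('a) * L))" by (simp add: ac_simps)
      also have "S powr (p - 1) * S powr (1 - p) = 1" using S by (simp add: powr_add[symmetric])
      also have "S powr (p - 1) * S = S powr p"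
        using S by (simp add: powr_diff)
      finally have "norm (g x) powr p \<le> C * (r ^ DIM('a) * L)"
        using powr_mono2[OF less_imp_le[OF p(1)] norm_ge_zero gx] by simp
      then have "ennreal (norm (g x) powr p) \<le> ennreal C * (ennreal (r ^ DIM('a)) * ?L)"
        using C r real by (simp add: ennreal_mult'[symmetric] ennreal_leI)
      also have "\<dots> \<le> ennreal C * average r m (\<lambda>y. norm (g y) powr p) x"
        by (intro mult_left_mono L_le) auto
      finally show ?thesis .
    qed
  qed
qed

text \<open>The weight lives in one dimension more than the slice. Dropping the normal coordinate
  from the norm leaves the weight of the hyperplane times one surplus power of r, which is the
  factor lost by the restriction.\<close>

lemma nn_integral_slice_le:
  fixes g :: "'a::euclidean_space \<times> real \<Rightarrow> complex"
  assumes [measurable]: "g \<in> borel_measurable borel" and r: "r \<ge> 1"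
    and fin: "weight_mass TYPE('a) m = ennreal \<kappa>" "0 \<le> \<kappa>"
    and D: "0 \<le> D"
    and sub: "\<And>x. ennreal (norm (g x) powr p) \<le> ennreal D * average r m (\<lambda>y. norm (g y) powr p) x"
  shows "(\<integral>\<^sup>+x. ennreal (norm (g (x, t)) powr p) \<partial>lborel)
    \<le> ennreal (D * \<kappa> * r) * (\<integral>\<^sup>+y. ennreal (norm (g y) powr p) \<partial>lborel)"
proof -
  have "(\<integral>\<^sup>+x. ennreal (norm (g (x, t)) powr p) \<partial>lborel)
    \<le> (\<integral>\<^sup>+x. ennreal D * (\<integral>\<^sup>+y. ennreal (norm (g y) powr p * weight r m ((x, t) - y)) \<partial>lborel) \<partial>lborel)"
    by (intro nn_integral_mono sub)
  also have "\<dots> = ennreal D * (\<integral>\<^sup>+x. (\<integral>\<^sup>+y. ennreal (norm (g y) powr p * weight r m ((x, t) - y)) \<partial>lborel) \<partial>lborel)"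
    by (rule nn_integral_cmult) measurable
  also have "(\<integral>\<^sup>+x. (\<integral>\<^sup>+y. ennreal (norm (g y) powr p * weight r m ((x, t) - y)) \<partial>lborel) \<partial>lborel)
    = (\<integral>\<^sup>+y. (\<integral>\<^sup>+x. ennreal (norm (g y) powr p * weight r m ((x, t) - y)) \<partial>lborel) \<partial>lborel)"
    by (rule lborel_pair.Fubini') measurable
  also have "\<dots> \<le> (\<integral>\<^sup>+y. ennreal (norm (g y) powr p) * ennreal (r * \<kappa>) \<partial>lborel)"
  proof (rule nn_integral_mono)
    fix y :: "'a \<times> real"
    have "weight r m ((x, t) - y) \<le> r * weight r m (fst y - x)" for x
    proof -
      have "norm (fst y - x) \<le> norm ((x, t) - y)"
        using norm_fst_le[of "x - fst y" "t - snd y"] by (cases y) (simp add: norm_minus_commute)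
      then have "(1 + r * norm (fst y - x)) ^ m \<le> (1 + r * norm ((x, t) - y)) ^ m"
        using r by (intro power_mono) (auto intro: mult_left_mono)
      then have "r ^ Suc DIM('a) / (1 + r * norm ((x, t) - y)) ^ m \<le> r ^ Suc DIM('a) / (1 + r * norm (fst y - x)) ^ m"
        using r by (intro divide_left_mono) (auto intro!: mult_pos_pos zero_less_power add_pos_nonneg)
      then show ?thesis by (simp add: weight_def)
    qed
    then have "(\<integral>\<^sup>+x. ennreal (norm (g y) powr p * weight r m ((x, t) - y)) \<partial>lborel)
      \<le> (\<integral>\<^sup>+x. ennreal (norm (g y) powr p * r) * ennreal (weight r m (fst y - x)) \<partial>lborel)"
      using r by (intro nn_integral_mono) (auto simp: ennreal_mult'[symmetric] mult.assoc intro!: ennreal_leI mult_left_mono)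
    also have "\<dots> = ennreal (norm (g y) powr p * r) * weight_mass TYPE('a) m"
      using nn_integral_weight[of r m "fst y"] r by (subst nn_integral_cmult) auto
    also have "\<dots> = ennreal (norm (g y) powr p) * ennreal (r * \<kappa>)"
      using r fin by (simp add: ennreal_mult'[symmetric] mult.assoc)
    finally show "(\<integral>\<^sup>+x. ennreal (norm (g y) powr p * weight r m ((x, t) - y)) \<partial>lborel)
      \<le> ennreal (norm (g y) powr p) * ennreal (r * \<kappa>)" .
  qed
  also have "\<dots> = (\<integral>\<^sup>+y. ennreal (norm (g y) powr p) \<partial>lborel) * ennreal (r * \<kappa>)"
    by (rule nn_integral_multc) measurable
  finally have "(\<integral>\<^sup>+x. ennreal (norm (g (x, t)) powr p) \<partial>lborel)
    \<le> ennreal D * ((\<integral>\<^sup>+y. ennreal (norm (g y) powr p) \<partial>lborel) * ennreal (r * \<kappa>))"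
    by (simp add: mult_left_mono)
  also have "\<dots> = ennreal D * ennreal (r * \<kappa>) * (\<integral>\<^sup>+y. ennreal (norm (g y) powr p) \<partial>lborel)"
    by (simp add: ac_simps)
  finally show ?thesis
    using D r fin(2) by (auto simp: ennreal_mult'[symmetric] ac_simps)
qed

section \<open>Bounds for a single block on a hyperplane\<close>

lemma Lp_norm_real:
  assumes "p > 0" "(\<integral>\<^sup>+ x. ennreal (norm (g x) powr p) \<partial>lborel) = ennreal J" "0 \<le> J"
  shows "Lp_norm (ereal p) g = ennreal (J powr (1 / p))"
  using assms by (simp add: Lp_norm_def epow_def)

text \<open>For p = \<infinity> the averages turn the essential bound into a bound at every point,
  which is what a restriction to a null set requires.\<close>

lemma slice_estimate_top:
  fixes g :: "'a::euclidean_space \<times> real \<Rightarrow> complex"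
  assumes [measurable]: "g \<in> borel_measurable borel" "K \<in> sets borel" and r: "r \<ge> 1"
    and k: "emeasure lborel K = ennreal k" "0 \<le> k"
    and fin: "weight_mass TYPE('a \<times> real) m = ennreal \<kappa>" "0 \<le> \<kappa>" and C: "0 \<le> C"
    and sub: "\<And>x. ennreal (norm (g x)) \<le> ennreal C * average r m (\<lambda>y. norm (g y)) x"
  shows "(\<integral>\<^sup>+x. ennreal (norm (g (x, t))) * indicator K x \<partial>lborel) \<le> ennreal (C * \<kappa> * k) * Lp_norm \<infinity> g"
proof -
  define E where "E = Lp_norm \<infinity> g"
  have ae: "AE y in lborel. ennreal (norm (g y)) \<le> E"
    unfolding E_def Lp_norm_def using esssup_AE by auto
  have le: "ennreal (norm (g x)) \<le> ennreal (C * \<kappa>) * E" for x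
  proof -
    have "average r m (\<lambda>y. norm (g y)) x \<le> (\<integral>\<^sup>+y. E * ennreal (weight r m (x - y)) \<partial>lborel)"
      using ae by (intro nn_integral_mono_AE) (auto elim!: eventually_mono simp: ennreal_mult' mult_right_mono)
    also have "\<dots> = E * ennreal \<kappa>"
      using nn_integral_weight[of r m x] r fin by (subst nn_integral_cmult) auto
    finally have "ennreal C * average r m (\<lambda>y. norm (g y)) x \<le> ennreal C * (E * ennreal \<kappa>)"
      by (rule mult_left_mono) simp
    with sub[of x] show ?thesis using C fin by (simp add: ennreal_mult ac_simps)
  qed
  have "(\<integral>\<^sup>+x. ennreal (norm (g (x, t))) * indicator K x \<partial>lborel) \<le> (\<integral>\<^sup>+x. (ennreal (C * \<kappa>) * E) * indicator K x \<partial>lborel)"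
    using le by (intro nn_integral_mono mult_right_mono) auto
  also have "\<dots> = ennreal (C * \<kappa>) * E * ennreal k"
    using k by (subst nn_integral_cmult) auto
  also have "\<dots> = ennreal (C * \<kappa> * k) * E"
    using C fin k by (simp add: ennreal_mult ac_simps)
  finally show ?thesis by (simp add: E_def)
qed

text \<open>The slice bound in L_p, followed by the power mean inequality on K. Here the finite
  measure of K enters.\<close>

lemma slice_estimate_ge_1:
  fixes g :: "'a::euclidean_space \<times> real \<Rightarrow> complex"
  assumes [measurable]: "g \<in> borel_measurable borel" "K \<in> sets borel" and r: "r \<ge> 1" and p: "p \<ge> 1"
    and k: "emeasure lborel K = ennreal k" "0 \<le> k"
    and fin: "weight_mass TYPE('a) m = ennreal \<kappa>" "0 \<le> \<kappa>" and D: "0 \<le> D"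
    and sub: "\<And>x. ennreal (norm (g x) powr p) \<le> ennreal D * average r m (\<lambda>y. norm (g y) powr p) x"
    and J: "(\<integral>\<^sup>+ x. ennreal (norm (g x) powr p) \<partial>lborel) = ennreal J" "0 \<le> J"
  shows "(\<integral>\<^sup>+x. ennreal (norm (g (x, t))) * indicator K x \<partial>lborel)
    \<le> ennreal ((k + 1) * (D * \<kappa>) powr (1 / p) * r powr (1 / p)) * Lp_norm (ereal p) g"
proof -
  let ?M = "density lborel (indicator K)"
  have "(\<integral>\<^sup>+x. ennreal (norm (g (x, t))) \<partial>?M) \<le> ennreal ((k + 1) * (D * \<kappa> * r * J) powr (1 / p))"
  proof (rule nn_integral_le_power_mean)
    show "emeasure ?M (space ?M) \<le> ennreal k" using k by (simp add: emeasure_density)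
    have "(\<integral>\<^sup>+x. ennreal (norm (g (x, t)) powr p) \<partial>?M) = (\<integral>\<^sup>+x. indicator K x * ennreal (norm (g (x, t)) powr p) \<partial>lborel)"
      by (rule nn_integral_density) measurable
    also have "\<dots> \<le> (\<integral>\<^sup>+x. ennreal (norm (g (x, t)) powr p) \<partial>lborel)"
      by (intro nn_integral_mono) (auto simp: indicator_def)
    also have "\<dots> \<le> ennreal (D * \<kappa> * r) * ennreal J"
      using nn_integral_slice_le[OF assms(1) r fin D sub, of t] J by simp
    finally show "(\<integral>\<^sup>+x. ennreal (norm (g (x, t)) powr p) \<partial>?M) \<le> ennreal (D * \<kappa> * r * J)"
      using D fin r J by (simp add: ennreal_mult[symmetric])
  qed (use D fin r J p k in auto)
  also have "(\<integral>\<^sup>+x. ennreal (norm (g (x, t))) \<partial>?M) = (\<integral>\<^sup>+x. ennreal (norm (g (x, t))) * indicator K x \<partial>lborel)"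
    by (subst nn_integral_density) (auto simp: mult.commute)
  also have "ennreal ((k + 1) * (D * \<kappa> * r * J) powr (1 / p))
      = ennreal ((k + 1) * (D * \<kappa>) powr (1 / p) * r powr (1 / p)) * Lp_norm (ereal p) g"
    using D fin r J p k by (subst Lp_norm_real[OF _ J]) (auto simp: ennreal_mult[symmetric] powr_mult ac_simps)
  finally show ?thesis .
qed

text \<open>An inequality of Nikolskii type: the average, with its weight replaced by the maximum
  r^n in dimension n = DIM + 1, bounds |g|^p everywhere, and |g| = (|g|^p)^(1/p - 1) |g|^p trades
  this bound for the missing integrability. The powers of r add up to n (1/p - 1) + 1 = 1/p + (n -
  1)(1/p - 1).\<close>

lemma slice_estimate_less_1:
  fixes g :: "'a::euclidean_space \<times> real \<Rightarrow> complex"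
  assumes [measurable]: "g \<in> borel_measurable borel" "K \<in> sets borel" and r: "r \<ge> 1" and p: "0 < p" "p < 1"
    and fin: "weight_mass TYPE('a) m = ennreal \<kappa>" "0 \<le> \<kappa>" and D: "0 \<le> D"
    and sub: "\<And>x. ennreal (norm (g x) powr p) \<le> ennreal D * average r m (\<lambda>y. norm (g y) powr p) x"
    and J: "(\<integral>\<^sup>+ x. ennreal (norm (g x) powr p) \<partial>lborel) = ennreal J" "0 \<le> J"
  shows "(\<integral>\<^sup>+x. ennreal (norm (g (x, t))) * indicator K x \<partial>lborel)
    \<le> ennreal (D powr (1 / p - 1) * D * \<kappa> * r powr (1 / p + real DIM('a) * (1 / p - 1))) * Lp_norm (ereal p) g"
proof -
  let ?B = "D * r ^ Suc DIM('a) * J"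
  have gB: "norm (g x) powr p \<le> ?B" for x
  proof -
    have "average r m (\<lambda>y. norm (g y) powr p) x
        \<le> (\<integral>\<^sup>+y. ennreal (r ^ Suc DIM('a)) * ennreal (norm (g y) powr p) \<partial>lborel)"
      using weight_le[of r m "x - _"] r
      by (intro nn_integral_mono)
         (auto simp: ennreal_mult'[symmetric] mult.commute[of "norm _ powr p"] intro!: ennreal_leI mult_right_mono)
    also have "\<dots> = ennreal (r ^ Suc DIM('a) * J)"
      using J r by (subst nn_integral_cmult) (auto simp: ennreal_mult')
    finally have "ennreal D * average r m (\<lambda>y. norm (g y) powr p) x
        \<le> ennreal D * ennreal (r ^ Suc DIM('a) * J)" by (rule mult_left_mono) simp
    with sub[of x] have "ennreal (norm (g x) powr p) \<le> ennreal D * ennreal (r ^ Suc DIM('a) * J)"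
      by (rule order_trans)
    then show ?thesis using D r J by (simp add: ennreal_mult'[symmetric] mult.assoc del: power_Suc)
  qed
  have le: "norm (g x) \<le> ?B powr (1 / p - 1) * norm (g x) powr p" for x
  proof (cases "norm (g x) = 0")
    case False
    then have pos: "norm (g x) > 0" by simp
    have "norm (g x) = (norm (g x) powr p) powr (1 / p - 1) * norm (g x) powr p"
      using pos p by (simp add: powr_powr powr_add[symmetric] right_diff_distrib)
    also have "\<dots> \<le> ?B powr (1 / p - 1) * norm (g x) powr p"
      using gB[of x] p by (intro mult_right_mono powr_mono2) (auto simp: field_simps)
    finally show ?thesis .
  qed simp
  have "(\<integral>\<^sup>+x. ennreal (norm (g (x, t))) * indicator K x \<partial>lborel)
      \<le> (\<integral>\<^sup>+x. ennreal (?B powr (1 / p - 1)) * ennreal (norm (g (x, t)) powr p) \<partial>lborel)"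
    using le by (intro nn_integral_mono) (auto simp: ennreal_mult'[symmetric] indicator_def intro!: ennreal_leI)
  also have "\<dots> = ennreal (?B powr (1 / p - 1)) * (\<integral>\<^sup>+x. ennreal (norm (g (x, t)) powr p) \<partial>lborel)"
    by (rule nn_integral_cmult) measurable
  also have "\<dots> \<le> ennreal (?B powr (1 / p - 1)) * (ennreal (D * \<kappa> * r) * ennreal J)"
    using nn_integral_slice_le[OF assms(1) r fin D sub, of t] J by (intro mult_left_mono) auto
  also have "\<dots> = ennreal (?B powr (1 / p - 1) * (D * \<kappa> * r * J))"
    using D fin r J by (simp add: ennreal_mult[symmetric])
  also have "?B powr (1 / p - 1) * (D * \<kappa> * r * J)
      = (D powr (1 / p - 1) * D * \<kappa> * r powr (1 / p + real DIM('a) * (1 / p - 1))) * J powr (1 / p)"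
  proof -
    have 1: "?B powr (1 / p - 1) = D powr (1 / p - 1) * r powr (real (Suc DIM('a)) * (1 / p - 1)) * J powr (1 / p - 1)"
      using D r J powr_realpow[of r "Suc DIM('a)"]
      by (simp add: powr_mult powr_powr[symmetric] del: power_Suc of_nat_Suc)
    have "r powr (real (Suc DIM('a)) * (1 / p - 1)) * r = r powr (real (Suc DIM('a)) * (1 / p - 1) + 1)"
      using r by (simp add: powr_add)
    also have "real (Suc DIM('a)) * (1 / p - 1) + 1 = 1 / p + real DIM('a) * (1 / p - 1)"
      by (simp add: algebra_simps)
    finally have 2: "r powr (real (Suc DIM('a)) * (1 / p - 1)) * r = r powr (1 / p + real DIM('a) * (1 / p - 1))" .
    have 3: "J powr (1 / p - 1) * J = J powr (1 / p)"
      using J p by (cases "J = 0") (auto simp: powr_diff)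
    have "?B powr (1 / p - 1) * (D * \<kappa> * r * J) = (D powr (1 / p - 1) * D * \<kappa>)
        * (r powr (real (Suc DIM('a)) * (1 / p - 1)) * r) * (J powr (1 / p - 1) * J)"
      unfolding 1 by (simp only: ac_simps)
    then show ?thesis unfolding 2 3 .
  qed
  also have "ennreal (\<dots>) = ennreal (D powr (1 / p - 1) * D * \<kappa> * r powr (1 / p + real DIM('a) * (1 / p - 1))) * Lp_norm (ereal p) g"
    using D fin r J p by (subst Lp_norm_real[OF _ J]) (auto simp: ennreal_mult[symmetric])
  finally show ?thesis .
qed

text \<open>B precedes g, r and t, so that one constant serves all blocks and all hyperplanes. The
  averaging bound is assumed for every M because for p < 1 the exponent has to be adapted to N and
  p.\<close>

lemma slice_estimate:
  fixes K :: "'a::euclidean_space set" and p :: ereal and C :: "nat \<Rightarrow> real"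
  defines "\<sigma> \<equiv> real_of_ereal (1 / p) + real DIM('a) * max (real_of_ereal (1 / p) - 1) 0"
  assumes K: "K \<in> sets borel" "emeasure lborel K < \<infinity>" and p: "p > 0" and C: "\<And>M. C M > 0"
  obtains B where "B > 0"
    "\<And>(g :: 'a \<times> real \<Rightarrow> complex) r t. g \<in> borel_measurable borel \<Longrightarrow> r \<ge> 1 \<Longrightarrow>
      \<exists>A. \<forall>x. norm (g x) \<le> A * (1 + norm x) ^ N \<Longrightarrow>
      (\<And>M x. ennreal (norm (g x)) \<le> ennreal (C M) * average r M (\<lambda>y. norm (g y)) x) \<Longrightarrow>
      (\<integral>\<^sup>+x. ennreal (norm (g (x, t))) * indicator K x \<partial>lborel) \<le> ennreal (B * r powr \<sigma>) * Lp_norm p g"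
proof -
  \<comment> \<open>Large enough for the weight to have finite mass both on the whole space and on
    the hyperplane.\<close>
  let ?m = "2 * DIM('a \<times> real)"
  obtain k where k: "emeasure lborel K = ennreal k" "0 \<le> k" using K(2) by (cases "emeasure lborel K") auto
  obtain \<kappa> where \<kappa>: "weight_mass TYPE('a) ?m = ennreal \<kappa>" "0 \<le> \<kappa>"
    using weight_mass_finite[where 'a='a and m="?m"] by (cases "weight_mass TYPE('a) ?m") auto
  obtain \<kappa>' where \<kappa>': "weight_mass TYPE('a \<times> real) ?m = ennreal \<kappa>'" "0 \<le> \<kappa>'"
    using weight_mass_finite[where 'a="'a \<times> real" and m="?m"] by (cases "weight_mass TYPE('a \<times> real) ?m") auto
  have real_inverse: "real_of_ereal (1 / ereal P) = 1 / P" if "P > 0" for P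
    using that by (simp add: one_ereal_def del: ereal_eq_1)
  \<comment> \<open>The constants are increased by 1 to be positive: otherwise their product with an
    infinite norm could be 0.\<close>
  have enlarge: "ennreal (b * s) * l \<le> ennreal ((b + 1) * s) * l" if "0 \<le> s" for b s l
    using that by (intro mult_right_mono ennreal_leI) (auto simp: distrib_right)
  consider "p = \<infinity>" | P where "p = ereal P" "P \<ge> 1" | P where "p = ereal P" "0 < P" "P < 1"
    using p by (cases p) force+
  then show thesis
  proof cases
    case 1
    \<comment> \<open>Here 1 / \<infinity> = 0, so both terms of \<sigma> vanish.\<close>
    have \<sigma>: "\<sigma> = 0" by (simp add: \<sigma>_def 1)
    show thesis
    proof (rule that[of "C ?m * \<kappa>' * k + 1"])
      show "0 < C ?m * \<kappa>' * k + 1" using C[of ?m] \<kappa>' k by (intro add_nonneg_pos) auto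
      fix g :: "'a \<times> real \<Rightarrow> complex" and r t
      assume g: "g \<in> borel_measurable borel" "r \<ge> 1"
        "\<And>M x. ennreal (norm (g x)) \<le> ennreal (C M) * average r M (\<lambda>y. norm (g y)) x"
      have "(\<integral>\<^sup>+x. ennreal (norm (g (x, t))) * indicator K x \<partial>lborel) \<le> ennreal (C ?m * \<kappa>' * k * r powr \<sigma>) * Lp_norm p g"
        using slice_estimate_top[OF g(1) K(1) g(2) k \<kappa>' less_imp_le[OF C] g(3)] g(2) by (simp add: \<sigma> 1)
      also note enlarge
      finally show "(\<integral>\<^sup>+x. ennreal (norm (g (x, t))) * indicator K x \<partial>lborel)
          \<le> ennreal ((C ?m * \<kappa>' * k + 1) * r powr \<sigma>) * Lp_norm p g" by simp
    qed
  next
    case (2 P)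
    have \<sigma>: "\<sigma> = 1 / P" using 2 by (simp add: \<sigma>_def real_inverse)
    let ?D = "(C ?m * (\<kappa>' + 1)) powr P"
    show thesis
    proof (rule that[of "(k + 1) * (?D * \<kappa>) powr (1 / P) + 1"])
      show B: "0 < (k + 1) * (?D * \<kappa>) powr (1 / P) + 1" using k by (intro add_nonneg_pos) auto
      fix g :: "'a \<times> real \<Rightarrow> complex" and r t
      assume g: "g \<in> borel_measurable borel" "r \<ge> 1"
        "\<And>M x. ennreal (norm (g x)) \<le> ennreal (C M) * average r M (\<lambda>y. norm (g y)) x"
      show "(\<integral>\<^sup>+x. ennreal (norm (g (x, t))) * indicator K x \<partial>lborel)
          \<le> ennreal (((k + 1) * (?D * \<kappa>) powr (1 / P) + 1) * r powr \<sigma>) * Lp_norm p g"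
      proof (cases "\<integral>\<^sup>+ x. ennreal (norm (g x) powr P) \<partial>lborel")
        case top
        then have "Lp_norm p g = \<top>" using 2 by (simp add: Lp_norm_def epow_def)
        then show ?thesis using B g(2) by (simp add: ennreal_mult_top)
      next
        case (real J)
        have "ennreal (norm (g x) powr P) \<le> ennreal ?D * average r ?m (\<lambda>y. norm (g y) powr P) x" for x
          by (rule subaverage_ge_1[OF g(1) 2(2) C g(2) \<kappa>' g(3)])
        from slice_estimate_ge_1[OF g(1) K(1) g(2) 2(2) k \<kappa> _ this real(2,1), of t]
        have "(\<integral>\<^sup>+x. ennreal (norm (g (x, t))) * indicator K x \<partial>lborel)
            \<le> ennreal ((k + 1) * (?D * \<kappa>) powr (1 / P) * r powr \<sigma>) * Lp_norm p g"
          by (simp add: \<sigma> 2)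
        also note enlarge
        finally show ?thesis by simp
      qed
    qed
  next
    case (3 P)
    have \<sigma>: "\<sigma> = 1 / P + real DIM('a) * (1 / P - 1)" using 3 by (simp add: \<sigma>_def real_inverse)
    \<comment> \<open>At least N, for a finite maximal function, and at least m / P, for decay of
      order m after the P-th power.\<close>
    define M where "M = max N (nat \<lceil>real ?m / P\<rceil>)"
    have M: "N \<le> M" "real ?m \<le> real M * P"
    proof -
      have "real ?m / P \<le> real (nat \<lceil>real ?m / P\<rceil>)" by (rule real_nat_ceiling_ge)
      also have "\<dots> \<le> real M" unfolding M_def by simp
      finally show "real ?m \<le> real M * P" using 3 by (simp add: pos_divide_le_eq)
    qed (simp add: M_def)
    let ?D = "C M"
    show thesis
    proof (rule that[of "?D powr (1 / P - 1) * ?D * \<kappa> + 1"])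
      show B: "0 < ?D powr (1 / P - 1) * ?D * \<kappa> + 1" using \<kappa> C[of M] by (intro add_nonneg_pos) auto
      fix g :: "'a \<times> real \<Rightarrow> complex" and r t
      assume g: "g \<in> borel_measurable borel" "r \<ge> 1" "\<exists>A. \<forall>x. norm (g x) \<le> A * (1 + norm x) ^ N"
        "\<And>M x. ennreal (norm (g x)) \<le> ennreal (C M) * average r M (\<lambda>y. norm (g y)) x"
      obtain A where A: "\<And>x. norm (g x) \<le> A * (1 + norm x) ^ N" using g(3) by blast
      show "(\<integral>\<^sup>+x. ennreal (norm (g (x, t))) * indicator K x \<partial>lborel)
          \<le> ennreal ((?D powr (1 / P - 1) * ?D * \<kappa> + 1) * r powr \<sigma>) * Lp_norm p g"
      proof (cases "\<integral>\<^sup>+ x. ennreal (norm (g x) powr P) \<partial>lborel")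
        case top
        then have "Lp_norm p g = \<top>" using 3 by (simp add: Lp_norm_def epow_def)
        then show ?thesis using B g(2) by (simp add: ennreal_mult_top)
      next
        case (real J)
        have "ennreal (norm (g x) powr P) \<le> ennreal ?D * average r ?m (\<lambda>y. norm (g y) powr P) x" for x
          by (rule subaverage_less_1[OF g(1) 3(2,3) C g(2) A M g(4)])
        from slice_estimate_less_1[OF g(1) K(1) g(2) 3(2,3) \<kappa> less_imp_le[OF C] this real(2,1), of t]
        have "(\<integral>\<^sup>+x. ennreal (norm (g (x, t))) * indicator K x \<partial>lborel)
            \<le> ennreal (?D powr (1 / P - 1) * ?D * \<kappa> * r powr \<sigma>) * Lp_norm p g"
          by (simp add: \<sigma> 3)
        also note enlarge
        finally show ?thesis by simp
      qed
    qed
  qed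
qed

section \<open>The trace\<close>

lemma lp_fun_continuous:
  assumes "cutoff \<Psi>" "u \<in> tempered"
  shows "continuous_on UNIV (lp_fun \<Psi> j u)"
proof -
  have "continuous_on UNIV (pair_translate u (kern (cPhi \<Psi> j)))"
    by (rule pair_translate_continuous[OF assms(2) kern_schwartz[OF Phi_schwartz[OF assms(1)]]])
  then show ?thesis
    unfolding lp_fun_eq[OF assms]
    by (rule continuous_on_compose2) (auto intro!: continuous_intros)
qed

lemma lp_fun_measurable:
  "cutoff \<Psi> \<Longrightarrow> u \<in> tempered \<Longrightarrow> lp_fun \<Psi> j u \<in> borel_measurable borel"
  by (intro borel_measurable_continuous_onI lp_fun_continuous)

text \<open>The exponent is common to all blocks since it comes from the order of u. The factor A
  may depend on j: it only ensures that a supremum is finite.\<close>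

lemma lp_fun_growth:
  assumes "cutoff \<Psi>" "u \<in> tempered"
  obtains N where "\<And>j. \<exists>A. \<forall>x. norm (lp_fun \<Psi> j u x) \<le> A * (1 + norm x) ^ N"
proof -
  obtain N where N: "\<And>G. G \<in> schwartz \<Longrightarrow> \<exists>A. \<forall>a. norm (pair_translate u G a) \<le> A * (1 + norm a) ^ N"
    using pair_translate_growth[OF assms(2)] by metis
  show ?thesis
  proof (rule that)
    fix j
    obtain A where "\<And>a. norm (pair_translate u (kern (cPhi \<Psi> j)) a) \<le> A * (1 + norm a) ^ N"
      using N[OF kern_schwartz[OF Phi_schwartz[OF assms(1)]]] by blast
    from this[of "- _"] show "\<exists>A. \<forall>x. norm (lp_fun \<Psi> j u x) \<le> A * (1 + norm x) ^ N"
      unfolding lp_fun_eq[OF assms] by auto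
  qed
qed

text \<open>The reproducing formula with \<open>Psi \<Psi> (Suc j)\<close> as the second symbol. Its
  kernel is a dilate of a single Schwartz function, so its decay constants do not depend on j;
  dilation by 2^(j+1) compared with the weight of frequency 2^j accounts for the power of 2.\<close>

lemma lp_fun_subaverage:
  fixes u :: "('a::euclidean_space \<Rightarrow> complex) \<Rightarrow> complex"
  assumes \<Psi>: "cutoff \<Psi>" and u: "u \<in> tempered"
  obtains C where "\<And>M. C M > 0"
    "\<And>j M x. ennreal (norm (lp_fun \<Psi> j u x))
      \<le> ennreal (C M) * average (2 ^ j) M (\<lambda>y. norm (lp_fun \<Psi> j u y)) x"
proof -
  let ?k = "kern (cPsi \<Psi> 0) :: 'a \<Rightarrow> complex"
  note k = kern_schwartz[OF Psi_schwartz[OF \<Psi>], where 'a='a]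
  have "\<exists>C>0. \<forall>x. (1 + norm x) ^ M * norm (?k x) \<le> C" for M
    using schwartz_bounded[OF k] by metis
  then obtain C where C: "\<And>M. C M > 0" "\<And>M x. (1 + norm x) ^ M * norm (?k x) \<le> C M" by metis
  have kern_le: "norm (kern (cPsi \<Psi> (Suc j)) z) \<le> 2 ^ DIM('a) * C M * weight (2 ^ j) M z" for j M and z :: 'a
  proof -
    let ?r = "2 ^ Suc j :: real"
    have pos: "0 < 1 + 2 ^ j * norm z" by (simp add: add_pos_nonneg)
    have "(1 + 2 ^ j * norm z) ^ M * norm (?k (?r *\<^sub>R z)) \<le> (1 + norm (?r *\<^sub>R z)) ^ M * norm (?k (?r *\<^sub>R z))"
      using pos by (intro mult_right_mono power_mono) (auto simp: mult_right_mono less_imp_le)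
    also have "\<dots> \<le> C M" by (rule C)
    finally have "norm (?k (?r *\<^sub>R z)) \<le> C M / (1 + 2 ^ j * norm z) ^ M"
      using pos by (simp add: pos_le_divide_eq mult.commute)
    then have "?r ^ DIM('a) * norm (?k (?r *\<^sub>R z)) \<le> ?r ^ DIM('a) * (C M / (1 + 2 ^ j * norm z) ^ M)"
      by (rule mult_left_mono) simp
    moreover have "norm (kern (cPsi \<Psi> (Suc j)) z) = ?r ^ DIM('a) * norm (?k (?r *\<^sub>R z))"
      unfolding kern_Psi_scale[OF \<Psi>, of "Suc j"] norm_mult norm_of_real by simp
    ultimately show ?thesis by (simp add: weight_def power_mult_distrib ac_simps)
  qed
  show ?thesis
  proof (rule that[of "\<lambda>M. 2 ^ DIM('a) * C M"])
    fix j M and x :: 'a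
    let ?g = "lp_fun \<Psi> j u"
    note [measurable] = lp_fun_measurable[OF \<Psi> u] rapid_measurable[OF schwartz_rapid[OF kern_schwartz[OF Psi_schwartz[OF \<Psi>]]]]
    have "complex_of_real (Phi \<Psi> j \<xi>) * complex_of_real (Psi \<Psi> (Suc j) \<xi>) = complex_of_real (Phi \<Psi> j \<xi>)" for \<xi> :: 'a
      using Psi_mult_Phi[OF \<Psi>, of j \<xi>] by (simp only: of_real_mult[symmetric] mult.commute)
    from pair_translate_reproducing[OF u Phi_schwartz[OF \<Psi>] Psi_schwartz[OF \<Psi>] this, of "- x"]
    have g: "?g x = (LINT w|lborel. kern (cPsi \<Psi> (Suc j)) (w + - x) * ?g w)"
      by (simp add: lp_fun_eq[OF \<Psi> u])
    have int: "integrable lborel (\<lambda>w. kern (cPsi \<Psi> (Suc j)) (w + - x) * ?g w)"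
      unfolding lp_fun_eq[OF \<Psi> u]
      by (rule pair_translate_integrable[OF u schwartz_rapid[OF schwartz_translate[OF kern_schwartz[OF Psi_schwartz[OF \<Psi>]]]]
            kern_schwartz[OF Phi_schwartz[OF \<Psi>]] linear_growth_uminus])
    have "ennreal (norm (?g x)) \<le> (\<integral>\<^sup>+w. norm (kern (cPsi \<Psi> (Suc j)) (w + - x) * ?g w) \<partial>lborel)"
      unfolding g by (rule integral_norm_bound_ennreal[OF int])
    also have "\<dots> \<le> (\<integral>\<^sup>+w. ennreal (2 ^ DIM('a) * C M) * ennreal (norm (?g w) * weight (2 ^ j) M (x - w)) \<partial>lborel)"
    proof (rule nn_integral_mono)
      fix w
      have "weight (2 ^ j) M (w + - x) = weight (2 ^ j) M (x - w)"
        by (simp add: weight_def norm_minus_commute)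
      then have "norm (kern (cPsi \<Psi> (Suc j)) (w + - x) * ?g w) \<le> (2 ^ DIM('a) * C M * weight (2 ^ j) M (x - w)) * norm (?g w)"
        unfolding norm_mult using kern_le[of j "w + - x" M] by (intro mult_right_mono) auto
      then show "ennreal (norm (kern (cPsi \<Psi> (Suc j)) (w + - x) * ?g w))
          \<le> ennreal (2 ^ DIM('a) * C M) * ennreal (norm (?g w) * weight (2 ^ j) M (x - w))"
        using C(1)[of M] by (simp add: ennreal_mult'[symmetric] less_imp_le ac_simps ennreal_leI)
    qed
    also have "\<dots> = ennreal (2 ^ DIM('a) * C M) * (\<integral>\<^sup>+w. ennreal (norm (?g w) * weight (2 ^ j) M (x - w)) \<partial>lborel)"
      by (rule nn_integral_cmult) measurable
    finally show "ennreal (norm (?g x))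
      \<le> ennreal (2 ^ DIM('a) * C M) * (\<integral>\<^sup>+y. ennreal (norm (?g y) * weight (2 ^ j) M (x - y)) \<partial>lborel)" .
  qed (use C in auto)
qed

section \<open>From the Besov norm to a summable majorant\<close>

lemma epow_less_top: "epow a r < \<infinity> \<longleftrightarrow> a < \<infinity>"
  by (simp add: epow_def less_top[symmetric])

lemma summable_geometric_powr:
  assumes "(e::real) < 0"
  shows "summable (\<lambda>j. 2 powr (e * real j))"
proof -
  have "2 powr (e * real j) = (2 powr e) ^ j" for j
    by (simp add: powr_powr[symmetric] powr_realpow)
  moreover have "2 powr e < 1" using assms powr_less_one[of 2 e] by simp
  ultimately show ?thesis by simp
qed

text \<open>For \<sigma> < s the terms weighted with s are bounded and the surplus gives a geometric
  series, whatever q is. For s = \<sigma> there is no surplus, and q \<le> 1 is used through the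
  inclusion of the q-summable sequences in the summable ones.\<close>

lemma besov_norm_finite_summable:
  assumes fin: "besov_norm \<Psi> s p q u < \<infinity>" and q: "q > 0" and \<sigma>: "\<sigma> \<le> s" "s = \<sigma> \<longrightarrow> q \<le> 1"
  obtains l where "\<And>k. Lp_norm p (lp_fun \<Psi> k u) = ennreal (l k)" "\<And>k. 0 \<le> l k"
    "summable (\<lambda>k. 2 powr (\<sigma> * real k) * l k)"
proof -
  note result = that
  let ?L = "\<lambda>k. Lp_norm p (lp_fun \<Psi> k u)"
  have split: "2 powr (\<sigma> * real k) * x = 2 powr ((\<sigma> - s) * real k) * (2 powr (s * real k) * x)" for k x
    by (simp add: mult.assoc[symmetric] powr_add[symmetric] algebra_simps)
  have bounded_case: thesis
    if l: "\<And>k. ?L k = ennreal (l k)" "\<And>k. 0 \<le> l k" and B: "\<And>k. 2 powr (s * real k) * l k \<le> B" and "\<sigma> < s" for l B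
  proof (rule result[OF l])
    have "summable (\<lambda>k. 2 powr ((\<sigma> - s) * real k) * B)"
      using \<open>\<sigma> < s\<close> by (intro summable_mult2 summable_geometric_powr) simp
    then show "summable (\<lambda>k. 2 powr (\<sigma> * real k) * l k)"
      using l(2) B by (rule_tac summable_comparison_test') (auto simp: abs_mult split[of _ "l _"] intro!: mult_left_mono)
  qed
  show thesis
  proof (cases q)
    case PInf
    \<comment> \<open>Equality would force q \<le> 1.\<close>
    then have "\<sigma> < s" using \<sigma> by (cases "s = \<sigma>") auto
    have A: "(SUP k. ennreal (2 powr (s * real k)) * ?L k) < \<infinity>" (is "?A < _")
      using fin PInf by (simp add: besov_norm_def)
    have le: "ennreal (2 powr (s * real k)) * ?L k \<le> ?A" for k by (rule SUP_upper) simp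
    have "?L k < \<infinity>" for k
      using le_less_trans[OF le[of k] A] by (auto simp: ennreal_mult_less_top)
    note L_fin = this
    define l where "l k = enn2real (?L k)" for k
    have l: "?L k = ennreal (l k)" "0 \<le> l k" for k using L_fin[of k] by (auto simp: l_def)
    have "2 powr (s * real k) * l k \<le> enn2real ?A" for k
    proof -
      have "ennreal (2 powr (s * real k) * l k) \<le> ?A" using le[of k] l by (simp add: ennreal_mult)
      from enn2real_mono[OF this] A show ?thesis using l(2)[of k] by simp
    qed
    then show thesis using bounded_case[OF l] \<open>\<sigma> < s\<close> by blast
  next
    case (real Q)
    then have Q: "Q > 0" using q by simp
    let ?b = "\<lambda>k. ennreal (2 powr (s * real k * Q)) * epow (?L k) Q"
    have sum_fin: "(\<Sum>k. ?b k) < \<infinity>"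
      using fin real by (simp add: besov_norm_def epow_less_top[unfolded infinity_ennreal_def])
    have b_fin: "?b k < \<infinity>" for k
      using sum_fin by (metis ennreal_suminf_lessD infinity_ennreal_def)
    have "epow (?L k) Q < \<infinity>" for k
      using b_fin[of k] by (cases "epow (?L k) Q = 0") (auto simp: ennreal_mult_less_top)
    then have "?L k < \<infinity>" for k by (simp add: epow_less_top[unfolded infinity_ennreal_def])
    note L_fin = this
    define l where "l k = enn2real (?L k)" for k
    have l: "?L k = ennreal (l k)" "0 \<le> l k" for k using L_fin[of k] by (auto simp: l_def)
    define x where "x k = 2 powr (s * real k) * l k" for k
    have x0: "0 \<le> x k" for k using l(2) by (simp add: x_def)
    have b: "?b k = ennreal (x k powr Q)" for k
      using l by (simp add: epow_def x_def powr_mult powr_powr ennreal_mult)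
    have sm: "summable (\<lambda>k. x k powr Q)"
      using sum_fin unfolding b by (intro summable_suminf_not_top) (auto simp: less_top)
    show thesis
    proof (cases "\<sigma> < s")
      case True
      have "x k \<le> (\<Sum>k. x k powr Q) powr (1 / Q)" for k
      proof -
        have "x k powr Q \<le> (\<Sum>k. x k powr Q)"
          using sum_le_suminf[OF sm, of "{k}"] by simp
        then have "(x k powr Q) powr (1 / Q) \<le> (\<Sum>k. x k powr Q) powr (1 / Q)"
          using Q by (intro powr_mono2) auto
        then show ?thesis using Q x0[of k] by (simp add: powr_powr)
      qed
      then show thesis unfolding x_def by (rule bounded_case[OF l _ True])
    next
      case False
      then have s: "s = \<sigma>" using \<sigma> by simp
      then have Q1: "Q \<le> 1" using \<sigma>(2) real by simp
      \<comment> \<open>Once a term is below 1, it is dominated by its Q-th power because Q \<le>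
        1.\<close>
      have "\<forall>\<^sub>F k in sequentially. x k powr Q < 1"
        using summable_LIMSEQ_zero[OF sm] by (rule order_tendstoD) simp
      then have "\<forall>\<^sub>F k in sequentially. norm (x k) \<le> x k powr Q"
      proof eventually_elim
        case (elim k)
        show ?case
        proof (cases "x k = 0")
          case False
          then have pos: "x k > 0" using x0[of k] by simp
          have "x k < 1"
          proof (rule ccontr)
            assume "\<not> x k < 1"
            then have "1 \<le> x k powr Q" using Q by (intro ge_one_powr_ge_zero) auto
            then show False using elim by simp
          qed
          then have "x k powr 1 \<le> x k powr Q" using pos Q1 by (intro powr_mono') auto
          then show ?thesis using pos by simp
        qed simp
      qed
      then have "summable x" by (rule summable_comparison_test_ev[OF _ sm])
      then show thesis using result[OF l] s by (simp add: x_def[abs_def])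
    qed
  qed (use q in simp)
qed

text \<open>Testing with a bounded function supported in K sees only the L_1 norm of the slice over
  K, which the slice estimate bounds with r = 2^j. The majorant c depends neither on t nor on
  \<phi>.\<close>

lemma lp_fun_slice_bound:
  fixes u :: "('a::euclidean_space \<times> real \<Rightarrow> complex) \<Rightarrow> complex"
  assumes \<Psi>: "cutoff \<Psi>" and u: "u \<in> besov \<Psi> s p q" and "p > 0" "q > 0"
    and s: "s \<ge> real_of_ereal (1 / p) + real DIM('a) * max (real_of_ereal (1 / p) - 1) 0"
    "s = real_of_ereal (1 / p) + real DIM('a) * max (real_of_ereal (1 / p) - 1) 0 \<longrightarrow> q \<le> 1"
    and K: "compact K"
  obtains c where "summable c" "\<And>j. 0 \<le> c j"
    "\<And>j t \<phi> F. \<phi> \<in> borel_measurable borel \<Longrightarrow> (\<And>x. x \<notin> K \<Longrightarrow> \<phi> x = 0) \<Longrightarrow> (\<And>x. norm (\<phi> x) \<le> F) \<Longrightarrow>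
      norm (LINT x|lborel. lp_fun \<Psi> j u (x, t) * \<phi> x) \<le> c j * F"
proof -
  let ?\<sigma> = "real_of_ereal (1 / p) + real DIM('a) * max (real_of_ereal (1 / p) - 1) 0"
  have ut: "u \<in> tempered" and fin: "besov_norm \<Psi> s p q u < \<infinity>" using u by (auto simp: besov_def)
  obtain l where l: "\<And>k. Lp_norm p (lp_fun \<Psi> k u) = ennreal (l k)" "\<And>k. 0 \<le> l k"
    "summable (\<lambda>k. 2 powr (?\<sigma> * real k) * l k)"
    using besov_norm_finite_summable[OF fin \<open>q > 0\<close> s] by blast
  obtain C where C: "\<And>M. C M > 0"
    "\<And>j M x. ennreal (norm (lp_fun \<Psi> j u x))
      \<le> ennreal (C M) * average (2 ^ j) M (\<lambda>y. norm (lp_fun \<Psi> j u y)) x"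
    using lp_fun_subaverage[OF \<Psi> ut] by blast
  obtain N where N: "\<And>j. \<exists>A. \<forall>x. norm (lp_fun \<Psi> j u x) \<le> A * (1 + norm x) ^ N"
    using lp_fun_growth[OF \<Psi> ut] by blast
  have Kb: "K \<in> sets borel" "emeasure lborel K < \<infinity>"
    using K emeasure_bounded_finite[OF compact_imp_bounded[OF K]] by (auto simp: borel_compact)
  obtain B where B: "B > 0"
    "\<And>(g :: 'a \<times> real \<Rightarrow> complex) r t. g \<in> borel_measurable borel \<Longrightarrow> r \<ge> 1 \<Longrightarrow>
      \<exists>A. \<forall>x. norm (g x) \<le> A * (1 + norm x) ^ N \<Longrightarrow>
      (\<And>M x. ennreal (norm (g x)) \<le> ennreal (C M) * average r M (\<lambda>y. norm (g y)) x) \<Longrightarrow>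
      (\<integral>\<^sup>+x. ennreal (norm (g (x, t))) * indicator K x \<partial>lborel) \<le> ennreal (B * r powr ?\<sigma>) * Lp_norm p g"
    using slice_estimate[where N=N and C=C, OF Kb \<open>p > 0\<close> C(1)] by blast
  note [measurable] = lp_fun_measurable[OF \<Psi> ut] Kb(1)
  define c where "c j = B * (2 powr (?\<sigma> * real j) * l j)" for j
  have c0: "0 \<le> c j" for j using B(1) l(2) by (simp add: c_def)
  have le: "(\<integral>\<^sup>+x. ennreal (norm (lp_fun \<Psi> j u (x, t))) * indicator K x \<partial>lborel) \<le> ennreal (c j)" for j t
  proof -
    have "(\<integral>\<^sup>+x. ennreal (norm (lp_fun \<Psi> j u (x, t))) * indicator K x \<partial>lborel)
        \<le> ennreal (B * (2 ^ j) powr ?\<sigma>) * Lp_norm p (lp_fun \<Psi> j u)"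
      by (rule B(2)[OF lp_fun_measurable[OF \<Psi> ut] _ N C(2)]) simp
    also have "(2 ^ j) powr ?\<sigma> = 2 powr (?\<sigma> * real j)"
      by (simp add: powr_realpow[symmetric] powr_powr mult.commute)
    finally show ?thesis using B(1) l by (simp add: c_def ennreal_mult[symmetric] mult.assoc)
  qed
  show ?thesis
  proof (rule that[of c])
    show "summable c" unfolding c_def[abs_def] by (rule summable_mult[OF l(3)])
    fix j t F and \<phi> :: "'a \<Rightarrow> complex"
    assume [measurable]: "\<phi> \<in> borel_measurable borel" and \<phi>: "\<And>x. x \<notin> K \<Longrightarrow> \<phi> x = 0" "\<And>x. norm (\<phi> x) \<le> F"
    have F: "0 \<le> F" using order_trans[OF norm_ge_zero \<phi>(2)] .
    have "(\<integral>\<^sup>+x. norm (lp_fun \<Psi> j u (x, t) * \<phi> x) \<partial>lborel)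
        \<le> (\<integral>\<^sup>+x. ennreal F * (ennreal (norm (lp_fun \<Psi> j u (x, t))) * indicator K x) \<partial>lborel)"
    proof (rule nn_integral_mono)
      fix x
      show "ennreal (norm (lp_fun \<Psi> j u (x, t) * \<phi> x)) \<le> ennreal F * (ennreal (norm (lp_fun \<Psi> j u (x, t))) * indicator K x)"
        using \<phi>(1)[of x] \<phi>(2)[of x] F
        by (cases "x \<in> K") (auto simp: norm_mult ennreal_mult'[symmetric] intro!: ennreal_leI,
              metis mult.commute mult_left_mono norm_ge_zero)
    qed
    also have "\<dots> = ennreal F * (\<integral>\<^sup>+x. ennreal (norm (lp_fun \<Psi> j u (x, t))) * indicator K x \<partial>lborel)"
      using Kb by (intro nn_integral_cmult) measurable
    also have "\<dots> \<le> ennreal F * ennreal (c j)" by (intro mult_left_mono le) simp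
    also have "\<dots> = ennreal (c j * F)" using F c0 by (simp add: ennreal_mult[symmetric] mult.commute)
    finally have nn: "(\<integral>\<^sup>+x. norm (lp_fun \<Psi> j u (x, t) * \<phi> x) \<partial>lborel) \<le> ennreal (c j * F)" .
    then have "integrable lborel (\<lambda>x. lp_fun \<Psi> j u (x, t) * \<phi> x)"
      by (intro integrableI_bounded) (auto simp: le_less_trans[OF _ ennreal_less_top])
    from order_trans[OF integral_norm_bound_ennreal[OF this] nn]
    show "norm (LINT x|lborel. lp_fun \<Psi> j u (x, t) * \<phi> x) \<le> c j * F"
      using F c0 by (simp add: ennreal_le_iff)
  qed (rule c0)
qed

section \<open>Distributions and curves of distributions\<close>

lemma test_functions_on_D:
  assumes "\<phi> \<in> test_functions_on K" "compact K"
  shows "\<phi> \<in> test_functions" "\<phi> \<in> borel_measurable borel" "bdd_above (range (\<lambda>x. norm (\<phi> x)))"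
proof -
  show "\<phi> \<in> test_functions" using assms by (auto simp: test_functions_def)
  then have "\<phi> \<in> schwartz" by (rule test_function_schwartz)
  then show "\<phi> \<in> borel_measurable borel" "bdd_above (range (\<lambda>x. norm (\<phi> x)))"
    using schwartz_bounded[of \<phi> 0] by (auto simp: bdd_above_def intro: smooth_measurable schwartz_smooth)
qed

lemma test_functions_add:
  assumes "\<phi> \<in> test_functions" "\<psi> \<in> test_functions"
  shows "(\<lambda>x. \<phi> x + \<psi> x) \<in> test_functions"
proof -
  obtain K L where K: "compact K" "\<phi> \<in> test_functions_on K" and L: "compact L" "\<psi> \<in> test_functions_on L"
    using assms by (auto simp: test_functions_def)
  then have "(\<lambda>x. \<phi> x + \<psi> x) \<in> test_functions_on (K \<union> L)"
    by (auto simp: test_functions_on_def intro: smooth_add)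
  then show ?thesis using compact_Un[OF K(1) L(1)] by (auto simp: test_functions_def)
qed

lemma test_functions_cmult:
  assumes "\<phi> \<in> test_functions"
  shows "(\<lambda>x. c * \<phi> x) \<in> test_functions"
  using assms by (auto simp: test_functions_def test_functions_on_def intro: smooth_cmult)

text \<open>All distributions constructed here have order 0, so a bound by the supremum norm is
  enough; \<open>multi_indices 0\<close> contains the empty list only.\<close>

lemma distributionsI:
  assumes lin: "linear_functional_on test_functions \<Lambda>"
    and bound: "\<And>K. compact K \<Longrightarrow> \<exists>C\<ge>0. \<forall>\<phi>\<in>test_functions_on K. \<forall>F. (\<forall>x. norm (\<phi> x) \<le> F) \<longrightarrow> norm (\<Lambda> \<phi>) \<le> C * F"
  shows "restrict \<Lambda> test_functions \<in> distributions"
  unfolding distributions_def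
proof (intro CollectI conjI allI impI)
  show "linear_functional_on test_functions (restrict \<Lambda> test_functions)"
    using lin by (simp add: linear_functional_on_def test_functions_add test_functions_cmult)
  fix K :: "'a set" assume K: "compact K"
  obtain C where C: "\<And>\<phi> F. \<phi> \<in> test_functions_on K \<Longrightarrow> (\<And>x. norm (\<phi> x) \<le> F) \<Longrightarrow> norm (\<Lambda> \<phi>) \<le> C * F"
    using bound[OF K] by blast
  have "norm (restrict \<Lambda> test_functions \<phi>) \<le> C * (\<Sum>vs\<in>multi_indices 0. SUP x. norm (pderivs vs \<phi> x))"
    if \<phi>: "\<phi> \<in> test_functions_on K" for \<phi>
  proof -
    have "norm (\<Lambda> \<phi>) \<le> C * (SUP x. norm (\<phi> x))"
      by (rule C[OF \<phi> cSUP_upper[OF UNIV_I test_functions_on_D(3)[OF \<phi> K]]])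
    moreover have "multi_indices 0 = {[] :: 'a list}" by (auto simp: multi_indices_def)
    ultimately show ?thesis using test_functions_on_D(1)[OF \<phi> K] by simp
  qed
  then show "\<exists>C N. \<forall>\<phi>\<in>test_functions_on K. norm (restrict \<Lambda> test_functions \<phi>)
      \<le> C * (\<Sum>vs\<in>multi_indices N. SUP x. norm (pderivs vs \<phi> x))" by blast
qed simp

text \<open>For a single block the polynomial growth is uniform for t in a bounded interval, so the
  decay of \<phi> gives integrability and a dominating function for continuity in t. The dependence
  on j is harmless at this point.\<close>

lemma slice_integrable:
  fixes g :: "'a::euclidean_space \<times> real \<Rightarrow> complex"
  assumes g: "continuous_on UNIV g" and growth: "\<And>x. norm (g x) \<le> A * (1 + norm x) ^ N" and \<phi>: "rapid \<phi>"
  shows "integrable lborel (\<lambda>x. g (x, t) * \<phi> x)"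
    and "continuous_on UNIV (\<lambda>t. LINT x|lborel. g (x, t) * \<phi> x)"
proof -
  note [measurable] = borel_measurable_continuous_onI[OF g] rapid_measurable[OF \<phi>]
  have A0: "0 \<le> A" using order_trans[OF norm_ge_zero growth[of 0]] by simp
  have le: "norm (g (x, t)) \<le> A * (1 + T) ^ N * (1 + norm x) ^ N" if "\<bar>t\<bar> \<le> T" for x t T
  proof -
    have "norm (x, t) \<le> norm x + \<bar>t\<bar>" using norm_Pair_le[of x t] by simp
    moreover have "0 \<le> T * norm x" using that by (intro mult_nonneg_nonneg) auto
    moreover have "(1 + T) * (1 + norm x) = 1 + T + norm x + T * norm x" by (simp add: algebra_simps)
    ultimately have "1 + norm (x, t) \<le> (1 + T) * (1 + norm x)"
      using that by linarith
    then have "(1 + norm (x, t)) ^ N \<le> ((1 + T) * (1 + norm x)) ^ N" by (intro power_mono) auto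
    from mult_left_mono[OF this A0] show ?thesis
      using growth[of "(x, t)"] by (simp add: power_mult_distrib mult.assoc)
  qed
  have int: "integrable lborel (\<lambda>x. \<phi> x * g (x, t))" for t
    by (rule rapid_integrable_mult[OF \<phi>]) (measurable, rule le[OF order_refl])
  then show "integrable lborel (\<lambda>x. g (x, t) * \<phi> x)" by (simp add: mult.commute)
  have "isCont (\<lambda>t. LINT x|lborel. g (x, t) * \<phi> x) t" for t
    unfolding continuous_at_sequentially comp_def
  proof (intro allI impI)
    fix X assume X: "X \<longlonglongrightarrow> t"
    then obtain T where T: "\<And>i. \<bar>X i\<bar> \<le> T"
      using convergent_imp_Bseq[of X] by (auto simp: convergent_def Bseq_def)
    show "(\<lambda>i. LINT x|lborel. g (x, X i) * \<phi> x) \<longlonglongrightarrow> (LINT x|lborel. g (x, t) * \<phi> x)"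
    proof (rule integral_dominated_convergence[where w="\<lambda>x. A * (1 + T) ^ N * (norm (\<phi> x) * (1 + 1 * norm x) ^ N)"])
      show "integrable lborel (\<lambda>x. A * (1 + T) ^ N * (norm (\<phi> x) * (1 + 1 * norm x) ^ N))"
        by (intro integrable_mult_right rapid_integrable_norm_mult[OF \<phi>])
      show "AE x in lborel. (\<lambda>i. g (x, X i) * \<phi> x) \<longlonglongrightarrow> g (x, t) * \<phi> x"
      proof (intro AE_I2 tendsto_mult tendsto_const)
        fix x
        have "isCont g (x, t)" using g by (simp add: continuous_on_eq_continuous_at)
        moreover have "(\<lambda>i. (x, X i)) \<longlonglongrightarrow> (x, t)" by (intro tendsto_intros X)
        ultimately show "(\<lambda>i. g (x, X i)) \<longlonglongrightarrow> g (x, t)" by (rule isCont_tendsto_compose)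
      qed
      show "AE x in lborel. norm (g (x, X i) * \<phi> x) \<le> A * (1 + T) ^ N * (norm (\<phi> x) * (1 + 1 * norm x) ^ N)" for i
      proof (rule AE_I2)
        fix x
        from mult_right_mono[OF le[OF T[of i]] norm_ge_zero, of x "\<phi> x"]
        show "norm (g (x, X i) * \<phi> x) \<le> A * (1 + T) ^ N * (norm (\<phi> x) * (1 + 1 * norm x) ^ N)"
          by (simp add: norm_mult ac_simps)
      qed
    qed measurable
  qed
  then show "continuous_on UNIV (\<lambda>t. LINT x|lborel. g (x, t) * \<phi> x)"
    by (simp add: continuous_at_imp_continuous_on)
qed

lemma test_functions_slice:
  fixes \<phi> :: "'a::euclidean_space \<times> real \<Rightarrow> complex"
  assumes "\<phi> \<in> test_functions_on K" "compact K"
  shows "(\<lambda>x. \<phi> (x, t)) \<in> test_functions_on (fst ` K)"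
proof -
  have "smooth (\<lambda>x. \<phi> ((x, 0) + (0, t)))"
    using assms(1) by (intro smooth_affine_comp[of \<phi> "\<lambda>x. (x, 0)"])
      (auto simp: test_functions_on_def intro!: bounded_linear_Pair bounded_linear_ident bounded_linear_zero)
  moreover have "\<phi> (x, t) = 0" if "x \<notin> fst ` K" for x
  proof -
    have "(x, t) \<notin> K" using that by force
    then show ?thesis using assms(1) by (simp add: test_functions_on_def)
  qed
  ultimately show ?thesis by (auto simp: test_functions_on_def)
qed

lemma test_functions_tensor:
  fixes \<phi> :: "'a::euclidean_space \<Rightarrow> complex" and \<eta> :: "real \<Rightarrow> complex"
  assumes "\<phi> \<in> test_functions" "\<eta> \<in> test_functions"
  shows "(\<lambda>(x, t). \<phi> x * \<eta> t) \<in> test_functions"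
proof -
  obtain K L where K: "compact K" "\<phi> \<in> test_functions_on K" and L: "compact L" "\<eta> \<in> test_functions_on L"
    using assms by (auto simp: test_functions_def)
  have "smooth (\<lambda>z::'a \<times> real. \<phi> (fst z + 0) * \<eta> (snd z + 0))"
    using K L by (intro smooth_mult smooth_affine_comp[OF _ bounded_linear_fst] smooth_affine_comp[OF _ bounded_linear_snd])
      (auto simp: test_functions_on_def)
  then have "(\<lambda>(x, t). \<phi> x * \<eta> t) \<in> test_functions_on (K \<times> L)"
    using K L by (auto simp: test_functions_on_def case_prod_unfold)
  then show ?thesis using compact_Times[OF K(1) L(1)] by (auto simp: test_functions_def)
qed

lemma continuous_curvesD:
  assumes "f \<in> continuous_curves"
  shows "f t \<in> distributions" "\<phi> \<in> test_functions \<Longrightarrow> continuous_on UNIV (\<lambda>t. f t \<phi>)"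
proof -
  have *: "continuous_map euclideanreal (product_topology (\<lambda>_. euclidean) test_functions) f"
    "f ` UNIV \<subseteq> distributions"
    using assms by (auto simp: continuous_curves_def distr_topology_def continuous_map_in_subtopology)
  then show "f t \<in> distributions" by auto
  show "continuous_on UNIV (\<lambda>t. f t \<phi>)" if "\<phi> \<in> test_functions"
    using * that by (auto simp: continuous_map_componentwise)
qed

lemma continuous_curvesI:
  assumes "\<And>t. f t \<in> distributions" "\<And>\<phi>. \<phi> \<in> test_functions \<Longrightarrow> continuous_on UNIV (\<lambda>t. f t \<phi>)"
  shows "f \<in> continuous_curves"
proof -
  \<comment> \<open>Continuity into a product topology includes that the values are extensional
    functions.\<close>
  have "f ` UNIV \<subseteq> extensional test_functions" using assms(1) by (auto simp: distributions_def)
  then show ?thesis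
    using assms
    by (auto simp: continuous_curves_def distr_topology_def continuous_map_in_subtopology continuous_map_componentwise)
qed

lemma distr_of_curve_inject:
  fixes f g :: "real \<Rightarrow> ('a::euclidean_space \<Rightarrow> complex) \<Rightarrow> complex"
  assumes \<Psi>: "cutoff \<Psi>" and f: "f \<in> continuous_curves" and g: "g \<in> continuous_curves"
    and eq: "distr_of_curve f = distr_of_curve g"
  shows "f = g"
proof
  fix t
  have tensor: "distr_of_curve f (\<lambda>(x, t). \<phi> x * \<eta> t) = (LINT t|lborel. f t \<phi> * \<eta> t)"
    if f: "f \<in> continuous_curves" and \<phi>: "\<phi> \<in> test_functions" and \<eta>: "\<eta> \<in> test_functions"
    for f :: "real \<Rightarrow> ('a \<Rightarrow> complex) \<Rightarrow> complex" and \<phi> \<eta>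
  proof -
    have "f t (\<lambda>x. \<phi> x * \<eta> t) = f t \<phi> * \<eta> t" for t
    proof -
      have "f t (\<lambda>x. \<eta> t * \<phi> x) = \<eta> t * f t \<phi>"
        using continuous_curvesD(1)[OF f, of t] \<phi> by (simp add: distributions_def linear_functional_on_def)
      then show ?thesis by (simp add: mult.commute)
    qed
    then show ?thesis using test_functions_tensor[OF \<phi> \<eta>] by (simp add: distr_of_curve_def)
  qed
  have "(\<lambda>t. f t \<phi>) = (\<lambda>t. g t \<phi>)" if \<phi>: "\<phi> \<in> test_functions" for \<phi>
  proof (rule continuous_eq_if_eq_on_test_functions[OF \<Psi> continuous_curvesD(2)[OF f \<phi>] continuous_curvesD(2)[OF g \<phi>]])
    fix \<eta> :: "real \<Rightarrow> complex" assume \<eta>: "\<eta> \<in> test_functions"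
    show "(LINT t|lborel. f t \<phi> * \<eta> t) = (LINT t|lborel. g t \<phi> * \<eta> t)"
      using tensor[OF f \<phi> \<eta>] tensor[OF g \<phi> \<eta>] eq by simp
  qed
  then have "f t \<phi> = g t \<phi>" if "\<phi> \<in> test_functions" for \<phi> using that by (metis (no_types, lifting))
  moreover have "f t \<in> extensional test_functions" "g t \<in> extensional test_functions"
    using continuous_curvesD(1)[OF f] continuous_curvesD(1)[OF g] by (auto simp: distributions_def)
  ultimately show "f t = g t" by (intro extensionalityI)
qed

section \<open>The sum of the blocks as a curve of distributions\<close>

definition lp_curve :: "(real \<Rightarrow> real) \<Rightarrow> (('a::euclidean_space \<times> real \<Rightarrow> complex) \<Rightarrow> complex) \<Rightarrow>
    real \<Rightarrow> ('a \<Rightarrow> complex) \<Rightarrow> complex" where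
  "lp_curve \<Psi> u t = (\<lambda>\<phi>\<in>test_functions. \<Sum>j. LINT x|lborel. lp_fun \<Psi> j u (x, t) * \<phi> x)"

text \<open>One summable majorant, uniform in t, serves all three claims: it gives continuity by
  uniform convergence, the interchange of the sum with integration in t, and the convergence of the
  series at t = 0.\<close>

lemma lp_curve_trace:
  fixes u :: "('a::euclidean_space \<times> real \<Rightarrow> complex) \<Rightarrow> complex"
  assumes \<Psi>: "cutoff \<Psi>" and u: "u \<in> besov \<Psi> s p q" and pq: "p > 0" "q > 0"
    and s: "s \<ge> real_of_ereal (1 / p) + real DIM('a) * max (real_of_ereal (1 / p) - 1) 0"
    "s = real_of_ereal (1 / p) + real DIM('a) * max (real_of_ereal (1 / p) - 1) 0 \<longrightarrow> q \<le> 1"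
  shows "lp_curve \<Psi> u \<in> continuous_curves"
    and "distr_of_curve (lp_curve \<Psi> u) = distr_of_tempered u"
    and "has_working_trace \<Psi> u (lp_curve \<Psi> u 0)"
proof -
  let ?g = "\<lambda>j. lp_fun \<Psi> j u"
  let ?h = "\<lambda>j t \<phi>. LINT x|lborel. ?g j (x, t) * \<phi> x"
  have ut: "u \<in> tempered" using u by (simp add: besov_def)
  obtain N where N: "\<And>j. \<exists>A. \<forall>x. norm (?g j x) \<le> A * (1 + norm x) ^ N"
    using lp_fun_growth[OF \<Psi> ut] by blast
  then obtain A where A: "\<And>j x. norm (?g j x) \<le> A j * (1 + norm x) ^ N" by metis
  note [measurable] = lp_fun_measurable[OF \<Psi> ut]
  note si = slice_integrable[OF lp_fun_continuous[OF \<Psi> ut] A]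
  have rap: "rapid \<phi>" if "\<phi> \<in> test_functions" for \<phi> :: "'b::euclidean_space \<Rightarrow> complex"
    by (rule schwartz_rapid[OF test_function_schwartz[OF that]])
  \<comment> \<open>The sequence c depends on K alone: that the sum is a distribution needs
    uniformity in \<phi>, and its pairing with a function of (x, t) needs a majorant for all its
    slices at once.\<close>
  have majorant: "\<exists>c. summable c \<and> (\<forall>j. 0 \<le> c j) \<and> (\<forall>j t. \<forall>\<phi>\<in>test_functions_on K. \<forall>F. (\<forall>x. norm (\<phi> x) \<le> F) \<longrightarrow> norm (?h j t \<phi>) \<le> c j * F)"
    if K: "compact K" for K
  proof -
    show ?thesis
    proof (rule lp_fun_slice_bound[OF \<Psi> u pq s K])
      fix c assume c: "summable c" "\<And>j. 0 \<le> c j"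
        "\<And>j t \<phi> F. \<phi> \<in> borel_measurable borel \<Longrightarrow> (\<And>x. x \<notin> K \<Longrightarrow> \<phi> x = 0) \<Longrightarrow> (\<And>x. norm (\<phi> x) \<le> F) \<Longrightarrow>
          norm (?h j t \<phi>) \<le> c j * F"
      show ?thesis
    proof (intro exI[of _ c] conjI allI ballI impI c(1,2))
      fix j t \<phi> F assume \<phi>: "\<phi> \<in> test_functions_on K" and F: "\<forall>x. norm (\<phi> x) \<le> F"
      show "norm (?h j t \<phi>) \<le> c j * F"
        by (rule c(3)[OF test_functions_on_D(2)[OF \<phi> K]]) (use \<phi> F in \<open>auto simp: test_functions_on_def\<close>)
      qed
    qed
  qed
  have majorant1: "\<exists>c. summable c \<and> (\<forall>j t. norm (?h j t \<phi>) \<le> c j)" if \<phi>: "\<phi> \<in> test_functions" for \<phi>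
  proof -
    obtain K where K: "compact K" "\<phi> \<in> test_functions_on K" using \<phi> by (auto simp: test_functions_def)
    obtain F where F: "\<forall>x. norm (\<phi> x) \<le> F" using test_functions_on_D(3)[OF K(2,1)] by (auto simp: bdd_above_def)
    obtain c where c: "summable c" "\<forall>j t. \<forall>\<phi>\<in>test_functions_on K. \<forall>F. (\<forall>x. norm (\<phi> x) \<le> F) \<longrightarrow> norm (?h j t \<phi>) \<le> c j * F"
      using majorant[OF K(1)] by blast
    show ?thesis using c K(2) F by (intro exI[of _ "\<lambda>j. c j * F"]) (auto intro: summable_mult2)
  qed
  have summ: "summable (\<lambda>j. ?h j t \<phi>)" if "\<phi> \<in> test_functions" for \<phi> t
    using majorant1[OF that] by (blast intro: summable_comparison_test')
  have lin: "?h j t (\<lambda>x. \<phi> x + \<psi> x) = ?h j t \<phi> + ?h j t \<psi>" "?h j t (\<lambda>x. c * \<phi> x) = c * ?h j t \<phi>"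
    if "\<phi> \<in> test_functions" "\<psi> \<in> test_functions" for j t \<phi> \<psi> c
  proof -
    show "?h j t (\<lambda>x. \<phi> x + \<psi> x) = ?h j t \<phi> + ?h j t \<psi>"
      using si(1)[OF rap[OF that(1)]] si(1)[OF rap[OF that(2)]] by (simp add: distrib_left)
    show "?h j t (\<lambda>x. c * \<phi> x) = c * ?h j t \<phi>"
      unfolding integral_mult_right_zero[symmetric] by (simp only: ac_simps)
  qed
  have curve_distr: "lp_curve \<Psi> u t \<in> distributions" for t
    unfolding lp_curve_def
  proof (rule distributionsI)
    show "linear_functional_on test_functions (\<lambda>\<phi>. \<Sum>j. ?h j t \<phi>)"
      using summ by (auto simp: linear_functional_on_def lin suminf_add suminf_mult)
    fix K :: "'a set" assume K: "compact K"
    obtain c where c: "summable c" "\<forall>j. 0 \<le> c j" "\<forall>j t. \<forall>\<phi>\<in>test_functions_on K. \<forall>F. (\<forall>x. norm (\<phi> x) \<le> F) \<longrightarrow> norm (?h j t \<phi>) \<le> c j * F"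
      using majorant[OF K] by blast
    have "norm (\<Sum>j. ?h j t \<phi>) \<le> suminf c * F" if \<phi>: "\<phi> \<in> test_functions_on K" and F: "\<forall>x. norm (\<phi> x) \<le> F" for \<phi> F
    proof -
      have le: "norm (?h j t \<phi>) \<le> c j * F" for j using c(3) \<phi> F by blast
      have "norm (\<Sum>j. ?h j t \<phi>) \<le> (\<Sum>j. c j * F)"
        by (rule norm_suminf_le[OF le summable_mult2[OF c(1)]])
      then show ?thesis by (simp add: suminf_mult2[OF c(1)])
    qed
    then show "\<exists>C\<ge>0. \<forall>\<phi>\<in>test_functions_on K. \<forall>F. (\<forall>x. norm (\<phi> x) \<le> F) \<longrightarrow> norm (\<Sum>j. ?h j t \<phi>) \<le> C * F"
      using suminf_nonneg[OF c(1)] c(2) by blast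
  qed
  show curve: "lp_curve \<Psi> u \<in> continuous_curves"
  proof (rule continuous_curvesI[OF curve_distr])
    fix \<phi> :: "'a \<Rightarrow> complex" assume \<phi>: "\<phi> \<in> test_functions"
    obtain c where c: "summable c" "\<forall>j t. norm (?h j t \<phi>) \<le> c j" using majorant1[OF \<phi>] by blast
    have "uniform_limit UNIV (\<lambda>n t. \<Sum>j<n. ?h j t \<phi>) (\<lambda>t. \<Sum>j. ?h j t \<phi>) sequentially"
      by (rule Weierstrass_m_test[OF _ c(1)]) (use c(2) in auto)
    moreover have "\<forall>\<^sub>F n in sequentially. continuous_on UNIV (\<lambda>t. \<Sum>j<n. ?h j t \<phi>)"
      by (intro always_eventually allI continuous_on_sum si(2) rap \<phi>)
    ultimately have "continuous_on UNIV (\<lambda>t. \<Sum>j. ?h j t \<phi>)"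
      by (intro uniform_limit_theorem[of _ "\<lambda>n t. \<Sum>j<n. ?h j t \<phi>"]) auto
    then show "continuous_on UNIV (\<lambda>t. lp_curve \<Psi> u t \<phi>)" using \<phi> by (simp add: lp_curve_def)
  qed
  show "distr_of_curve (lp_curve \<Psi> u) = distr_of_tempered u"
    unfolding distr_of_curve_def distr_of_tempered_def
  proof (rule restrict_ext)
    fix \<phi> :: "'a \<times> real \<Rightarrow> complex" assume \<phi>: "\<phi> \<in> test_functions"
    then obtain K where K: "compact K" "\<phi> \<in> test_functions_on K" by (auto simp: test_functions_def)
    obtain F where F: "\<And>x. norm (\<phi> x) \<le> F" using test_functions_on_D(3)[OF K(2,1)] by (auto simp: bdd_above_def)
    have F0: "0 \<le> F" using order_trans[OF norm_ge_zero F] .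
    obtain R where R: "\<And>x. x \<in> K \<Longrightarrow> norm x \<le> R" using compact_imp_bounded[OF K(1)] by (auto simp: bounded_iff)
    \<comment> \<open>All slices of \<phi> are supported in this one compact set, so a single
      majorant works for every t.\<close>
    have fK: "compact (fst ` K)" by (intro compact_continuous_image K continuous_intros)
    note sl = test_functions_slice[OF K(2,1)]
    note [measurable] = test_functions_on_D(2)[OF K(2,1)]
    obtain c where c: "summable c" "\<forall>j. 0 \<le> c j" "\<forall>j t. \<forall>\<phi>\<in>test_functions_on (fst ` K). \<forall>F. (\<forall>x. norm (\<phi> x) \<le> F) \<longrightarrow> norm (?h j t \<phi>) \<le> c j * F"
      using majorant[OF fK] by blast
    define H where "H j t = ?h j t (\<lambda>x. \<phi> (x, t))" for j t
    have [measurable]: "H j \<in> borel_measurable lborel" for j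
      unfolding H_def by measurable
    \<comment> \<open>The indicator supplies integrability in t: outside the interval the slice of
      \<phi> vanishes.\<close>
    have H_le: "norm (H j t) \<le> c j * (F * indicator {-R..R} t)" for j t
    proof (cases "t \<in> {-R..R}")
      case True
      have "norm (H j t) \<le> c j * F" unfolding H_def by (rule c(3)[rule_format, OF sl]) (rule F)
      then show ?thesis using True by simp
    next
      case False
      have "(x, t) \<notin> K" for x
      proof
        assume "(x, t) \<in> K"
        then have "\<bar>t\<bar> \<le> R" using R[of "(x, t)"] norm_snd_le[of t x] by simp
        then show False using False by auto
      qed
      then have "\<phi> (x, t) = 0" for x using K(2) by (simp add: test_functions_on_def)
      then show ?thesis using False by (simp add: H_def)
    qed
    have ind: "integrable lborel (\<lambda>t. a * (F * indicator {-R..R} t))" for a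
      by (intro integrable_mult_right integrable_real_indicator)
         (use emeasure_bounded_finite[OF bounded_closed_interval[of "-R" R]] in auto)
    have H_int: "integrable lborel (H j)" for j
      by (rule Bochner_Integration.integrable_bound[OF ind[of "c j"]])
         (use H_le c(2) F0 in \<open>auto simp: abs_mult\<close>)
    have lp: "(LINT t|lborel. H j t) = lp_block \<Psi> j u \<phi>" for j
    proof -
      \<comment> \<open>For a single block Fubini's theorem applies directly and returns the pairing
        of the block with \<phi>; these pairings sum to u \<phi> by
        \<open>lp_block_sums\<close>.\<close>
      have "integrable lborel (\<lambda>z. \<phi> z * ?g j z)"
        by (rule rapid_integrable_mult[OF rap[OF \<phi>] _ A]) measurable
      then have int: "integrable (lborel \<Otimes>\<^sub>M lborel) (\<lambda>(x, t). ?g j (x, t) * \<phi> (x, t))"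
        by (simp add: lborel_prod case_prod_unfold mult.commute)
      have "(LINT t|lborel. H j t) = integral\<^sup>L (lborel \<Otimes>\<^sub>M lborel) (\<lambda>(x, t). ?g j (x, t) * \<phi> (x, t))"
        unfolding H_def by (rule lborel_pair.integral_snd[OF int])
      also have "\<dots> = (LINT z|lborel. ?g j z * \<phi> z)" by (simp add: lborel_prod case_prod_unfold)
      also have "\<dots> = lp_block \<Psi> j u \<phi>"
        unfolding lp_fun_eq[OF \<Psi> ut] by (rule lp_block_eq_integral[OF \<Psi> ut test_function_schwartz[OF \<phi>], symmetric])
      finally show ?thesis .
    qed
    have "(LINT t|lborel. (\<Sum>j. H j t)) = (\<Sum>j. LINT t|lborel. H j t)"
    proof (rule integral_suminf[OF H_int])
      show "AE t in lborel. summable (\<lambda>j. norm (H j t))"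
      proof (rule AE_I2)
        fix t
        show "summable (\<lambda>j. norm (H j t))"
          by (rule summable_comparison_test'[OF summable_mult2[OF c(1), of "F * indicator {-R..R} t"]]) (use H_le in auto)
      qed
      show "summable (\<lambda>j. LINT t|lborel. norm (H j t))"
      proof (rule summable_comparison_test'[OF summable_mult2[OF c(1)]])
        fix j
        have "(LINT t|lborel. norm (H j t)) \<le> (LINT t|lborel. c j * (F * indicator {-R..R} t))"
          by (rule integral_mono[OF integrable_norm[OF H_int] ind H_le])
        then show "norm (LINT t|lborel. norm (H j t)) \<le> c j * (LINT t|lborel. F * indicator {-R..R} t)"
          by simp
      qed
    qed
    also have "\<dots> = u \<phi>"
      unfolding lp by (rule sums_unique[OF lp_block_sums[OF \<Psi> ut test_function_schwartz[OF \<phi>]], symmetric])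
    finally show "(LINT t|lborel. lp_curve \<Psi> u t (\<lambda>x. \<phi> (x, t))) = u \<phi>"
      unfolding lp_curve_def H_def using test_functions_on_D(1)[OF sl fK] by simp
  qed
  show "has_working_trace \<Psi> u (lp_curve \<Psi> u 0)"
  proof -
    let ?P = "\<lambda>n. \<lambda>\<phi>\<in>test_functions. \<Sum>j<n. distr_of_fun (\<lambda>x'. ?g j (x', 0)) \<phi>"
    have P: "?P n = (\<lambda>\<phi>\<in>test_functions. \<Sum>j<n. ?h j 0 \<phi>)" for n
      by (intro restrict_ext sum.cong) (auto simp: distr_of_fun_def)
    \<comment> \<open>\<open>distr_topology\<close> is a subspace topology, so convergence in it
      includes that the partial sums and the limit are distributions.\<close>
    have Pd: "?P n \<in> distributions" for n
      unfolding P
    proof (rule distributionsI)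
      show "linear_functional_on test_functions (\<lambda>\<phi>. \<Sum>j<n. ?h j 0 \<phi>)"
        by (auto simp: linear_functional_on_def lin sum.distrib sum_distrib_left)
      fix K :: "'a set" assume K: "compact K"
      obtain c where c: "\<forall>j. 0 \<le> c j" "\<forall>j t. \<forall>\<phi>\<in>test_functions_on K. \<forall>F. (\<forall>x. norm (\<phi> x) \<le> F) \<longrightarrow> norm (?h j t \<phi>) \<le> c j * F"
        using majorant[OF K] by blast
      have "norm (\<Sum>j<n. ?h j 0 \<phi>) \<le> (\<Sum>j<n. c j) * F" if "\<phi> \<in> test_functions_on K" "\<forall>x. norm (\<phi> x) \<le> F" for \<phi> F
        unfolding sum_distrib_right using c(2) that by (intro sum_norm_le) blast
      then show "\<exists>C\<ge>0. \<forall>\<phi>\<in>test_functions_on K. \<forall>F. (\<forall>x. norm (\<phi> x) \<le> F) \<longrightarrow> norm (\<Sum>j<n. ?h j 0 \<phi>) \<le> C * F"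
        using c(1) by (intro exI[of _ "\<Sum>j<n. c j"]) (auto intro: sum_nonneg)
    qed
    have "limitin (product_topology (\<lambda>_. euclidean) test_functions) ?P (lp_curve \<Psi> u 0) sequentially"
      unfolding limitin_componentwise
    proof (intro conjI ballI)
      show "lp_curve \<Psi> u 0 \<in> extensional test_functions" by (simp add: lp_curve_def)
      show "\<forall>\<^sub>F n in sequentially. ?P n \<in> topspace (product_topology (\<lambda>_. euclidean) test_functions)"
        by (simp add: PiE_def)
      fix \<phi> :: "'a \<Rightarrow> complex" assume \<phi>: "\<phi> \<in> test_functions"
      show "limitin euclidean (\<lambda>n. ?P n \<phi>) (lp_curve \<Psi> u 0 \<phi>) sequentially"
        unfolding P using \<phi> summable_LIMSEQ[OF summ[OF \<phi>, of 0]] by (simp add: lp_curve_def)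
    qed
    then show ?thesis
      unfolding has_working_trace_def distr_topology_def limitin_subtopology
      using curve_distr Pd by (auto intro: always_eventually)
  qed
qed

theorem theorem1p4:
  fixes n :: nat and s :: real and p q :: ereal and \<Psi> :: "real \<Rightarrow> real"
  assumes "n \<ge> 2" and "DIM('a::euclidean_space) = n - 1"
    and "cutoff \<Psi>"
    and "p > 0" and "q > 0"
    and "s \<ge> real_of_ereal (1 / p) + real (n - 1) * max (real_of_ereal (1 / p) - 1) 0"
    and "s = real_of_ereal (1 / p) + real (n - 1) * max (real_of_ereal (1 / p) - 1) 0 \<Longrightarrow> q \<le> 1"
  shows "distr_of_tempered ` (besov \<Psi> s p q :: (('a \<times> real \<Rightarrow> complex) \<Rightarrow> complex) set)
           \<subseteq> distr_of_curve ` continuous_curves \<and>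
         (\<forall>u \<in> (besov \<Psi> s p q :: (('a \<times> real \<Rightarrow> complex) \<Rightarrow> complex) set).
           \<forall>f \<in> continuous_curves. distr_of_curve f = distr_of_tempered u \<longrightarrow>
             has_working_trace \<Psi> u (f 0))"
proof (intro conjI ballI impI image_subsetI)
  fix u :: "('a \<times> real \<Rightarrow> complex) \<Rightarrow> complex" assume u: "u \<in> besov \<Psi> s p q"
  have crit: "s = real_of_ereal (1 / p) + real DIM('a) * max (real_of_ereal (1 / p) - 1) 0 \<longrightarrow> q \<le> 1"
    using assms(7) by (simp add: assms(2))
  note trace = lp_curve_trace[OF assms(3) u assms(4,5) assms(6)[folded assms(2)] crit]
  show "distr_of_tempered u \<in> distr_of_curve ` continuous_curves"
    unfolding trace(2)[symmetric] by (rule imageI[OF trace(1)])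
  fix f :: "real \<Rightarrow> ('a \<Rightarrow> complex) \<Rightarrow> complex"
  assume f: "f \<in> continuous_curves" and "distr_of_curve f = distr_of_tempered u"
  \<comment> \<open>The representing curve is unique, so the claim for an arbitrary f reduces to the
    one constructed from the blocks.\<close>
  then have "f = lp_curve \<Psi> u"
    by (intro distr_of_curve_inject[OF assms(3) f trace(1)]) (simp add: trace(2))
  then show "has_working_trace \<Psi> u (f 0)" using trace(3) by simp
qed

end
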